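(* Let $x>0$, $0<\theta,\psi<1$, and let $\nu\in\mathbb{C}\setminus\mathbb{Z}$ with $\Re(\nu)\geq 0$. Let $N$ be any integer with $N\geq\lfloor\frac{\Re(\nu)+1}{2}\rfloor$, and suppose $x\notin\{(n-\theta)(r-\psi):\ n,r\in\mathbb{N}\}$. Then \begin{align*} &8\pi x^{\nu/2}\sum_{n=1}^{\infty}n^{\nu/2}K_{\nu}(4\pi\sqrt{nx})\sum_{d\mid n}d^{-\nu}\cos(2\pi d\theta)\cos\left(\frac{2\pi n\psi}{d}\right)\\ &=-\frac{\pi x^{\nu}}{2\cos(\frac{\pi\nu}{2})}\bigl\{\zeta(1+\nu,\psi)+\zeta(1+\nu,1-\psi)\bigr\}-\frac{\pi}{2\cos(\frac{\pi\nu}{2})}\bigl(\zeta(1-\nu,\theta)+\zeta(1-\nu,1-\theta)\bigr)\\ &\quad+\frac{1}{2\sin(\frac{\pi\nu}{2})}\sum_{j=1}^{N}x^{2j-1}\bigl\{\zeta(2j,\psi)+\zeta(2j,1-\psi)\bigr\}\bigl\{\zeta(2j-\nu,\theta)+\zeta(2j-\nu,1-\theta)\bigr\}\\ &\quad+\frac{1}{2\sin(\frac{\pi\nu}{2})}x^{2N+1}\sum_{m,n\geq 0}\Bigl\{G(n+\psi,m+\theta)+G(n+1-\psi,m+\theta)+G(n+\psi,m+1-\theta)+G(n+1-\psi,m+1-\theta)\Bigr\}, \end{align*} where for $u,v>0$ with $uv\neq x$, \[ G(u,v)=u^{-\nu}\cdot\frac{(uv)^{\nu-2N}-x^{\nu-2N}}{(uv)^2-x^2}.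 \]
   Context: $K_\nu$ denotes the modified Bessel function of the second kind of order $\nu$. $\zeta(s,\alpha)$ is the Hurwitz zeta function ($\sum_{n\ge0}(n+\alpha)^{-s}$ for $\Re s>1$, meromorphically continued to $\mathbb{C}$). $\mathbb{N}=\{1,2,\dots\}$; the double sum runs over all pairs of non-negative integers $m,n$.
   Formalization: The hypothesis on x does not exclude uv = x in three of the four families of terms (e.g. x = θψ), where G(u,v) is undefined; there G(u,v) is taken to be its limit u^{-ν}(ν−2N)x^{ν−2N−2}/2. *)

theory Defs
  imports "HOL-Analysis.Analysis"
begin

text \<open>Hurwitz zeta function zeta(s,a) for a > 0: the unique function holomorphic on
  the complex plane minus 1 that agrees with the Dirichlet series for Re s > 1
  (the value at the pole s = 1 is fixed to 0 by convention).\<close>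
definition hurwitz_zeta :: "complex \<Rightarrow> real \<Rightarrow> complex" where
  "hurwitz_zeta s a =
     (THE f. f holomorphic_on (- {1}) \<and> f 1 = 0 \<and>
        (\<forall>w. 1 < Re w \<longrightarrow> f w = (\<Sum>n. (complex_of_real (real n + a)) powr (- w)))) s"

definition bessel_I :: "complex \<Rightarrow> real \<Rightarrow> complex" where
  "bessel_I nu z =
     (\<Sum>k. (complex_of_real (z / 2)) powr (2 * of_nat k + nu) * rGamma (of_nat k + nu + 1)
            / of_nat (fact k))"

definition bessel_K_aux :: "complex \<Rightarrow> real \<Rightarrow> complex" where
  "bessel_K_aux nu z = of_real pi / 2 * (bessel_I (- nu) z - bessel_I nu z) / sin (nu * of_real pi)"

definition bessel_K :: "complex \<Rightarrow> real \<Rightarrow> complex" where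
  "bessel_K nu z = (if nu \<in> \<int> then Lim (at nu) (\<lambda>mu. bessel_K_aux mu z) else bessel_K_aux nu z)"

text \<open>The function G(u,v) of the theorem; at u v = x it takes the value of its
  continuous (removable-singularity) extension.\<close>
definition G_fun :: "real \<Rightarrow> complex \<Rightarrow> nat \<Rightarrow> real \<Rightarrow> real \<Rightarrow> complex" where
  "G_fun x nu N u v =
     (if u * v = x then
        (complex_of_real u) powr (- nu) * (nu - 2 * of_nat N)
          * (complex_of_real x) powr (nu - 2 * of_nat N - 2) / 2
      else (complex_of_real u) powr (- nu) *
        (((complex_of_real (u * v)) powr (nu - 2 * of_nat N) - (complex_of_real x) powr (nu - 2 * of_nat N))
          / complex_of_real ((u * v)\<^sup>2 - x\<^sup>2)))"

end

(* Writing 2 (b/a)^(nu/2) K_nu(2 sqrt(a b)) as the integral of t^(nu-1) exp(-a t - b/t) turns the series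
   into the Mellin transform  L(nu) = 4 pi * integral t^(nu-1) C(t, theta) C(x/t, psi) dt,  where
   C(t, q) = sum_{d >= 1} exp(-2 pi d t) cos(2 pi d q).  C decays exponentially at infinity and is bounded
   at 0, so L is entire.  The partial fraction expansion of the cotangent gives
   C(t, q) = -1/2 + (1/(2 pi)) sum_v t/(t^2 + v^2), with v running through m + q and m + 1 - q.

   For real 0 < nu < 1 both expansions can be inserted and integrated termwise: the constant -1/2 paired
   with C(t, theta) gives the terms zeta(1 - nu, .) (Hurwitz's formula), paired with the psi-sum it gives
   zeta(1 + nu, .), and the product of the two sums gives the double sum over G with N = 0.
   Passing from N to N + 1 in the double sum splits off a product of two Hurwitz zeta values.
   Both sides are holomorphic for -1 < Re nu < 2 N + 1 away from the integers, so the identity theorem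
   gives the claim. *)

theory Submission
  imports Defs "HOL-Complex_Analysis.Complex_Analysis"
begin

section \<open>Holomorphic parameter integrals\<close>

text \<open>Substituting \<open>t = exp y\<close> throughout turns every Mellin transform into an
  integral over the whole line, where t -> a t and t -> x/t become affine maps. All pieces converge
  for 0 < \<nu> < 1: C(t, \<theta>) tends to -1/2 at 0, so its transform needs \<nu> > 0; the
  \<psi>-sum at x/t is bounded at 0 and O(1/t) at infinity, so it needs 0 < \<nu> < 1. Two
  definitions have to be made usable. \<open>hurwitz_zeta\<close> is a definite description, so a
  continuation must be constructed and shown unique. \<open>bessel_K\<close> combines two power
  series while the proof wants an integral; in place of asymptotics of solutions of Bessel's
  equation, first-order recurrences and two Wronskian identities give linear equations that
  determine that integral. Hurwitz's formula is not presupposed: it results from integrating the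
  cotangent expansion for -1 < s < 0 and continuing in s. The value of \<open>G_fun\<close> at u v =
  x is the one the corresponding integral produces, up to a common factor, when two quadratic
  denominators coincide.\<close>

lemma has_field_derivative_integral_dominated:
  fixes F :: "complex \<Rightarrow> 'a \<Rightarrow> complex"
  assumes S: "open S" "s \<in> S"
    and meas: "\<And>z. z \<in> S \<Longrightarrow> F z \<in> borel_measurable M"
    and holo: "\<And>t. t \<in> space M \<Longrightarrow> (\<lambda>z. F z t) holomorphic_on S"
    and dom: "\<exists>r>0. \<exists>g :: 'a \<Rightarrow> real. integrable M g \<and> (\<forall>z\<in>ball s r \<inter> S. \<forall>t\<in>space M. norm (F z t) \<le> g t)"
  shows "((\<lambda>z. \<integral>t. F z t \<partial>M) has_field_derivative (\<integral>t. deriv (\<lambda>z. F z t) s \<partial>M)) (at s)"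
proof -
  obtain r0 g where r0: "r0 > 0" and g: "integrable M g"
    and bd0: "\<And>z t. z \<in> ball s r0 \<inter> S \<Longrightarrow> t \<in> space M \<Longrightarrow> norm (F z t) \<le> g t"
    using dom by blast
  obtain r1 where r1: "r1 > 0" "ball s r1 \<subseteq> S"
    using S openE by blast
  \<comment> \<open>With a quarter of the radius, the closed disc of radius \<open>r\<close> around
    any point of \<open>ball s r\<close> stays inside both given balls.\<close>
  define r where "r = min r0 r1 / 4"
  have r: "r > 0" using r0 r1 by (simp add: r_def)
  have sub: "z \<in> S \<inter> ball s r0" if "dist s z < 4 * r" for z
    using that r1 by (auto simp: r_def)
  have deriv_bd: "norm (deriv (\<lambda>z. F z t) z) \<le> g t / r" if t: "t \<in> space M" and z: "z \<in> ball s r" for t z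
  proof -
    have in4: "w \<in> S \<inter> ball s r0" if "w \<in> cball z r" for w
    proof (rule sub)
      have "dist s w \<le> dist s z + dist z w" by (rule dist_triangle)
      also have "\<dots> < 4 * r" using that z r by auto
      finally show "dist s w < 4 * r" .
    qed
    have 1: "(\<lambda>w. F w t) holomorphic_on cball z r"
      by (rule holomorphic_on_subset[OF holo[OF t]]) (use in4 in auto)
    \<comment> \<open>Cauchy's estimate bounds the derivative by \<open>g t / r\<close>, so a
      dominating function for \<open>F\<close> itself suffices.\<close>
    have "norm ((deriv ^^ 1) (\<lambda>w. F w t) z) \<le> fact 1 * g t / r ^ 1"
    proof (rule Cauchy_inequality)
      show "(\<lambda>w. F w t) holomorphic_on ball z r" "continuous_on (cball z r) (\<lambda>w. F w t)"
        using 1 holomorphic_on_imp_continuous_on holomorphic_on_subset ball_subset_cball by blast+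
      show "norm (F x t) \<le> g t" if "norm (z - x) = r" for x
        by (rule bd0[OF _ t]) (use in4[of x] that in \<open>auto simp: dist_norm\<close>)
    qed (use r in auto)
    then show ?thesis by simp
  qed
  have int: "integrable M (F z)" if "z \<in> ball s r" for z
  proof (rule Bochner_Integration.integrable_bound[OF g])
    show "F z \<in> borel_measurable M" using meas sub[of z] that r by auto
    have "norm (F z t) \<le> norm (g t)" if "t \<in> space M" for t
      using bd0[of z t] sub[of z] that \<open>z \<in> ball s r\<close> r by force
    then show "AE t in M. norm (F z t) \<le> norm (g t)" by simp
  qed
  show ?thesis
    unfolding has_field_derivative_iff tendsto_at_iff_sequentially comp_def
  proof (intro allI impI)
    fix X assume X: "\<forall>i. X i \<in> UNIV - {s}" "X \<longlonglongrightarrow> s"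
    have ev: "eventually (\<lambda>n. X n \<in> ball s r) sequentially"
      using X(2) r by (auto simp: tendsto_iff dist_commute)
    then obtain n0 where n0: "\<And>n. n \<ge> n0 \<Longrightarrow> X n \<in> ball s r"
      by (auto simp: eventually_sequentially)
    \<comment> \<open>Domination is demanded for every index, so the finitely many terms outside
      \<open>ball s r\<close> are dropped.\<close>
    define Y where "Y = (\<lambda>n. X (n + n0))"
    have Y: "Y n \<in> ball s r" "Y n \<noteq> s" for n using n0 X(1) by (auto simp: Y_def)
    have Ylim: "Y \<longlonglongrightarrow> s" unfolding Y_def by (rule LIMSEQ_ignore_initial_segment[OF X(2)])
    have q: "(\<lambda>n. \<integral>t. (F (Y n) t - F s t) / (Y n - s) \<partial>M) \<longlonglongrightarrow> (\<integral>t. deriv (\<lambda>z. F z t) s \<partial>M)"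
    proof (rule integral_dominated_convergence)
      show "integrable M (\<lambda>t. g t / r)" using g by simp
      have qm: "(\<lambda>t. (F (Y n) t - F s t) / (Y n - s)) \<in> borel_measurable M" for n
        using meas[of s] meas[of "Y n"] S sub[of "Y n"] Y(1)[of n] r by auto
      then show "\<And>n. (\<lambda>t. (F (Y n) t - F s t) / (Y n - s)) \<in> borel_measurable M" .
      have lim: "(\<lambda>n. (F (Y n) t - F s t) / (Y n - s)) \<longlonglongrightarrow> deriv (\<lambda>z. F z t) s" if t: "t \<in> space M" for t
      proof -
        have "((\<lambda>z. F z t) has_field_derivative deriv (\<lambda>z. F z t) s) (at s)"
          using holomorphic_derivI[OF holo[OF t]] S by auto
        then show ?thesis
          using Ylim Y(2) unfolding has_field_derivative_iff tendsto_at_iff_sequentially comp_def by auto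
      qed
      then show "AE t in M. (\<lambda>n. (F (Y n) t - F s t) / (Y n - s)) \<longlonglongrightarrow> deriv (\<lambda>z. F z t) s" by simp
      show "(\<lambda>t. deriv (\<lambda>z. F z t) s) \<in> borel_measurable M"
        by (rule borel_measurable_LIMSEQ_metric[where f="\<lambda>n t. (F (Y n) t - F s t) / (Y n - s)"])
           (use qm lim in auto)
      have "norm ((F (Y n) t - F s t) / (Y n - s)) \<le> g t / r" if t: "t \<in> space M" for n t
      proof -
        \<comment> \<open>The ball is convex, so the mean value inequality carries the bound from
          the derivative to the difference quotients.\<close>
        have "norm (F (Y n) t - F s t) \<le> g t / r * norm (Y n - s)"
        proof (rule field_differentiable_bound[where S="ball s r"])
          fix z assume z: "z \<in> ball s r"
          have "z \<in> S" using sub[of z] z r by auto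
          then have "((\<lambda>z. F z t) has_field_derivative deriv (\<lambda>z. F z t) z) (at z)"
            using holomorphic_derivI[OF holo[OF t]] S by auto
          then show "((\<lambda>z. F z t) has_field_derivative deriv (\<lambda>z. F z t) z) (at z within ball s r)"
            by (rule DERIV_subset) auto
          show "norm (deriv (\<lambda>z. F z t) z) \<le> g t / r" by (rule deriv_bd[OF t z])
        qed (use Y r in auto)
        then show ?thesis using Y(2)[of n] by (simp add: norm_divide pos_divide_le_eq)
      qed
      then show "\<And>n. AE t in M. norm ((F (Y n) t - F s t) / (Y n - s)) \<le> g t / r" by simp
    qed
    have eq: "(\<integral>t. (F (Y n) t - F s t) / (Y n - s) \<partial>M) = ((\<integral>t. F (Y n) t \<partial>M) - (\<integral>t. F s t \<partial>M)) / (Y n - s)" for n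
      using Bochner_Integration.integral_diff[OF int[OF Y(1)] int[of s]] r by auto
    have "(\<lambda>n. ((\<integral>t. F (Y n) t \<partial>M) - (\<integral>t. F s t \<partial>M)) / (Y n - s)) \<longlonglongrightarrow> (\<integral>t. deriv (\<lambda>z. F z t) s \<partial>M)"
      using q unfolding eq .
    then show "(\<lambda>n. ((\<integral>t. F (X n) t \<partial>M) - (\<integral>t. F s t \<partial>M)) / (X n - s)) \<longlonglongrightarrow> (\<integral>t. deriv (\<lambda>z. F z t) s \<partial>M)"
      unfolding Y_def by (rule LIMSEQ_offset)
  qed
qed

lemma holomorphic_integral_dominated:
  fixes F :: "complex \<Rightarrow> 'a \<Rightarrow> complex"
  assumes S: "open S"
    and meas: "\<And>z. z \<in> S \<Longrightarrow> F z \<in> borel_measurable M"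
    and holo: "\<And>t. t \<in> space M \<Longrightarrow> (\<lambda>z. F z t) holomorphic_on S"
    and dom: "\<And>s. s \<in> S \<Longrightarrow> \<exists>r>0. \<exists>g :: 'a \<Rightarrow> real. integrable M g \<and> (\<forall>z\<in>ball s r \<inter> S. \<forall>t\<in>space M. norm (F z t) \<le> g t)"
  shows "(\<lambda>z. \<integral>t. F z t \<partial>M) holomorphic_on S"
  unfolding holomorphic_on_open[OF S]
  using has_field_derivative_integral_dominated[OF S _ meas holo dom] by blast

section \<open>The Hurwitz zeta function\<close>

lemma norm_of_real_powr: "0 < x \<Longrightarrow> norm (complex_of_real x powr s) = x powr Re s"
  by (simp add: norm_powr_real_powr)

lemma summable_hurwitz:
  assumes "1 < Re s" "0 < a"
  shows "summable (\<lambda>n. norm (complex_of_real (real n + a) powr (- s)))"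
proof (subst summable_Suc_iff[symmetric], rule summable_comparison_test)
  show "summable (\<lambda>n. real (Suc n) powr (- Re s))"
    using assms by (subst summable_Suc_iff) (simp add: summable_real_powr_iff)
  have "norm (norm (complex_of_real (real (Suc n) + a) powr (- s))) \<le> real (Suc n) powr (- Re s)" for n
    using assms by (subst norm_of_real_powr) (auto intro!: powr_mono2')
  then show "\<exists>N. \<forall>n\<ge>N. norm (norm (complex_of_real (real (Suc n) + a) powr (- s))) \<le> real (Suc n) powr (- Re s)"
    by blast
qed

text \<open>The n = 0 term \<open>a powr (- s)\<close> is left out because it blows up as a tends to
  0. The other terms are at most (n+1)^(-\<sigma>) for all a > 0 at once; the head is added back by
  \<open>suminf_hurwitz_split\<close>.\<close>

lemma hurwitz_uniform_limit:
  assumes "1 < \<sigma>"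
  shows "uniform_limit ({s. \<sigma> < Re s} \<times> {0<..})
           (\<lambda>N p. \<Sum>n<N. complex_of_real (real (Suc n) + snd p) powr (- fst p))
           (\<lambda>p. \<Sum>n. complex_of_real (real (Suc n) + snd p) powr (- fst p)) sequentially"
proof (rule Weierstrass_m_test)
  show "summable (\<lambda>n. real (Suc n) powr (- \<sigma>))"
    using assms by (subst summable_Suc_iff) (simp add: summable_real_powr_iff)
  fix n and p :: "complex \<times> real" assume p: "p \<in> {s. \<sigma> < Re s} \<times> {0<..}"
  have "norm (complex_of_real (real (Suc n) + snd p) powr (- fst p)) = (real (Suc n) + snd p) powr (- Re (fst p))"
    using p by (subst norm_of_real_powr) auto
  also have "\<dots> \<le> (real (Suc n) + snd p) powr (- \<sigma>)"
    using p by (intro powr_mono) auto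
  also have "\<dots> \<le> real (Suc n) powr (- \<sigma>)"
    using p assms by (intro powr_mono2') auto
  finally show "norm (complex_of_real (real (Suc n) + snd p) powr (- fst p)) \<le> real (Suc n) powr (- \<sigma>)" .
qed

lemma continuous_on_of_real_powr [continuous_intros]:
  assumes "continuous_on A f" "continuous_on A g" "\<And>p. p \<in> A \<Longrightarrow> 0 < f p"
  shows "continuous_on A (\<lambda>p. complex_of_real (f p) powr (g p))"
proof (rule continuous_on_powr_complex)
  show "A \<subseteq> {z. Re (complex_of_real (f z)) \<ge> 0 \<or> Im (complex_of_real (f z)) \<noteq> 0}"
    using assms(3) by (auto intro: less_imp_le)
  show "\<And>z. z \<in> A \<Longrightarrow> complex_of_real (f z) = 0 \<Longrightarrow> 0 < Re (g z)"
    using assms(3) by fastforce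
qed (use assms in \<open>auto intro: continuous_intros\<close>)

lemma suminf_hurwitz_split:
  assumes "1 < Re s" "0 < a"
  shows "(\<Sum>n. complex_of_real (real n + a) powr (- s)) =
     of_real a powr (- s) + (\<Sum>n. complex_of_real (real (Suc n) + a) powr (- s))"
  using suminf_split_head[OF summable_norm_cancel[OF summable_hurwitz[OF assms]]] by simp

text \<open>Continuity is wanted jointly in s and a, because the continuation in s integrates over
  a.\<close>

lemma continuous_on_hurwitz_series:
  "continuous_on ({s. 1 < Re s} \<times> {0<..}) (\<lambda>p. \<Sum>n. complex_of_real (real n + snd p) powr (- fst p))"
  (is "continuous_on _ ?Z")
proof (subst continuous_on_eq_continuous_at)
  show op: "open ({s. 1 < Re s} \<times> {0::real<..})"
    by (intro open_Times open_halfspace_Re_gt) auto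
  show "\<forall>p\<in>{s. 1 < Re s} \<times> {0<..}. isCont ?Z p"
  proof
    fix p :: "complex \<times> real" assume p: "p \<in> {s. 1 < Re s} \<times> {0<..}"
    define \<sigma> where "\<sigma> = (1 + Re (fst p)) / 2"
    have \<sigma>: "1 < \<sigma>" "\<sigma> < Re (fst p)" using p by (auto simp: \<sigma>_def field_simps)
    let ?U = "{s. \<sigma> < Re s} \<times> {0::real<..}"
    have U: "open ?U" "p \<in> ?U" using p \<sigma> by (auto intro!: open_Times open_halfspace_Re_gt)
    have "continuous_on ?U (\<lambda>p. \<Sum>n. complex_of_real (real (Suc n) + snd p) powr (- fst p))"
      by (rule uniform_limit_theorem[OF _ hurwitz_uniform_limit[OF \<sigma>(1)]])
         (auto simp del: of_nat_Suc of_real_add intro!: always_eventually continuous_intros continuous_on_of_real_powr)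
    moreover have "continuous_on ?U (\<lambda>p. of_real (snd p) powr (- fst p))"
      by (auto intro!: continuous_intros continuous_on_of_real_powr)
    ultimately have "continuous_on ?U (\<lambda>p. of_real (snd p) powr (- fst p) + (\<Sum>n. complex_of_real (real (Suc n) + snd p) powr (- fst p)))"
      by (rule continuous_on_add[rotated])
    then have "continuous_on ?U ?Z"
      by (rule continuous_on_eq) (rule suminf_hurwitz_split[symmetric], use \<sigma> in auto)
    then show "isCont ?Z p"
      using U continuous_on_eq_continuous_at by blast
  qed
qed

lemma holomorphic_hurwitz_series:
  assumes a: "0 < a"
  shows "(\<lambda>s. \<Sum>n. complex_of_real (real n + a) powr (- s)) holomorphic_on {s. 1 < Re s}"
proof -
  let ?P = "\<lambda>N s. \<Sum>n<N. complex_of_real (real (Suc n) + a) powr (- s)"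
  let ?Z = "\<lambda>s. \<Sum>n. complex_of_real (real (Suc n) + a) powr (- s)"
  have "?Z holomorphic_on {s. 1 < Re s}"
  proof (rule holomorphic_uniform_sequence)
    show "open {s. 1 < Re s}" by (rule open_halfspace_Re_gt)
    show "(\<lambda>s. \<Sum>n<N. complex_of_real (real (Suc n) + a) powr (- s)) holomorphic_on {s. 1 < Re s}" for N
      using a by (auto intro!: holomorphic_intros)
    fix s :: complex assume s: "s \<in> {s. 1 < Re s}"
    define \<sigma> where "\<sigma> = (1 + Re s) / 2"
    have \<sigma>: "1 < \<sigma>" "\<sigma> < Re s" using s by (auto simp: \<sigma>_def field_simps)
    have "open {s. \<sigma> < Re s}" by (rule open_halfspace_Re_gt)
    then obtain d where d: "d > 0" "cball s d \<subseteq> {s. \<sigma> < Re s}"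
      using \<sigma> open_contains_cball by blast
    have "uniform_limit (cball s d) ?P
         ?Z sequentially"
      using uniform_limit_compose'[OF hurwitz_uniform_limit[OF \<sigma>(1)], of "\<lambda>s. (s, a)" "cball s d"] d a by auto
    then show "\<exists>d>0. cball s d \<subseteq> {s. 1 < Re s} \<and>
        uniform_limit (cball s d) ?P
         ?Z sequentially"
      using d \<sigma> by (intro exI[of _ d]) auto
  qed
  then have "(\<lambda>s. of_real a powr (- s) + (\<Sum>n. complex_of_real (real (Suc n) + a) powr (- s))) holomorphic_on {s. 1 < Re s}"
    using a by (auto intro!: holomorphic_intros)
  then show ?thesis
    by (rule holomorphic_transform) (rule suminf_hurwitz_split[symmetric], use a in auto)
qed

section \<open>Continuation of the Hurwitz zeta function in s by integration by parts\<close>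

lemma hurwitz_term_integral:
  assumes b: "0 < b" and s: "s \<noteq> 1"
  shows "((\<lambda>w. of_real (1 - w) * (s * complex_of_real (b + w) powr (- s - 1))) has_integral
      (of_real b powr (- s) + (of_real b powr (1 - s) - of_real (b + 1) powr (1 - s)) / (1 - s))) {0..1}"
proof -
  \<comment> \<open>\<open>F\<close> comes from integrating 1 - w by parts against the derivative of
    -(b + w)^(-s). The weight vanishes at w = 1, so the boundary contributes b^(-s) only.\<close>
  define F where "F = (\<lambda>z. - (1 - z) * (of_real b + z) powr (- s) - (of_real b + z) powr (1 - s) / (1 - s))"
  have "((\<lambda>w. of_real (1 - w) * (s * complex_of_real (b + w) powr (- s - 1))) has_integral
     (F (of_real 1) - F (of_real 0))) {0..1}"
  proof (rule fundamental_theorem_of_calculus)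
    fix w :: real assume w: "w \<in> {0..1}"
    have "(1 - s) * (1 - s) \<noteq> 0" using s by simp
    moreover have "(1 - s) * (1 - s) = 1 + s * s - s * 2" by (simp add: algebra_simps)
    ultimately have s': "1 + s * s - s * 2 \<noteq> 0" by simp
    have nz: "of_real b + complex_of_real w \<notin> \<real>\<^sub>\<le>\<^sub>0"
      using b w by (simp add: complex_nonpos_Reals_iff)
    have "(F has_field_derivative of_real (1 - w) * (s * complex_of_real (b + w) powr (- s - 1))) (at (of_real w))"
      unfolding F_def using nz s s'
      by (auto intro!: derivative_eq_intros simp: algebra_simps) (simp add: divide_simps, simp add: algebra_simps)
    then show "((\<lambda>x. F (complex_of_real x)) has_vector_derivative
        of_real (1 - w) * (s * complex_of_real (b + w) powr (- s - 1))) (at w within {0..1})"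
      by (rule has_vector_derivative_real_field)
  qed auto
  moreover have "F (of_real 1) - F (of_real 0) = of_real b powr (- s) + (of_real b powr (1 - s) - of_real (b + 1) powr (1 - s)) / (1 - s)"
    by (simp add: F_def diff_divide_distrib)
  ultimately show ?thesis by simp
qed

text \<open>The term integrals are summed over b = n + a. Their parts (b^(1-s) - (b+1)^(1-s)) / (1 -
  s) telescope, and the far end tends to 0 since Re s > 1.\<close>

lemma hurwitz_series_shift:
  assumes s: "1 < Re s" and a: "0 < a"
  shows "((\<lambda>w. of_real (1 - w) * (s * (\<Sum>n. complex_of_real (real n + (a + w)) powr (- s - 1)))) has_integral
     ((\<Sum>n. complex_of_real (real n + a) powr (- s)) + of_real a powr (1 - s) / (1 - s))) {0..1}"
proof -
  have s1: "s \<noteq> 1" using s by auto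
  let ?f = "\<lambda>n w. of_real (1 - w) * (s * complex_of_real (real n + (a + w)) powr (- s - 1))"
  let ?I = "\<lambda>n. of_real (real n + a) powr (- s) + (of_real (real n + a) powr (1 - s) - of_real (real (Suc n) + a) powr (1 - s)) / (1 - s)"
  have I: "(?f n has_integral ?I n) {0..1}" for n
    using hurwitz_term_integral[of "real n + a" s] a s1 by (simp add: add_ac)
  \<comment> \<open>The powers decrease in w, so their values at w = 0, a convergent series with
    exponent s + 1, dominate and the sum may be exchanged with the integral.\<close>
  have ul: "uniform_limit {0..1} (\<lambda>N w. \<Sum>n<N. ?f n w) (\<lambda>w. \<Sum>n. ?f n w) sequentially"
  proof (rule Weierstrass_m_test)
    show "summable (\<lambda>n. norm s * norm (complex_of_real (real n + a) powr (- (s + 1))))"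
      using s a by (intro summable_mult summable_hurwitz) auto
    fix n w assume w: "w \<in> {0..(1::real)}"
    have "norm (complex_of_real (real n + (a + w)) powr (- s - 1)) \<le> norm (complex_of_real (real n + a) powr (- (s + 1)))"
      using w a s by (subst (1 2) norm_of_real_powr) (auto intro!: powr_mono2')
    moreover have "norm (complex_of_real (1 - w)) \<le> 1" using w by (subst norm_of_real) auto
    ultimately show "norm (?f n w) \<le> norm s * norm (complex_of_real (real n + a) powr (- (s + 1)))"
      unfolding norm_mult using mult_mono[of "norm (complex_of_real (1 - w))" 1 "norm s * norm (complex_of_real (real n + (a + w)) powr (- s - 1))"]
      by (simp add: mult_left_mono del: of_real_diff of_real_add)
  qed
  have co: "continuous_on {0..1} (\<lambda>w. \<Sum>n<N. ?f n w)" for N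
    using a by (intro continuous_intros continuous_on_of_real_powr) auto
  obtain I' J where IJ: "\<And>N. ((\<lambda>w. \<Sum>n<N. ?f n w) has_integral I' N) {0..1}"
      "((\<lambda>w. \<Sum>n. ?f n w) has_integral J) {0..1}" "I' \<longlonglongrightarrow> J"
    using uniform_limit_integral[OF ul co] by auto
  have I'eq: "I' N = (\<Sum>n<N. ?I n)" for N
    using has_integral_unique[OF IJ(1) has_integral_sum[OF finite_lessThan I]] by simp
  have "(\<lambda>N. (\<Sum>n<N. of_real (real n + a) powr (- s)) +
      (of_real a powr (1 - s) - of_real (real N + a) powr (1 - s)) / (1 - s)) \<longlonglongrightarrow>
      (\<Sum>n. complex_of_real (real n + a) powr (- s)) + (of_real a powr (1 - s) - 0) / (1 - s)"
  proof (intro tendsto_intros)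
    show "(\<lambda>N. \<Sum>n<N. of_real (real n + a) powr (- s)) \<longlonglongrightarrow> (\<Sum>n. complex_of_real (real n + a) powr (- s))"
      using summable_LIMSEQ[OF summable_norm_cancel[OF summable_hurwitz[OF assms]]] .
    have "(\<lambda>N. norm (complex_of_real (real N + a) powr (1 - s))) \<longlonglongrightarrow> 0"
    proof -
      have "(\<lambda>N. (real N + a) powr (Re (1 - s))) \<longlonglongrightarrow> 0"
        using s by (intro tendsto_neg_powr filterlim_at_top_add_at_top filterlim_tendsto_add_at_top tendsto_const filterlim_real_sequentially
           filterlim_at_top_mono[OF filterlim_real_sequentially]) (auto intro!: always_eventually simp: a less_imp_le)
      then show ?thesis using a by (subst norm_of_real_powr) auto
    qed
    then show "(\<lambda>N. complex_of_real (real N + a) powr (1 - s)) \<longlonglongrightarrow> 0"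
      by (rule tendsto_norm_zero_cancel)
  qed (use s1 in auto)
  moreover have "(\<Sum>n<N. ?I n) = (\<Sum>n<N. of_real (real n + a) powr (- s)) +
      (of_real a powr (1 - s) - of_real (real N + a) powr (1 - s)) / (1 - s)" for N
    by (induction N) (auto simp: diff_divide_distrib add_ac)
  ultimately have "I' \<longlonglongrightarrow> (\<Sum>n. complex_of_real (real n + a) powr (- s)) + of_real a powr (1 - s) / (1 - s)"
    unfolding I'eq[abs_def] by simp
  then have J: "J = (\<Sum>n. complex_of_real (real n + a) powr (- s)) + of_real a powr (1 - s) / (1 - s)"
    using IJ(3) LIMSEQ_unique by blast
  have "((\<lambda>w. of_real (1 - w) * (s * (\<Sum>n. complex_of_real (real n + (a + w)) powr (- s - 1)))) has_integral J) {0..1}"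
  proof (rule has_integral_eq[OF _ IJ(2)])
    fix w assume w: "w \<in> {0..(1::real)}"
    have "summable (\<lambda>n. complex_of_real (real n + (a + w)) powr (- (s + 1)))"
      using summable_norm_cancel[OF summable_hurwitz[of "s + 1" "a + w"]] s a w by auto
    then have "summable (\<lambda>n. complex_of_real (real n + (a + w)) powr (- s - 1))" by simp
    then show "(\<Sum>n. ?f n w) = of_real (1 - w) * (s * (\<Sum>n. complex_of_real (real n + (a + w)) powr (- s - 1)))"
      by (simp add: suminf_mult summable_mult)
  qed
  then show ?thesis unfolding J .
qed

text \<open>For \<open>Re s > 1 - k\<close> this is \<open>(s - 1) \<zeta>(s, a)\<close>. The recursion is an integration by parts in
  \<open>\<integral> \<zeta>(s, y) dy = a\<^sup>1\<^sup>-\<^sup>s / (s - 1)\<close> over \<open>[a, a + 1]\<close>, because \<open>\<zeta>(s, a)\<close> has the derivative \<open>- s \<zeta>(s + 1, a)\<close> in \<open>a\<close>.\<close>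
primrec hurwitz_aux :: "nat \<Rightarrow> complex \<Rightarrow> real \<Rightarrow> complex" where
  "hurwitz_aux 0 s a = (s - 1) * (\<Sum>n. complex_of_real (real n + a) powr (- s))"
| "hurwitz_aux (Suc k) s a = of_real a powr (1 - s) +
     (s - 1) * integral (cbox 0 1) (\<lambda>w. of_real (1 - w) * hurwitz_aux k (s + 1) (a + w))"

text \<open>The exponent s + 1 inside the integral lies in the half-plane of index k exactly when s
  lies in that of index k + 1, so the induction carries the identity one unit further left each
  time. The base case is \<open>hurwitz_series_shift\<close>.\<close>

lemma hurwitz_aux_Suc: "1 - real k < Re s \<Longrightarrow> 0 < a \<Longrightarrow> hurwitz_aux (Suc k) s a = hurwitz_aux k s a"
proof (induction k arbitrary: s a)
  case 0
  then have "s \<noteq> 1" by auto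
  have "- (s + 1) = - s - 1" by simp
  then have "integral (cbox 0 1) (\<lambda>w. of_real (1 - w) * hurwitz_aux 0 (s + 1) (a + w)) =
      integral {0..1} (\<lambda>w. of_real (1 - w) * (s * (\<Sum>n. complex_of_real (real n + (a + w)) powr (- s - 1))))"
    by (simp only: hurwitz_aux.simps add_diff_cancel_right' cbox_interval)
  also have "\<dots> = (\<Sum>n. complex_of_real (real n + a) powr (- s)) + of_real a powr (1 - s) / (1 - s)"
    by (rule integral_unique[OF hurwitz_series_shift]) (use 0 in auto)
  finally have eq: "integral (cbox 0 1) (\<lambda>w. of_real (1 - w) * hurwitz_aux 0 (s + 1) (a + w)) =
      (\<Sum>n. complex_of_real (real n + a) powr (- s)) + of_real a powr (1 - s) / (1 - s)" .
  show ?case unfolding hurwitz_aux.simps(2)[of 0] eq using \<open>s \<noteq> 1\<close> by (simp add: field_simps)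
next
  case (Suc k)
  have "integral (cbox 0 1) (\<lambda>w. of_real (1 - w) * hurwitz_aux (Suc k) (s + 1) (a + w)) =
     integral (cbox 0 1) (\<lambda>w. of_real (1 - w) * hurwitz_aux k (s + 1) (a + w))"
    by (intro integral_cong arg_cong2[of _ _ _ _ "(*)"] refl Suc.IH) (use Suc.prems in auto)
  then show ?case by (simp only: hurwitz_aux.simps)
qed

text \<open>Joint continuity keeps the recursion integral continuous in its parameters; on compact
  sets it also supplies the bound that dominates the integrand in the proof of holomorphy.\<close>

lemma continuous_on_hurwitz_aux:
  "continuous_on ({s. 1 - real k < Re s} \<times> {0<..}) (\<lambda>p. hurwitz_aux k (fst p) (snd p))"
proof (induction k)
  case 0
  then show ?case using continuous_on_hurwitz_series by (auto intro!: continuous_intros)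
next
  case (Suc k)
  let ?U = "{s. 1 - real (Suc k) < Re s} \<times> {0::real<..}"
  have "continuous_on ?U (\<lambda>p. integral (cbox 0 1) (\<lambda>w. of_real (1 - w) * hurwitz_aux k (fst p + 1) (snd p + w)))"
  proof (rule integral_continuous_on_param)
    have "continuous_on (?U \<times> cbox 0 1) (\<lambda>q. hurwitz_aux k (fst (fst (fst q) + 1, snd (fst q) + snd q)) (snd (fst (fst q) + 1, snd (fst q) + snd q)))"
      by (rule continuous_on_compose2[OF Suc.IH]) (auto intro!: continuous_intros)
    then show "continuous_on (?U \<times> cbox 0 1) (\<lambda>(p, w). of_real (1 - w) * hurwitz_aux k (fst p + 1) (snd p + w))"
      by (auto simp: case_prod_unfold intro!: continuous_intros)
  qed
  then show ?case
    by (auto intro!: continuous_intros continuous_on_of_real_powr)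
qed

lemma holomorphic_hurwitz_aux:
  "0 < a \<Longrightarrow> (\<lambda>s. hurwitz_aux k s a) holomorphic_on {s. 1 - real k < Re s}"
proof (induction k arbitrary: a)
  case 0
  then show ?case using holomorphic_hurwitz_series by (auto intro!: holomorphic_intros)
next
  case (Suc k)
  let ?U = "{s. 1 - real (Suc k) < Re s}"
  let ?f = "\<lambda>s w. of_real (1 - w) * hurwitz_aux k (s + 1) (a + w)"
  have op: "open ?U" by (rule open_halfspace_Re_gt)
  have joint: "continuous_on (?U \<times> {0..1}) (\<lambda>q. ?f (fst q) (snd q))"
  proof -
    have "continuous_on (?U \<times> {0..1}) (\<lambda>q. hurwitz_aux k (fst (fst q + 1, a + snd q)) (snd (fst q + 1, a + snd q)))"
      by (rule continuous_on_compose2[OF continuous_on_hurwitz_aux]) (use Suc.prems in \<open>auto intro!: continuous_intros\<close>)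
    then show ?thesis by (auto intro!: continuous_intros)
  qed
  have slice: "continuous_on {0..1} (?f s)" if "s \<in> ?U" for s
  proof -
    have "continuous_on {0..1} (\<lambda>w. ?f (fst (s, w)) (snd (s, w)))"
    proof (rule continuous_on_compose2[OF joint])
      show "continuous_on {0..1} (\<lambda>w. (s, w))" by (intro continuous_intros)
      show "(\<lambda>w. (s, w)) ` {0..1} \<subseteq> ?U \<times> {0..1}"
        by (intro image_subsetI SigmaI that)
    qed
    then show ?thesis unfolding fst_conv snd_conv .
  qed
  \<comment> \<open>The gauge integral over [0, 1] is rewritten as a Lebesgue integral with an
    indicator, the form to which the result on dominated parameter integrals applies.\<close>
  have "(\<lambda>s. \<integral>w. indicator {0..1} w *\<^sub>R ?f s w \<partial>lborel) holomorphic_on ?U"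
  proof (rule holomorphic_integral_dominated[OF op])
    show "(\<lambda>w. indicator {0..1} w *\<^sub>R ?f s w) \<in> borel_measurable lborel" if "s \<in> ?U" for s
      using borel_measurable_continuous_on_indicator[OF _ slice[OF that]] by simp
    show "(\<lambda>s. indicator {0..1} w *\<^sub>R ?f s w) holomorphic_on ?U" for w
    proof (cases "w \<in> {0..1}")
      case True
      have "((\<lambda>s. hurwitz_aux k s (a + w)) \<circ> (\<lambda>s. s + 1)) holomorphic_on ?U"
        by (rule holomorphic_on_compose_gen[OF _ Suc.IH]) (use True Suc.prems in \<open>auto intro!: holomorphic_intros\<close>)
      then have "(\<lambda>s. hurwitz_aux k (s + 1) (a + w)) holomorphic_on ?U" by (simp add: o_def)
      then show ?thesis using True by (auto intro!: holomorphic_intros)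
    qed auto
    fix s assume s: "s \<in> ?U"
    then obtain d where d: "d > 0" "cball s d \<subseteq> ?U"
      using op open_contains_cball by blast
    have "compact ((\<lambda>q. ?f (fst q) (snd q)) ` (cball s d \<times> {0..1}))"
      by (intro compact_continuous_image continuous_on_subset[OF joint] compact_Times) (use d in auto)
    then have "bounded ((\<lambda>q. ?f (fst q) (snd q)) ` (cball s d \<times> {0..1}))"
      by (rule compact_imp_bounded)
    then obtain C where "\<forall>y\<in>(\<lambda>q. ?f (fst q) (snd q)) ` (cball s d \<times> {0..1}). norm y \<le> C"
      unfolding bounded_iff ..
    then have C: "norm (?f (fst q) (snd q)) \<le> C" if "q \<in> cball s d \<times> {0..1}" for q
      unfolding ball_simps(9) using that by (rule bspec)
    show "\<exists>r>0. \<exists>g. integrable lborel g \<and> (\<forall>z\<in>ball s r \<inter> ?U. \<forall>t\<in>space lborel. norm (indicator {0..1} t *\<^sub>R ?f z t) \<le> g t)"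
    proof (intro exI conjI ballI)
      show "integrable lborel (\<lambda>w. indicator {0..(1::real)} w *\<^sub>R C)" by (intro integrable_scaleR_left integrable_real_indicator) auto
      show "norm (indicator {0..1} t *\<^sub>R ?f z t) \<le> indicator {0..1} t *\<^sub>R C" if "z \<in> ball s d \<inter> ?U" for z t
        using C[of "(z, t)"] that by (auto simp: indicator_def)
    qed (use d in auto)
  qed
  then have "(\<lambda>s. integral (cbox 0 1) (?f s)) holomorphic_on ?U"
  proof (rule holomorphic_transform)
    fix s assume s: "s \<in> ?U"
    show "(\<integral>w. indicator {0..1} w *\<^sub>R ?f s w \<partial>lborel) = integral (cbox 0 1) (?f s)"
      using set_borel_integral_eq_integral(2)[OF borel_integrable_atLeastAtMost'[OF slice[OF s]]]
      by (simp add: set_lebesgue_integral_def)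
  qed
  then show ?case using Suc.prems by (auto intro!: holomorphic_intros)
qed

lemma hurwitz_aux_mono:
  assumes "1 - real k < Re s" "0 < a" "k \<le> l"
  shows "hurwitz_aux l s a = hurwitz_aux k s a"
  using assms(3)
proof (induction l rule: dec_induct)
  case (step l)
  then show ?case using hurwitz_aux_Suc[of l s a] assms by auto
qed auto

text \<open>The definite description needs existence and uniqueness. For existence, the functions
  \<open>hurwitz_aux j s a / (s - 1)\<close> agree where their half-planes overlap and glue
  together. Uniqueness is the identity theorem on the connected set \<open>- {1}\<close>, the value
  at 1 being prescribed.\<close>

lemma hurwitz_zeta_properties:
  assumes a: "0 < a"
  shows "(\<lambda>s. hurwitz_zeta s a) holomorphic_on (- {1})"
    and "1 < Re s \<Longrightarrow> hurwitz_zeta s a = (\<Sum>n. complex_of_real (real n + a) powr (- s))"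
proof -
  let ?P = "\<lambda>f. f holomorphic_on (- {1}) \<and> f 1 = 0 \<and>
        (\<forall>w. 1 < Re w \<longrightarrow> f w = (\<Sum>n. (complex_of_real (real n + a)) powr (- w)))"
  \<comment> \<open>An index whose half-plane \<open>1 - real k < Re s\<close> contains s; every
    other admissible index gives the same value.\<close>
  define k where "k = (\<lambda>s. nat (\<lfloor>1 - Re s\<rfloor> + 1))"
  have k: "1 - real (k s) < Re s" for s unfolding k_def by linarith
  define f where "f = (\<lambda>s. if s = 1 then 0 else hurwitz_aux (k s) s a / (s - 1))"
  have f_eq: "f s = hurwitz_aux j s a / (s - 1)" if "1 - real j < Re s" "s \<noteq> 1" for s j
    using hurwitz_aux_mono[OF that(1) a, of "max j (k s)"] hurwitz_aux_mono[OF k[of s] a, of "max j (k s)"] that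
    by (simp add: f_def)
  have "f holomorphic_on (\<Union>j\<in>UNIV. {s. 1 - real j < Re s} - {1})"
  proof (rule holomorphic_on_UN_open)
    fix j :: nat
    have "(\<lambda>s. hurwitz_aux j s a / (s - 1)) holomorphic_on ({s. 1 - real j < Re s} - {1})"
      using holomorphic_on_subset[OF holomorphic_hurwitz_aux[OF a, of j]] by (auto intro!: holomorphic_intros)
    then show "f holomorphic_on ({s. 1 - real j < Re s} - {1})"
      by (rule holomorphic_transform) (auto simp: f_eq)
    show "open ({s. 1 - real j < Re s} - {1})"
      by (intro open_Diff open_halfspace_Re_gt) auto
  qed
  moreover have "(\<Union>j\<in>UNIV. {s. 1 - real j < Re s} - {1}) = - {1}"
    using k by auto
  ultimately have f_hol: "f holomorphic_on (- {1})" by simp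
  have f_ser: "f w = (\<Sum>n. (complex_of_real (real n + a)) powr (- w))" if "1 < Re w" for w
    using f_eq[of 0 w] that by (cases "w = 1") auto
  have Pf: "?P f" using f_hol f_ser by (simp add: f_def)
  have uniq: "g = f" if "?P g" for g
  proof
    fix s
    show "g s = f s"
    proof (cases "s = 1")
      case False
      show ?thesis
      proof (rule analytic_continuation_open[where s="{s. 1 < Re s}" and s'="- {1}" and f=g and g=f])
        show "{s. 1 < Re s} \<noteq> {}" by (auto intro!: exI[of _ 2])
        show "connected (- {1::complex})" by (rule connected_punctured_universe) simp
      qed (use that f_hol f_ser False in \<open>auto intro: open_halfspace_Re_gt\<close>)
    qed (use that in \<open>simp add: f_def\<close>)
  qed
  have "hurwitz_zeta s a = f s" for s
    unfolding hurwitz_zeta_def using the_equality[of ?P f, OF Pf uniq] by simp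
  then show "(\<lambda>s. hurwitz_zeta s a) holomorphic_on (- {1})"
    "1 < Re s \<Longrightarrow> hurwitz_zeta s a = (\<Sum>n. complex_of_real (real n + a) powr (- s))"
    using f_hol f_ser by auto
qed

section \<open>An integral representation of the Bessel function K\<close>

lemma integrable_exp_minus_abs: "integrable lborel (\<lambda>y::real. exp (- \<bar>y\<bar>))"
proof -
  have "(\<lambda>y::real. exp (- 1 * y)) absolutely_integrable_on {0..}"
    using integrable_on_exp_minus_to_infinity[of 1 0] by (subst absolutely_integrable_on_iff_nonneg) auto
  then have 1: "integrable lborel (\<lambda>y::real. indicator {0..} y *\<^sub>R exp (- y))"
    unfolding set_integrable_def by (subst (asm) integrable_completion) auto
  then have 2: "integrable lborel (\<lambda>y::real. indicator {0..} (0 + (-1) * y) *\<^sub>R exp (- (0 + (-1) * y)))"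
    by (rule lborel_integrable_real_affine) auto
  show ?thesis
    by (rule Bochner_Integration.integrable_bound[OF Bochner_Integration.integrable_add[OF 1 2]])
       (auto simp: indicator_def)
qed

lemma exp_minus_le_power:
  fixes u :: real
  assumes "0 < u"
  shows "exp (- u) \<le> fact n / u ^ n"
proof -
  have "u ^ n / fact n \<le> exp u"
    using sums_le[OF _ sums_single[of n "\<lambda>n. u ^ n /\<^sub>R fact n"] exp_converges[of u]] assms
    by (auto simp: divide_inverse mult.commute)
  then show ?thesis using assms by (simp add: exp_minus field_simps)
qed

text \<open>The estimate exp (- u) <= n! / u^n is used with u = exp y on the right and u = c exp (-
  y) on the left; n >= |\<sigma>| + 1 leaves a factor exp (- |y|). The constant involves only the
  lower bound c of d, so it is uniform over half-planes.\<close>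

lemma kernel_bound:
  fixes \<sigma> c d y :: real
  assumes "\<bar>\<sigma>\<bar> + 1 \<le> real n" "0 < c" "c \<le> d"
  shows "exp (\<sigma> * y - exp y - d * exp (- y)) \<le> (fact n + fact n / c ^ n) * exp (- \<bar>y\<bar>)"
proof (cases "0 \<le> y")
  case True
  have "exp (\<sigma> * y - exp y - d * exp (- y)) \<le> exp (\<sigma> * y) * exp (- exp y)"
    using assms by (simp flip: exp_add)
  also have "\<dots> \<le> exp (\<sigma> * y) * (fact n / exp y ^ n)"
    by (intro mult_left_mono exp_minus_le_power) auto
  also have "\<dots> = fact n * exp ((\<sigma> - real n) * y)"
    by (simp add: exp_diff left_diff_distrib exp_of_nat_mult exp_of_nat2_mult)
  also have "\<dots> \<le> fact n * exp (- \<bar>y\<bar>)"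
    using True assms mult_right_mono[of "\<sigma> - real n" "- 1" y] by simp
  also have "\<dots> \<le> (fact n + fact n / c ^ n) * exp (- \<bar>y\<bar>)"
    using assms by (intro mult_right_mono) auto
  finally show ?thesis .
next
  case False
  have "exp (\<sigma> * y - exp y - d * exp (- y)) \<le> exp (\<sigma> * y) * exp (- (c * exp (- y)))"
    using mult_right_mono[OF assms(3) exp_ge_zero[of "- y"]] exp_gt_zero[of y]
    by (subst exp_add[symmetric], subst exp_le_cancel_iff) linarith
  also have "\<dots> \<le> exp (\<sigma> * y) * (fact n / (c * exp (- y)) ^ n)"
    using assms by (intro mult_left_mono exp_minus_le_power) auto
  also have "\<dots> = fact n / c ^ n * exp ((\<sigma> + real n) * y)"
    by (simp add: exp_add distrib_right power_mult_distrib exp_of_nat2_mult exp_of_nat_mult exp_minus field_simps)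
  also have "\<dots> \<le> fact n / c ^ n * exp (- \<bar>y\<bar>)"
    using False assms mult_right_mono_neg[of 1 "\<sigma> + real n" y] by (intro mult_left_mono) auto
  also have "\<dots> \<le> (fact n + fact n / c ^ n) * exp (- \<bar>y\<bar>)"
    using assms by (intro mult_right_mono) auto
  finally show ?thesis .
qed

text \<open>Serves as integration by parts over the whole line with vanishing boundary
  terms.\<close>

lemma integral_derivative_eq_0:
  fixes F f :: "real \<Rightarrow> 'a::euclidean_space"
  assumes "\<And>x. (F has_vector_derivative f x) (at x)" "continuous_on UNIV f" "integrable lborel f"
    and "(F \<longlongrightarrow> 0) at_top" "(F \<longlongrightarrow> 0) at_bot"
  shows "(\<integral>x. f x \<partial>lborel) = 0"
proof -
  have "(LBINT x=-\<infinity>..\<infinity>. f x) = 0 - 0"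
  proof (rule interval_integral_FTC_integrable)
    show "isCont f x" for x using assms(2) by (simp add: continuous_on_eq_continuous_at)
    show "set_integrable lborel (einterval (-\<infinity>) \<infinity>) f"
      using assms(3) by (simp add: einterval_def set_integrable_def)
    show "((F \<circ> real_of_ereal) \<longlongrightarrow> 0) (at_right (-\<infinity>))" "((F \<circ> real_of_ereal) \<longlongrightarrow> 0) (at_left \<infinity>)"
      using assms(4,5) by (simp_all add: ereal_tendsto_simps)
  qed (use assms(1) in auto)
  then show ?thesis by (simp add: interval_lebesgue_integral_def einterval_def set_lebesgue_integral_def)
qed

section \<open>The integral representing K, with its recurrences\<close>

definition kern :: "complex \<Rightarrow> complex \<Rightarrow> real \<Rightarrow> complex" where
  "kern \<kappa> w y = exp (\<kappa> * of_real y - of_real (exp y) - w * of_real (exp (- y)))"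

text \<open>With t = exp y this is the integral over t > 0 of t^(\<kappa>-1) exp (- t - w/t), which
  for w > 0 is to be identified with 2 w^(\<kappa>/2) times the Bessel function K of order \<kappa>
  at 2 sqrt w. The parameter w is complex so that it can be differentiated holomorphically.\<close>

definition kern_int :: "complex \<Rightarrow> complex \<Rightarrow> complex" where
  "kern_int \<kappa> w = (\<integral>y. kern \<kappa> w y \<partial>lborel)"

lemma norm_kern: "norm (kern \<kappa> w y) = exp (Re \<kappa> * y - exp y - Re w * exp (- y))"
  by (simp add: kern_def)

lemma continuous_on_kern: "continuous_on UNIV (kern \<kappa> w)"
  unfolding kern_def by (intro continuous_intros)

lemma borel_measurable_kern [measurable]: "kern \<kappa> w \<in> borel_measurable borel"
  using borel_measurable_continuous_onI[OF continuous_on_kern] .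

lemma norm_kern_le:
  assumes "\<bar>Re \<kappa>\<bar> + 1 \<le> real n" "0 < c" "c \<le> Re w"
  shows "norm (kern \<kappa> w y) \<le> (fact n + fact n / c ^ n) * exp (- \<bar>y\<bar>)"
  unfolding norm_kern using kernel_bound[OF assms] .

lemma kern_dominated:
  assumes "0 < c"
  shows "\<exists>C. \<forall>w y. c \<le> Re w \<longrightarrow> norm (kern \<kappa> w y) \<le> C * exp (- \<bar>y\<bar>)"
proof -
  obtain n where "\<bar>Re \<kappa>\<bar> + 1 \<le> real n" using real_arch_simple by blast
  then show ?thesis using norm_kern_le assms by blast
qed

lemma integrable_kern:
  assumes "0 < Re w"
  shows "integrable lborel (kern \<kappa> w)"
proof -
  obtain C where C: "\<And>v y. Re w \<le> Re v \<Longrightarrow> norm (kern \<kappa> v y) \<le> C * exp (- \<bar>y\<bar>)"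
    using kern_dominated[OF assms] by blast
  have "integrable lborel (\<lambda>y. C * exp (- \<bar>y\<bar>))" using integrable_exp_minus_abs by auto
  then show ?thesis
    by (rule Bochner_Integration.integrable_bound) (use C[of w] in \<open>auto intro!: order.trans[OF C abs_ge_self]\<close>)
qed

lemma kern_shift: "kern \<kappa> w y * of_real (exp y) = kern (\<kappa> + 1) w y"
  "kern \<kappa> w y * of_real (exp (- y)) = kern (\<kappa> - 1) w y"
  unfolding kern_def by (simp_all add: exp_of_real[symmetric] algebra_simps flip: exp_add)

text \<open>Differentiation in w brings down - exp (- y), which lowers \<kappa> by one. Domination
  holds on the disc of radius Re w / 2, where the real part stays at least Re w / 2.\<close>

lemma has_field_derivative_kern_int:
  assumes w: "0 < Re w"
  shows "(kern_int \<kappa> has_field_derivative - kern_int (\<kappa> - 1) w) (at w)"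
proof -
  let ?S = "{w. 0 < Re w}"
  have d: "((\<lambda>w. kern \<kappa> w y) has_field_derivative - kern (\<kappa> - 1) w y) (at w)" for w y
    unfolding kern_shift[symmetric] unfolding kern_def by (auto intro!: derivative_eq_intros)
  have "((\<lambda>w. \<integral>y. kern \<kappa> w y \<partial>lborel) has_field_derivative (\<integral>y. deriv (\<lambda>w. kern \<kappa> w y) w \<partial>lborel)) (at w)"
  proof (rule has_field_derivative_integral_dominated)
    show "open ?S" "w \<in> ?S" using w by (auto intro: open_halfspace_Re_gt)
    show "(\<lambda>w. kern \<kappa> w y) holomorphic_on ?S" for y
      unfolding kern_def by (intro holomorphic_intros)
    obtain C where C: "\<And>v y. Re w / 2 \<le> Re v \<Longrightarrow> norm (kern \<kappa> v y) \<le> C * exp (- \<bar>y\<bar>)"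
      using kern_dominated[OF half_gt_zero[OF w], of \<kappa>] by blast
    have "Re w / 2 \<le> Re v" if "v \<in> ball w (Re w / 2)" for v
      using abs_Re_le_cmod[of "w - v"] that by (auto simp: dist_norm)
    then show "\<exists>r>0. \<exists>g. integrable lborel g \<and> (\<forall>z\<in>ball w r \<inter> ?S. \<forall>t\<in>space lborel. norm (kern \<kappa> z t) \<le> g t)"
      using w C integrable_exp_minus_abs
      by (intro exI[of _ "Re w / 2"] conjI exI[of _ "\<lambda>y. C * exp (- \<bar>y\<bar>)"]) auto
  qed auto
  then show ?thesis using DERIV_imp_deriv[OF d] by (simp add: kern_int_def[abs_def])
qed

text \<open>The y-derivative of the kernel integrates to 0; each of the three summands of the
  exponent contributes one term.\<close>

lemma kern_int_recurrence:
  assumes w: "0 < Re w"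
  shows "kern_int (\<kappa> + 1) w = \<kappa> * kern_int \<kappa> w + w * kern_int (\<kappa> - 1) w"
proof -
  obtain C where C: "\<And>v y. Re w \<le> Re v \<Longrightarrow> norm (kern \<kappa> v y) \<le> C * exp (- \<bar>y\<bar>)"
    using kern_dominated[OF w] by blast
  have lim: "(kern \<kappa> w \<longlongrightarrow> 0) F" if "((\<lambda>y. C * exp (- \<bar>y\<bar>)) \<longlongrightarrow> 0) F" for F
    by (rule tendsto_0_le[OF that, of _ 1]) (auto intro!: always_eventually order.trans[OF C abs_ge_self])
  have int: "integrable lborel (kern \<kappa>' w)" for \<kappa>' using integrable_kern[OF w] .
  have "(\<integral>y. \<kappa> * kern \<kappa> w y - kern (\<kappa> + 1) w y + w * kern (\<kappa> - 1) w y \<partial>lborel) = 0"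
  proof (rule integral_derivative_eq_0[where F="kern \<kappa> w"])
    fix y :: real
    have *: "((\<lambda>z. exp (\<kappa> * z - exp z - w * exp (- z))) has_field_derivative
          (\<kappa> * kern \<kappa> w y - kern (\<kappa> + 1) w y + w * kern (\<kappa> - 1) w y)) (at (of_real y))"
      unfolding kern_shift[symmetric] unfolding kern_def
      by (auto intro!: derivative_eq_intros simp: exp_of_real[symmetric] algebra_simps)
    show "(kern \<kappa> w has_vector_derivative (\<kappa> * kern \<kappa> w y - kern (\<kappa> + 1) w y + w * kern (\<kappa> - 1) w y)) (at y)"
      using has_vector_derivative_real_field[OF *] by (simp add: kern_def[abs_def] exp_of_real[symmetric])
    show "(kern \<kappa> w \<longlongrightarrow> 0) at_top" "(kern \<kappa> w \<longlongrightarrow> 0) at_bot"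
      by (rule lim, real_asymp)+
  qed (auto intro!: continuous_intros continuous_on_subset[OF continuous_on_kern] Bochner_Integration.integrable_add
         Bochner_Integration.integrable_diff integrable_mult_right int)
  moreover have "(\<integral>y. \<kappa> * kern \<kappa> w y - kern (\<kappa> + 1) w y + w * kern (\<kappa> - 1) w y \<partial>lborel) =
      \<kappa> * kern_int \<kappa> w - kern_int (\<kappa> + 1) w + w * kern_int (\<kappa> - 1) w"
    unfolding kern_int_def using int by simp
  ultimately show ?thesis by (simp add: algebra_simps)
qed

text \<open>The substitution y -> ln w - y, that is t -> w/t, exchanges the exponentials exp (- t)
  and exp (- w/t).\<close>

lemma kern_int_reflect:
  assumes w: "0 < w"
  shows "kern_int \<kappa> (of_real w) = of_real w powr \<kappa> * kern_int (- \<kappa>) (of_real w)"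
proof -
  have "kern \<kappa> (of_real w) (ln w + (-1) * y) = of_real w powr \<kappa> * kern (- \<kappa>) (of_real w) y" for y
  proof -
    have "exp (complex_of_real (ln w)) = of_real w" using w by (simp add: exp_of_real)
    moreover have "of_real w powr \<kappa> = exp (\<kappa> * of_real (ln w))" using w by (simp add: powr_def Ln_of_real)
    moreover have "exp (ln w - y) = w * exp (- y)" "exp (- (ln w - y)) = exp y / w"
      using w by (simp_all add: exp_diff exp_minus field_simps)
    ultimately show ?thesis using w unfolding kern_def
      by (simp add: algebra_simps flip: exp_add)
  qed
  then have "(\<integral>y. kern \<kappa> (of_real w) (ln w + (-1) * y) \<partial>lborel) = of_real w powr \<kappa> * kern_int (- \<kappa>) (of_real w)"
    by (simp add: kern_int_def)
  then show ?thesis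
    unfolding kern_int_def by (subst lborel_integral_real_affine[of "-1" _ "ln w"]) auto
qed

lemma range_exp_real: "range (exp :: real \<Rightarrow> real) = {0<..}"
proof (intro equalityI subsetI)
  fix x :: real assume "x \<in> {0<..}"
  then have "x = exp (ln x)" by simp
  then show "x \<in> range exp" by blast
qed auto

lemma Gamma_exp_integral:
  assumes "0 < Re \<kappa>"
  shows "integrable lborel (\<lambda>y. exp (\<kappa> * of_real y - of_real (exp y)))"
    and "(\<integral>y. exp (\<kappa> * of_real y - of_real (exp y)) \<partial>lborel) = Gamma \<kappa>"
proof -
  let ?f = "\<lambda>t. complex_of_real t powr (\<kappa> - 1) / of_real (exp t)"
  have eq: "\<bar>exp y\<bar> *\<^sub>R ?f (exp y) = exp (\<kappa> * of_real y - of_real (exp y))" for y :: real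
    by (simp add: powr_def Ln_of_real scaleR_conv_of_real exp_of_real[symmetric] exp_diff left_diff_distrib)
  have "?f absolutely_integrable_on (exp ` UNIV) \<and> integral (exp ` UNIV) ?f = Gamma \<kappa>"
    unfolding range_exp_real
    using absolutely_integrable_Gamma_integral'[OF assms] integral_unique[OF Gamma_integral_complex'[OF assms]] by blast
  then have "(\<lambda>y. \<bar>exp y\<bar> *\<^sub>R ?f (exp y)) absolutely_integrable_on UNIV \<and>
      integral UNIV (\<lambda>y. \<bar>exp y\<bar> *\<^sub>R ?f (exp y)) = Gamma \<kappa>"
    by (subst has_absolute_integral_change_of_variables_real) (auto intro!: derivative_eq_intros simp: inj_on_def)
  then have 1: "(\<lambda>y. exp (\<kappa> * of_real y - of_real (exp y))) absolutely_integrable_on UNIV"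
    and 2: "integral UNIV (\<lambda>y. exp (\<kappa> * of_real y - of_real (exp y))) = Gamma \<kappa>"
    unfolding eq by auto
  show 3: "integrable lborel (\<lambda>y. exp (\<kappa> * of_real y - of_real (exp y)))"
    using 1 unfolding set_integrable_def by (subst (asm) integrable_completion) (auto intro!: borel_measurable_continuous_onI continuous_intros)
  show "(\<integral>y. exp (\<kappa> * of_real y - of_real (exp y)) \<partial>lborel) = Gamma \<kappa>"
    using 2 integral_lborel[OF 3] by simp
qed

text \<open>The integrands are dominated by the one at w = 0, which is Euler's integral and
  integrable for Re \<kappa> > 0. The limit fixes the constant in the Wronskian identity
  below.\<close>

lemma kern_int_tendsto_Gamma:
  assumes "0 < Re \<kappa>"
  shows "(\<lambda>n. kern_int \<kappa> (of_real (1 / real (Suc n)))) \<longlonglongrightarrow> Gamma \<kappa>"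
  unfolding kern_int_def Gamma_exp_integral(2)[OF assms, symmetric]
proof (rule integral_dominated_convergence)
  show "integrable lborel (\<lambda>y. norm (exp (\<kappa> * of_real y - of_real (exp y))))"
    using integrable_norm[OF Gamma_exp_integral(1)[OF assms]] .
  have "(\<lambda>n. kern \<kappa> (of_real (1 / real (Suc n))) y) \<longlonglongrightarrow> exp (\<kappa> * of_real y - of_real (exp y) - of_real 0 * of_real (exp (- y)))" for y
    unfolding kern_def by (intro tendsto_intros LIMSEQ_Suc lim_1_over_n)
  then show "AE y in lborel. (\<lambda>n. kern \<kappa> (of_real (1 / real (Suc n))) y) \<longlonglongrightarrow> exp (\<kappa> * of_real y - of_real (exp y))"
    by simp
  show "AE y in lborel. norm (kern \<kappa> (of_real (1 / real (Suc n))) y) \<le> norm (exp (\<kappa> * of_real y - of_real (exp y)))" for n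
    by (simp add: norm_kern)
qed (auto intro!: borel_measurable_continuous_onI continuous_intros)

text \<open>The Bessel function I of order \<kappa> at 2 sqrt w, without its branch factor
  w^(\<kappa>/2). What remains is entire in w, so it can be differentiated and evaluated at w =
  0.\<close>

definition bessel_ser :: "complex \<Rightarrow> complex \<Rightarrow> complex" where
  "bessel_ser \<kappa> w = (\<Sum>k. rGamma (of_nat k + \<kappa> + 1) / fact k * w ^ k)"

lemma rGamma_shift: "rGamma (of_nat k + \<kappa> + 1) = (of_nat k + \<kappa> + 1) * rGamma (of_nat k + \<kappa> + 2)" for \<kappa> :: complex
  using rGamma_plus1[of "of_nat k + \<kappa> + 1"] by (simp add: add_ac)

lemma summable_bessel_ser:
  fixes \<kappa> w :: complex
  shows "summable (\<lambda>k. rGamma (of_nat k + \<kappa> + 1) / fact k * w ^ k)"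
proof -
  \<comment> \<open>Beyond this \<open>N\<close> one has |k + \<kappa> + 1| >= 2 |w|, which yields
    the ratio 1/2. The comparison multiplies by k + \<kappa> + 1 instead of dividing by values of
    \<open>rGamma\<close>, which may vanish.\<close>
  obtain N :: nat where N: "norm \<kappa> + 2 * norm w + 2 \<le> real N" using real_arch_simple by blast
  show ?thesis
  proof (rule summable_ratio_test[of "1/2"])
    fix k assume "N \<le> k"
    then have k: "norm \<kappa> + 2 * norm w + 2 \<le> real k" using N by linarith
    have "norm (of_nat k + \<kappa> + 1) \<ge> norm (of_nat k + 1 :: complex) - norm \<kappa>"
      using norm_triangle_ineq2[of "of_nat k + 1" "- \<kappa>"] by (simp add: add_ac)
    moreover have n1: "norm (of_nat k + 1 :: complex) = real k + 1"
      by (metis norm_of_nat of_nat_Suc add.commute)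
    then have [simp]: "norm (1 + of_nat k :: complex) = real k + 1" by (simp add: add.commute)
    ultimately have b: "2 * norm w \<le> norm (of_nat k + \<kappa> + 1)" using k n1 by linarith
    have "norm (rGamma (of_nat (Suc k) + \<kappa> + 1) / fact (Suc k) * w ^ Suc k) =
        norm (rGamma (of_nat k + \<kappa> + 2)) / fact k * norm w ^ k * (norm w / (real k + 1))"
      by (simp add: norm_mult norm_divide norm_power add_ac mult_ac)
    also have "\<dots> \<le> norm (rGamma (of_nat k + \<kappa> + 2)) / fact k * norm w ^ k * norm w"
      by (intro mult_left_mono) (auto simp: divide_le_eq mult_le_cancel_left1)
    also have "\<dots> \<le> norm (rGamma (of_nat k + \<kappa> + 2)) / fact k * norm w ^ k * (1/2 * norm (of_nat k + \<kappa> + 1))"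
      using b by (intro mult_left_mono) auto
    also have "\<dots> = 1/2 * norm (rGamma (of_nat k + \<kappa> + 1) / fact k * w ^ k)"
      by (subst rGamma_shift) (simp add: norm_mult norm_divide norm_power mult_ac)
    finally show "norm (rGamma (of_nat (Suc k) + \<kappa> + 1) / fact (Suc k) * w ^ Suc k)
       \<le> 1/2 * norm (rGamma (of_nat k + \<kappa> + 1) / fact k * w ^ k)" .
  qed auto
qed

lemma has_field_derivative_bessel_ser:
  "(bessel_ser \<kappa> has_field_derivative bessel_ser (\<kappa> + 1) w) (at w)"
proof -
  have "((\<lambda>w. \<Sum>k. rGamma (of_nat k + \<kappa> + 1) / fact k * w ^ k) has_field_derivative
      (\<Sum>k. diffs (\<lambda>k. rGamma (of_nat k + \<kappa> + 1) / fact k) k * w ^ k)) (at w)"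
    by (rule termdiffs_strong_converges_everywhere) (rule summable_bessel_ser)
  moreover have "diffs (\<lambda>k. rGamma (of_nat k + \<kappa> + 1) / fact k) k = rGamma (of_nat k + (\<kappa> + 1) + 1) / fact k" for k
  proof -
    have "of_nat (Suc k) + \<kappa> + 1 = of_nat k + (\<kappa> + 1) + 1" by simp
    moreover have [simp]: "1 + complex_of_nat k \<noteq> 0"
      using of_nat_neq_0[of k, where 'a=complex] by simp
    ultimately show ?thesis by (simp only: diffs_def fact_Suc) simp
  qed
  ultimately show ?thesis by (simp add: bessel_ser_def[abs_def])
qed

text \<open>Coefficientwise, the factor k + \<kappa> + 1 from \<open>rGamma_shift\<close> is split
  into \<kappa> + 1 and k; the part with k is w times the series of index \<kappa> + 2, shifted by
  one place.\<close>

lemma bessel_ser_recurrence: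
  "bessel_ser \<kappa> w = (\<kappa> + 1) * bessel_ser (\<kappa> + 1) w + w * bessel_ser (\<kappa> + 2) w"
proof -
  let ?c = "\<lambda>\<kappa> k. rGamma (of_nat k + \<kappa> + 1) / fact k * w ^ k"
  have [simp]: "1 + complex_of_nat k \<noteq> 0" for k
    using of_nat_neq_0[of k, where 'a=complex] by simp
  have s: "?c \<kappa> sums bessel_ser \<kappa> w" for \<kappa>
    unfolding bessel_ser_def by (rule summable_sums[OF summable_bessel_ser])
  have "(\<lambda>k. of_nat (Suc k) * ?c (\<kappa> + 1) (Suc k)) sums (w * bessel_ser (\<kappa> + 2) w)"
    using sums_mult[OF s[of "\<kappa> + 2"], of w]
    by (rule back_subst[of "\<lambda>f. f sums _"]) (auto simp: fun_eq_iff add_ac)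
  from sums_Suc[OF this] have "(\<lambda>k. of_nat k * ?c (\<kappa> + 1) k) sums (w * bessel_ser (\<kappa> + 2) w)" by simp
  from sums_add[OF sums_mult[OF s[of "\<kappa> + 1"], of "\<kappa> + 1"] this]
  have "(\<lambda>k. (\<kappa> + 1) * ?c (\<kappa> + 1) k + of_nat k * ?c (\<kappa> + 1) k) sums
     ((\<kappa> + 1) * bessel_ser (\<kappa> + 1) w + w * bessel_ser (\<kappa> + 2) w)" .
  moreover have "(\<kappa> + 1) * ?c (\<kappa> + 1) k + of_nat k * ?c (\<kappa> + 1) k = ?c \<kappa> k" for k
    using rGamma_shift[of k \<kappa>] by (simp add: add_ac) (simp add: algebra_simps add_divide_distrib)
  ultimately show ?thesis using sums_unique2[OF s[of \<kappa>]] by simp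
qed

lemma bessel_ser_0: "bessel_ser \<kappa> 0 = rGamma (\<kappa> + 1)"
  unfolding bessel_ser_def using powser_zero[of "\<lambda>k. rGamma (of_nat k + \<kappa> + 1) / fact k"] by simp

text \<open>The left-hand side is a Wronskian: the recurrences make it constant in \<open>w\<close>, and its limit at \<open>w = 0\<close>
  is \<open>\<Gamma>(\<kappa> + 1) / \<Gamma>(\<kappa> + 1)\<close>. It is also invariant under \<open>\<kappa> \<mapsto> \<kappa> + 1\<close>, which removes \<open>Re \<kappa> > 0\<close> below.\<close>
lemma kern_int_bessel_ser_Re_pos:
  assumes \<kappa>: "0 < Re \<kappa>" and w: "0 < Re w"
  shows "w * kern_int \<kappa> w * bessel_ser (\<kappa> + 1) w + kern_int (\<kappa> + 1) w * bessel_ser \<kappa> w = 1"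
proof -
  define T where "T = (\<lambda>w. w * kern_int \<kappa> w * bessel_ser (\<kappa> + 1) w + kern_int (\<kappa> + 1) w * bessel_ser \<kappa> w)"
  let ?S = "{w. 0 < Re w}"
  have "(T has_field_derivative 0) (at w within ?S)" if "w \<in> ?S" for w
  proof -
    have w: "0 < Re w" using that by simp
    have "(T has_field_derivative
       ((kern_int \<kappa> w + w * - kern_int (\<kappa> - 1) w) * bessel_ser (\<kappa> + 1) w + w * kern_int \<kappa> w * bessel_ser (\<kappa> + 1 + 1) w
        + (- kern_int (\<kappa> + 1 - 1) w * bessel_ser \<kappa> w + kern_int (\<kappa> + 1) w * bessel_ser (\<kappa> + 1) w))) (at w)"
      unfolding T_def
      by (rule derivative_eq_intros has_field_derivative_kern_int[OF w] has_field_derivative_bessel_ser refl)+ (simp add: algebra_simps)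
    moreover have "(kern_int \<kappa> w + w * - kern_int (\<kappa> - 1) w) * bessel_ser (\<kappa> + 1) w + w * kern_int \<kappa> w * bessel_ser (\<kappa> + 1 + 1) w
        + (- kern_int (\<kappa> + 1 - 1) w * bessel_ser \<kappa> w + kern_int (\<kappa> + 1) w * bessel_ser (\<kappa> + 1) w) = 0"
      unfolding kern_int_recurrence[OF w] bessel_ser_recurrence[of \<kappa>] by (simp add: algebra_simps)
    ultimately show ?thesis using has_field_derivative_at_within by metis
  qed
  then obtain c where c: "\<And>w. w \<in> ?S \<Longrightarrow> T w = c"
    using has_field_derivative_zero_constant[of ?S T] convex_halfspace_Re_gt by blast
  have bs: "(\<lambda>n. bessel_ser \<kappa>' (of_real (1 / real (Suc n)))) \<longlonglongrightarrow> rGamma (\<kappa>' + 1)" for \<kappa>'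
  proof -
    have "isCont (bessel_ser \<kappa>') 0" using has_field_derivative_bessel_ser DERIV_isCont by blast
    moreover have "(\<lambda>n. complex_of_real (1 / real (Suc n))) \<longlonglongrightarrow> of_real 0"
      by (intro tendsto_intros LIMSEQ_Suc lim_1_over_n)
    ultimately show ?thesis using isCont_tendsto_compose[of 0 "bessel_ser \<kappa>'"] bessel_ser_0 by fastforce
  qed
  have "(\<lambda>n. T (of_real (1 / real (Suc n)))) \<longlonglongrightarrow> of_real 0 * Gamma \<kappa> * rGamma (\<kappa> + 1 + 1) + Gamma (\<kappa> + 1) * rGamma (\<kappa> + 1)"
    unfolding T_def using \<kappa> by (intro tendsto_intros bs kern_int_tendsto_Gamma LIMSEQ_Suc lim_1_over_n) auto
  moreover have "T (of_real (1 / real (Suc n))) = c" for n by (rule c) simp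
  ultimately have "c = of_real 0 * Gamma \<kappa> * rGamma (\<kappa> + 1 + 1) + Gamma (\<kappa> + 1) * rGamma (\<kappa> + 1)"
    using LIMSEQ_unique[OF tendsto_const] by simp
  moreover have "\<kappa> + 1 \<notin> \<int>\<^sub>\<le>\<^sub>0" using \<kappa> by (auto elim!: nonpos_Ints_cases simp: complex_eq_iff)
  ultimately have "c = 1" by (simp add: Gamma_def rGamma_eq_zero_iff)
  then show ?thesis using c[of w] w by (simp add: T_def)
qed

lemma kern_int_bessel_ser:
  assumes w: "0 < Re w"
  shows "w * kern_int \<kappa> w * bessel_ser (\<kappa> + 1) w + kern_int (\<kappa> + 1) w * bessel_ser \<kappa> w = 1"
proof -
  let ?T = "\<lambda>\<kappa>. w * kern_int \<kappa> w * bessel_ser (\<kappa> + 1) w + kern_int (\<kappa> + 1) w * bessel_ser \<kappa> w"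
  have step: "?T (\<kappa> + 1) = ?T \<kappa>" for \<kappa>
    using kern_int_recurrence[OF w, of "\<kappa> + 1"] bessel_ser_recurrence[of \<kappa> w]
    by (simp add: algebra_simps)
  have "?T (\<kappa> + of_nat n) = ?T \<kappa>" for n
  proof (induction n)
    case (Suc n)
    then show ?case using step[of "\<kappa> + of_nat n"] by (simp add: add_ac)
  qed simp
  moreover obtain n where "- Re \<kappa> < real n" using reals_Archimedean2 by blast
  ultimately show ?thesis using kern_int_bessel_ser_Re_pos[of "\<kappa> + of_nat n" w] w by simp
qed

text \<open>Up to elementary factors this is the Wronskian of the Bessel functions I of orders \<nu>
  and - \<nu>. Its w-derivative vanishes by the recurrences, and its value at w = 0 is a product of
  two reciprocal Gamma values given by the reflection formula.\<close>

lemma bessel_ser_wronskian: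
  "bessel_ser (- \<nu> - 1) w * bessel_ser \<nu> w - w * bessel_ser (\<nu> + 1) w * bessel_ser (- \<nu>) w = - sin (of_real pi * \<nu>) / of_real pi"
proof -
  define Q where "Q = (\<lambda>w. bessel_ser (- \<nu> - 1) w * bessel_ser \<nu> w - w * bessel_ser (\<nu> + 1) w * bessel_ser (- \<nu>) w)"
  have "(Q has_field_derivative 0) (at w within UNIV)" for w
  proof -
    have "(Q has_field_derivative
       (bessel_ser (- \<nu> - 1 + 1) w * bessel_ser \<nu> w + bessel_ser (- \<nu> - 1) w * bessel_ser (\<nu> + 1) w)
       - ((bessel_ser (\<nu> + 1) w + w * bessel_ser (\<nu> + 1 + 1) w) * bessel_ser (- \<nu>) w + w * bessel_ser (\<nu> + 1) w * bessel_ser (- \<nu> + 1) w)) (at w)"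
      unfolding Q_def
      by (rule derivative_eq_intros has_field_derivative_bessel_ser refl)+ (simp add: algebra_simps)
    moreover have "(bessel_ser (- \<nu> - 1 + 1) w * bessel_ser \<nu> w + bessel_ser (- \<nu> - 1) w * bessel_ser (\<nu> + 1) w)
       - ((bessel_ser (\<nu> + 1) w + w * bessel_ser (\<nu> + 1 + 1) w) * bessel_ser (- \<nu>) w + w * bessel_ser (\<nu> + 1) w * bessel_ser (- \<nu> + 1) w) = 0"
      unfolding bessel_ser_recurrence[of \<nu>] bessel_ser_recurrence[of "- \<nu> - 1"] by (simp add: algebra_simps)
    ultimately show ?thesis by simp
  qed
  then have "Q w = Q 0"
    using has_field_derivative_zero_constant[of UNIV Q] by auto
  also have "Q 0 = rGamma (- \<nu>) * rGamma (1 - (- \<nu>))" by (simp add: Q_def bessel_ser_0 add_ac)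
  also have "\<dots> = sin (of_real pi * (- \<nu>)) / of_real pi" by (rule rGamma_reflection_complex)
  finally show ?thesis by (simp add: Q_def)
qed

text \<open>Cramer's rule: \<open>kern_int_bessel_ser\<close> at \<nu> and, after reflection, at -
  \<nu> - 1 gives two linear equations for \<open>kern_int \<nu>\<close> and
  \<open>kern_int (\<nu> + 1)\<close>, whose determinant is the preceding Wronskian up to
  sign.\<close>

lemma kern_int_eq_bessel_ser:
  assumes w: "0 < w"
  shows "kern_int \<nu> (of_real w) * (sin (of_real pi * \<nu>) / of_real pi) =
     bessel_ser (- \<nu>) (of_real w) - of_real w powr \<nu> * bessel_ser \<nu> (of_real w)"
proof -
  let ?w = "complex_of_real w"
  have 1: "?w * kern_int \<nu> ?w * bessel_ser (\<nu> + 1) ?w + kern_int (\<nu> + 1) ?w * bessel_ser \<nu> ?w = 1"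
    using w by (intro kern_int_bessel_ser) simp
  have "?w * kern_int (- \<nu> - 1) ?w * bessel_ser (- \<nu>) ?w + kern_int (- \<nu>) ?w * bessel_ser (- \<nu> - 1) ?w = 1"
    using kern_int_bessel_ser[of ?w "- \<nu> - 1"] w by simp
  \<comment> \<open>The factor w^\<nu> is distributed so that reflection turns the indices - \<nu> -
    1 and - \<nu> into \<nu> + 1 and \<nu>.\<close>
  moreover have "?w powr (\<nu> + 1) * kern_int (- (\<nu> + 1)) ?w * bessel_ser (- \<nu>) ?w + (?w powr \<nu> * kern_int (- \<nu>) ?w) * bessel_ser (- \<nu> - 1) ?w =
     ?w powr \<nu> * (?w * kern_int (- \<nu> - 1) ?w * bessel_ser (- \<nu>) ?w + kern_int (- \<nu>) ?w * bessel_ser (- \<nu> - 1) ?w)"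
    using w by (simp add: powr_add algebra_simps minus_diff_commute)
  ultimately have "?w powr (\<nu> + 1) * kern_int (- (\<nu> + 1)) ?w * bessel_ser (- \<nu>) ?w + (?w powr \<nu> * kern_int (- \<nu>) ?w) * bessel_ser (- \<nu> - 1) ?w = ?w powr \<nu>"
    by (simp only: mult_1_right)
  then have 2: "kern_int (\<nu> + 1) ?w * bessel_ser (- \<nu>) ?w + kern_int \<nu> ?w * bessel_ser (- \<nu> - 1) ?w = ?w powr \<nu>"
    unfolding kern_int_reflect[OF w, symmetric] by simp
  \<comment> \<open>Eliminates \<open>kern_int (\<nu> + 1)\<close> from the two equations.\<close>
  have "kern_int \<nu> ?w * - (bessel_ser (- \<nu> - 1) ?w * bessel_ser \<nu> ?w - ?w * bessel_ser (\<nu> + 1) ?w * bessel_ser (- \<nu>) ?w) =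
    bessel_ser (- \<nu>) ?w * (?w * kern_int \<nu> ?w * bessel_ser (\<nu> + 1) ?w + kern_int (\<nu> + 1) ?w * bessel_ser \<nu> ?w) -
    (kern_int (\<nu> + 1) ?w * bessel_ser (- \<nu>) ?w + kern_int \<nu> ?w * bessel_ser (- \<nu> - 1) ?w) * bessel_ser \<nu> ?w"
    by (simp add: algebra_simps)
  then show ?thesis unfolding 1 2 bessel_ser_wronskian by simp
qed

lemma bessel_I_eq_bessel_ser:
  assumes w: "0 < w"
  shows "bessel_I \<nu> (2 * sqrt w) = of_real w powr (\<nu> / 2) * bessel_ser \<nu> (of_real w)"
proof -
  have "of_real (2 * sqrt w / 2) powr (2 * of_nat k + \<nu>) = of_real w powr (\<nu> / 2) * complex_of_real w ^ k" for k
  proof -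
    have "complex_of_real (sqrt w) powr (2 * of_nat k + \<nu>) = exp ((2 * of_nat k + \<nu>) * of_real (ln w / 2))"
      using w by (simp add: powr_def Ln_of_real ln_sqrt)
    also have "\<dots> = exp (\<nu> / 2 * of_real (ln w)) * exp (of_nat k * of_real (ln w))"
      by (simp add: field_simps flip: exp_add)
    also have "exp (of_nat k * complex_of_real (ln w)) = of_real w ^ k"
      using w by (simp add: exp_of_nat_mult exp_of_real)
    finally show ?thesis using w by (simp add: powr_def Ln_of_real)
  qed
  then have "bessel_I \<nu> (2 * sqrt w) = (\<Sum>k. of_real w powr (\<nu> / 2) * (rGamma (of_nat k + \<nu> + 1) / fact k * of_real w ^ k))"
    unfolding bessel_I_def by (simp add: mult_ac)
  then show ?thesis unfolding bessel_ser_def using suminf_mult[OF summable_bessel_ser] by simp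
qed

lemma kern_int_eq_bessel_K:
  assumes w: "0 < w" and \<nu>: "\<nu> \<notin> \<int>"
  shows "kern_int \<nu> (of_real w) = 2 * of_real w powr (\<nu> / 2) * bessel_K \<nu> (2 * sqrt w)"
proof -
  define p where "p = complex_of_real w powr (\<nu> / 2)"
  define q where "q = complex_of_real w powr (- \<nu> / 2)"
  define S where "S = sin (of_real pi * \<nu>)"
  have S: "S \<noteq> 0"
    using \<nu> by (auto simp: S_def sin_eq_0 mult.commute)
  have pq: "p * q = 1" "p * p = of_real w powr \<nu>"
    using w by (simp_all add: p_def q_def flip: powr_add)
  have K: "bessel_K \<nu> (2 * sqrt w) = of_real pi / 2 * (q * bessel_ser (- \<nu>) (of_real w) - p * bessel_ser \<nu> (of_real w)) / S"
    using \<nu> bessel_I_eq_bessel_ser[OF w, of \<nu>] bessel_I_eq_bessel_ser[OF w, of "- \<nu>"]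
    by (simp add: bessel_K_def bessel_K_aux_def p_def q_def S_def mult.commute)
  have "2 * p * bessel_K \<nu> (2 * sqrt w) * S = of_real pi * ((p * q) * bessel_ser (- \<nu>) (of_real w) - (p * p) * bessel_ser \<nu> (of_real w))"
    unfolding K using S by (simp add: field_simps)
  also have "\<dots> = of_real pi * (kern_int \<nu> (of_real w) * (S / of_real pi))"
    unfolding pq using kern_int_eq_bessel_ser[OF w, of \<nu>] by (simp add: S_def)
  also have "\<dots> = kern_int \<nu> (of_real w) * S" by simp
  finally show ?thesis using S by (simp add: p_def)
qed

section \<open>The cosine series and its partial fraction expansion\<close>

text \<open>Pairs are enumerated by \<open>prod_decode\<close>, so termwise integration of series
  applies; absolute convergence makes the result independent of the enumeration.\<close>

lemma integral_has_sum_pairs: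
  fixes f :: "nat \<times> nat \<Rightarrow> 'a \<Rightarrow> 'b::{banach, second_countable_topology}"
  assumes int: "\<And>i. integrable M (f i)"
    and norm: "\<And>x. x \<in> space M \<Longrightarrow> (\<lambda>i. norm (f i x)) summable_on UNIV"
    and g: "\<And>x. x \<in> space M \<Longrightarrow> ((\<lambda>i. f i x) has_sum g x) UNIV"
    and s: "(\<lambda>i. \<integral>x. norm (f i x) \<partial>M) summable_on UNIV"
  shows "integrable M g" and "((\<lambda>i. \<integral>x. f i x \<partial>M) has_sum (\<integral>x. g x \<partial>M)) UNIV"
proof -
  define F where "F = (\<lambda>k. f (prod_decode k))"
  have intF: "integrable M (F k)" for k using int by (simp add: F_def)
  have ae: "AE x in M. summable (\<lambda>k. norm (F k x))"
  proof (rule AE_I2)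
    fix x assume "x \<in> space M"
    then have "(\<lambda>k. norm (F k x)) summable_on UNIV"
      using norm summable_on_reindex_bij_betw[OF bij_prod_decode, of "\<lambda>i. norm (f i x)"] by (simp add: F_def)
    then show "summable (\<lambda>k. norm (F k x))" by (rule summable_on_imp_summable)
  qed
  have "(\<lambda>k. \<integral>x. norm (F k x) \<partial>M) summable_on UNIV"
    using s summable_on_reindex_bij_betw[OF bij_prod_decode, of "\<lambda>i. \<integral>x. norm (f i x) \<partial>M"] by (simp add: F_def)
  then have sF: "summable (\<lambda>k. \<integral>x. norm (F k x) \<partial>M)" by (rule summable_on_imp_summable)
  have gF: "(\<Sum>k. F k x) = g x" if "x \<in> space M" for x
  proof -
    have "((\<lambda>k. F k x) has_sum g x) UNIV"
      using g[OF that] has_sum_reindex_bij_betw[OF bij_prod_decode, of "\<lambda>i. f i x"] by (simp add: F_def)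
    then show ?thesis using has_sum_imp_sums sums_unique by metis
  qed
  show "integrable M g"
    using integrable_suminf[OF intF ae sF] by (rule Bochner_Integration.integrable_cong[THEN iffD1, rotated -1]) (auto simp: gF)
  have "(\<lambda>k. \<integral>x. F k x \<partial>M) sums (\<integral>x. (\<Sum>k. F k x) \<partial>M)"
    by (rule sums_integral[OF intF ae sF])
  also have "(\<integral>x. (\<Sum>k. F k x) \<partial>M) = (\<integral>x. g x \<partial>M)"
    by (rule Bochner_Integration.integral_cong) (auto simp: gF)
  finally have 1: "(\<lambda>k. \<integral>x. F k x \<partial>M) sums (\<integral>x. g x \<partial>M)" .
  have "summable (\<lambda>k. norm (\<integral>x. F k x \<partial>M))"
    by (rule summable_comparison_test'[OF sF]) (simp add: integral_norm_bound)
  from norm_summable_imp_has_sum[OF this 1]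
  have "((\<lambda>k. \<integral>x. f (prod_decode k) x \<partial>M) has_sum (\<integral>x. g x \<partial>M)) UNIV" by (simp add: F_def)
  then show "((\<lambda>i. \<integral>x. f i x \<partial>M) has_sum (\<integral>x. g x \<partial>M)) UNIV"
    using has_sum_reindex_bij_betw[OF bij_prod_decode, of "\<lambda>i. \<integral>x. f i x \<partial>M"] by simp
qed

lemma has_sum_product_pairs:
  fixes a b :: "nat \<Rightarrow> 'a::{real_normed_field, banach}"
  assumes a: "summable (\<lambda>m. norm (a m))" "a sums A" and b: "summable (\<lambda>n. norm (b n))" "b sums B"
  shows "(\<lambda>(m, n). norm (a m * b n)) summable_on UNIV"
    and "((\<lambda>(m, n). a m * b n) has_sum (A * B)) UNIV"
proof -
  have hb: "((\<lambda>n. norm (b n)) has_sum (\<Sum>n. norm (b n))) UNIV" "(b has_sum B) UNIV"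
    using b by (auto intro!: norm_summable_imp_has_sum summable_sums)
  have ha: "((\<lambda>m. norm (a m)) has_sum (\<Sum>m. norm (a m))) UNIV" "(a has_sum A) UNIV"
    using a by (auto intro!: norm_summable_imp_has_sum summable_sums)
  have "(\<lambda>(m, n). norm (a m * b n)) summable_on (UNIV \<times> UNIV)"
  proof (rule summable_on_SigmaI)
    show "((\<lambda>n. case (m, n) of (m, n) \<Rightarrow> norm (a m * b n)) has_sum (norm (a m) * (\<Sum>n. norm (b n)))) UNIV" for m
      using has_sum_cmult_right[OF hb(1), of "norm (a m)"] by (simp add: norm_mult)
    show "(\<lambda>m. norm (a m) * (\<Sum>n. norm (b n))) summable_on UNIV"
      using has_sum_cmult_left[OF ha(1)] summable_on_def by blast
  qed auto
  then show 1: "(\<lambda>(m, n). norm (a m * b n)) summable_on UNIV" by simp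
  have "((\<lambda>(m, n). a m * b n) has_sum (A * B)) (UNIV \<times> UNIV)"
  proof (rule has_sum_SigmaI)
    show "((\<lambda>n. case (m, n) of (m, n) \<Rightarrow> a m * b n) has_sum (a m * B)) UNIV" for m
      using has_sum_cmult_right[OF hb(2), of "a m"] by simp
    show "((\<lambda>m. a m * B) has_sum (A * B)) UNIV"
      using has_sum_cmult_left[OF ha(2)] .
    have "(\<lambda>x. norm (case x of (m, n) \<Rightarrow> a m * b n)) summable_on UNIV \<times> UNIV"
      using 1 by (simp add: case_prod_unfold)
    then show "(\<lambda>(m, n). a m * b n) summable_on UNIV \<times> UNIV"
      by (rule abs_summable_summable)
  qed
  then show "((\<lambda>(m, n). a m * b n) has_sum (A * B)) UNIV" by simp
qed

text \<open>The logarithmic derivative of Gamma(z) Gamma(1 - z), carried out on the entire product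
  of reciprocals, which is sin (pi z) / pi. Keeping the sine as a factor expresses pi cot (pi z)
  without a division.\<close>

lemma Digamma_reflection_complex:
  fixes z :: complex
  assumes "z \<notin> \<int>"
  shows "(Digamma (1 - z) - Digamma z) * sin (of_real pi * z) = of_real pi * cos (of_real pi * z)"
proof -
  have z: "z \<notin> \<int>\<^sub>\<le>\<^sub>0" "1 - z \<notin> \<int>\<^sub>\<le>\<^sub>0"
    using assms nonpos_Ints_subset_Ints Ints_diff[OF Ints_1, of "1 - z"] by auto
  have d1: "((\<lambda>z. rGamma z * rGamma (1 - z)) has_field_derivative
      (- rGamma z * Digamma z) * rGamma (1 - z) + ((- rGamma (1 - z) * Digamma (1 - z)) * (- 1)) * rGamma z) (at z)"
    using z by (intro DERIV_mult has_field_derivative_rGamma_no_nonpos_int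
        DERIV_chain2[where f=rGamma and g="\<lambda>z. 1 - z"]) (auto intro!: derivative_eq_intros)
  have eq: "(\<lambda>z::complex. rGamma z * rGamma (1 - z)) = (\<lambda>z. sin (of_real pi * z) / of_real pi)"
    by (simp add: fun_eq_iff rGamma_reflection_complex)
  have d2: "((\<lambda>z. sin (of_real pi * z) / of_real pi) has_field_derivative cos (of_real pi * z)) (at z)"
    by (auto intro!: derivative_eq_intros)
  have "cos (of_real pi * z) = (- rGamma z * Digamma z) * rGamma (1 - z) + ((- rGamma (1 - z) * Digamma (1 - z)) * (- 1)) * rGamma z"
    by (rule DERIV_unique[OF d2 d1[unfolded eq]])
  also have "\<dots> = (Digamma (1 - z) - Digamma z) * (rGamma z * rGamma (1 - z))"
    by (simp add: algebra_simps)
  finally have "of_real pi * cos (of_real pi * z) =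
      of_real pi * ((Digamma (1 - z) - Digamma z) * (rGamma z * rGamma (1 - z)))"
    by (rule arg_cong)
  also have "\<dots> = (Digamma (1 - z) - Digamma z) * sin (of_real pi * z)"
    unfolding rGamma_reflection_complex by simp
  finally show ?thesis by (rule sym)
qed

text \<open>Half of a periodised Poisson kernel:
  \<open>poisson_ker q t + poisson_ker (1 - q) t\<close> is the sum of t / (t^2 + (n + q)^2) over
  all integers n. The halves are kept apart because each produces its own Hurwitz zeta
  value.\<close>

definition poisson_ker :: "real \<Rightarrow> real \<Rightarrow> real" where
  "poisson_ker q t = (\<Sum>m. t / (t\<^sup>2 + (real m + q)\<^sup>2))"

lemma summable_inverse_square_shift:
  assumes "0 < q"
  shows "summable (\<lambda>m. 1 / (real m + q)\<^sup>2)"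
proof -
  have "summable (\<lambda>n. norm (complex_of_real (real n + q) powr (- 2)))"
    by (rule summable_hurwitz) (use assms in auto)
  moreover have "norm (complex_of_real (real n + q) powr (- 2)) = 1 / (real n + q)\<^sup>2" for n
    using assms by (subst norm_of_real_powr) (auto simp: powr_minus powr_realpow divide_inverse simp flip: powr_numeral)
  ultimately show ?thesis by simp
qed

lemma poisson_ker_term_le:
  assumes "0 < q" "0 \<le> t"
  shows "0 \<le> t / (t\<^sup>2 + (real m + q)\<^sup>2)" "t / (t\<^sup>2 + (real m + q)\<^sup>2) \<le> t * (1 / (real m + q)\<^sup>2)"
  using assms by (auto intro!: divide_left_mono mult_pos_pos add_nonneg_pos simp: add_nonneg_eq_0_iff)

lemma poisson_ker_sums:
  assumes "0 < q" "0 \<le> t"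
  shows "(\<lambda>m. t / (t\<^sup>2 + (real m + q)\<^sup>2)) sums poisson_ker q t"
  unfolding poisson_ker_def
proof (rule summable_sums, rule summable_comparison_test'[where N=0])
  show "summable (\<lambda>m. t * (1 / (real m + q)\<^sup>2))"
    by (rule summable_mult[OF summable_inverse_square_shift[OF assms(1)]])
  show "norm (t / (t\<^sup>2 + (real m + q)\<^sup>2)) \<le> t * (1 / (real m + q)\<^sup>2)" for m
    unfolding real_norm_def abs_of_nonneg[OF poisson_ker_term_le(1)[OF assms]]
    by (rule poisson_ker_term_le(2)[OF assms])
qed

lemma poisson_ker_bounds:
  assumes "0 < q" "0 \<le> t"
  shows "0 \<le> poisson_ker q t" "poisson_ker q t \<le> t * (\<Sum>m. 1 / (real m + q)\<^sup>2)"
proof -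
  show "0 \<le> poisson_ker q t"
    by (rule sums_le[OF _ sums_zero poisson_ker_sums[OF assms]]) (use poisson_ker_term_le[OF assms] in auto)
  show "poisson_ker q t \<le> t * (\<Sum>m. 1 / (real m + q)\<^sup>2)"
    by (rule sums_le[OF _ poisson_ker_sums[OF assms] sums_mult[OF summable_sums[OF summable_inverse_square_shift[OF assms(1)]]]])
       (use poisson_ker_term_le[OF assms] in auto)
qed

lemma borel_measurable_poisson_ker [measurable]: "poisson_ker q \<in> borel_measurable borel"
  unfolding poisson_ker_def[abs_def] by measurable

text \<open>The cosine series C(t, q). Taking the partial fraction side as the definition gives
  measurability and the behaviour near t = 0 at once; the series is recovered in
  \<open>expcos_sums\<close>.\<close>

definition expcos :: "real \<Rightarrow> real \<Rightarrow> real" where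
  "expcos q t = (poisson_ker q t + poisson_ker (1 - q) t) / (2 * pi) - 1 / 2"

lemma borel_measurable_expcos [measurable]: "expcos q \<in> borel_measurable borel"
  unfolding expcos_def[abs_def] by measurable

text \<open>Two evaluations of pi cot (pi z) at z = q + i t are compared. With Q = exp (2 pi i z) it
  equals - i pi (1 + 2 Q / (1 - Q)), where the real part of Q / (1 - Q) is the cosine series; as
  \<open>Digamma (1 - z) - Digamma z\<close> its imaginary part is minus the two Poisson
  sums.\<close>

lemma expcos_sums:
  assumes q: "0 < q" "q < 1" and t: "0 < t"
  shows "(\<lambda>d. exp (- (2 * pi * real (Suc d) * t)) * cos (2 * pi * real (Suc d) * q)) sums expcos q t"
proof -
  define z where "z = Complex q t"
  have z: "Re z = q" "Im z = t" by (simp_all add: z_def)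
  have zn: "z \<notin> \<int>" using t z by (auto elim!: Ints_cases)
  then have z0: "z \<noteq> 0" "z \<noteq> 1" by auto
  define Q where "Q = exp (2 * of_real pi * \<i> * z)"
  have Qn: "norm Q = exp (- (2 * pi * t))" by (simp add: Q_def z)
  then have Q1: "norm Q < 1" using t by simp
  then have Q1': "Q \<noteq> 1" by auto
  define S where "S = Q / (1 - Q)"
  have "(\<lambda>d. Q * Q ^ d) sums (Q * (1 / (1 - Q)))"
    by (rule sums_mult[OF geometric_sums[OF Q1]])
  then have "(\<lambda>d. Re (Q * Q ^ d)) sums Re S" by (intro sums_Re) (simp add: S_def)
  moreover have "Re (Q * Q ^ d) = exp (- (2 * pi * real (Suc d) * t)) * cos (2 * pi * real (Suc d) * q)" for d
  proof -
    have "Q * Q ^ d = exp (of_nat (Suc d) * (2 * of_real pi * \<i> * z))"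
      unfolding Q_def exp_of_nat_mult by simp
    then show ?thesis by (simp add: Re_exp z algebra_simps)
  qed
  ultimately have 1: "(\<lambda>d. exp (- (2 * pi * real (Suc d) * t)) * cos (2 * pi * real (Suc d) * q)) sums Re S" by simp
  \<comment> \<open>In the difference of the two Digamma series the terms 1/(n+1) and Euler's
    constant cancel, leaving the partial fractions of the cotangent.\<close>
  have "(\<lambda>n. (inverse (of_nat (Suc n)) - inverse ((1 - z) + of_nat n)) - (inverse (of_nat (Suc n)) - inverse (z + of_nat n)))
     sums ((Digamma (1 - z) + euler_mascheroni) - (Digamma z + euler_mascheroni))"
    using z0 summable_sums[OF summable_Digamma[of z]] summable_sums[OF summable_Digamma[of "1 - z"]]
    by (intro sums_diff) (auto simp: Digamma_def)
  then have "(\<lambda>n. Im (inverse (z + of_nat n) - inverse ((1 - z) + of_nat n))) sums Im (Digamma (1 - z) - Digamma z)"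
    by (intro sums_Im) simp
  moreover have "Im (inverse (z + of_nat n) - inverse ((1 - z) + of_nat n)) =
      - (t / (t\<^sup>2 + (real n + q)\<^sup>2) + t / (t\<^sup>2 + (real n + (1 - q))\<^sup>2))" for n
    by (simp add: z power2_eq_square algebra_simps)
  moreover have "(\<lambda>n. - (t / (t\<^sup>2 + (real n + q)\<^sup>2) + t / (t\<^sup>2 + (real n + (1 - q))\<^sup>2))) sums (- (poisson_ker q t + poisson_ker (1 - q) t))"
    using q t by (intro sums_minus sums_add poisson_ker_sums) auto
  ultimately have 2: "Im (Digamma (1 - z) - Digamma z) = - (poisson_ker q t + poisson_ker (1 - q) t)"
    using sums_unique2 by simp
  \<comment> \<open>A square root of \<open>Q\<close>. Sine and cosine of pi z are rational in
    \<open>E\<close>, and after multiplication by 2 i E only \<open>Q\<close> remains.\<close>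
  define E where "E = exp (\<i> * of_real pi * z)"
  have E: "E \<noteq> 0" "E * E = Q"
    by (simp_all add: E_def Q_def flip: exp_add) (simp add: algebra_simps)
  have Em: "exp (- (\<i> * (of_real pi * z))) = 1 / E" "exp (\<i> * (of_real pi * z)) = E"
    by (simp_all add: E_def exp_minus divide_inverse mult.assoc)
  have sn: "sin (of_real pi * z) = (E - 1 / E) / (2 * \<i>)" and cs: "cos (of_real pi * z) = (E + 1 / E) / 2"
    unfolding sin_exp_eq cos_exp_eq using Em by (simp_all add: mult.commute)
  define D where "D = Digamma (1 - z) - Digamma z"
  have snQ: "sin (of_real pi * z) * (2 * \<i> * E) = Q - 1" and csQ: "cos (of_real pi * z) * (2 * \<i> * E) = \<i> * (Q + 1)"
    unfolding sn cs using E(1) by (simp_all add: field_simps flip: E(2))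
  have "D * (Q - 1) = D * sin (of_real pi * z) * (2 * \<i> * E)"
    by (simp only: mult.assoc flip: snQ)
  also have "\<dots> = of_real pi * (cos (of_real pi * z) * (2 * \<i> * E))"
    unfolding D_def Digamma_reflection_complex[OF zn] by (simp only: mult.assoc)
  finally have "D * (Q - 1) = of_real pi * (\<i> * (Q + 1))" unfolding csQ .
  then have "D = of_real pi * (\<i> * (Q + 1)) / (Q - 1)" using Q1' by (simp add: eq_divide_eq)
  then have "Digamma (1 - z) - Digamma z = of_real pi * \<i> * ((Q + 1) / (Q - 1))"
    by (simp add: D_def mult.assoc)
  also have "(Q + 1) / (Q - 1) = - (1 + 2 * S)"
    unfolding S_def using Q1' by (simp add: divide_simps) (simp add: algebra_simps)
  finally have "Im (Digamma (1 - z) - Digamma z) = Im (of_real pi * \<i> * - (1 + 2 * S))" by (rule arg_cong)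
  also have "\<dots> = - (pi * (1 + 2 * Re S))" by (simp add: algebra_simps)
  finally have "Im (Digamma (1 - z) - Digamma z) = - (pi * (1 + 2 * Re S))" .
  then have "Re S = expcos q t" using 2 by (simp add: expcos_def field_simps)
  then show ?thesis using 1 by simp
qed

text \<open>For t <= 1 the Poisson sums are bounded; from t = 1 on the cosine series is dominated by
  a geometric series. The rate 1 in place of 2 pi is enough for what follows.\<close>

lemma expcos_bound:
  assumes q: "0 < q" "q < 1"
  shows "\<exists>K>0. \<forall>t>0. \<bar>expcos q t\<bar> \<le> K * exp (- t)"
proof -
  define c where "c = (\<Sum>m. 1 / (real m + q)\<^sup>2) + (\<Sum>m. 1 / (real m + (1 - q))\<^sup>2)"
  \<comment> \<open>The first entry compensates exp (- t) >= exp (- 1) for t <= 1, the second bounds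
    1 / (1 - exp (- t)) for t >= 1.\<close>
  define K where "K = max ((c + 1) * exp 1) (1 / (1 - exp (- 1)))"
  have c: "0 \<le> c"
    unfolding c_def using q by (intro add_nonneg_nonneg suminf_nonneg summable_inverse_square_shift) auto
  have e1: "exp (- 1) < (1::real)" by simp
  have small: "\<bar>expcos q t\<bar> \<le> c + 1" if "0 < t" "t \<le> 1" for t
  proof -
    have "poisson_ker q t + poisson_ker (1 - q) t \<le> t * c" "0 \<le> poisson_ker q t + poisson_ker (1 - q) t"
      using poisson_ker_bounds[of q t] poisson_ker_bounds[of "1 - q" t] q that by (auto simp: c_def distrib_left)
    moreover have "t * c \<le> c" using that c mult_right_mono[of t 1 c] by simp
    ultimately have "poisson_ker q t + poisson_ker (1 - q) t \<le> c" "0 \<le> poisson_ker q t + poisson_ker (1 - q) t" by auto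
    moreover have "1 \<le> 2 * pi" using pi_gt3 by simp
    then have "(poisson_ker q t + poisson_ker (1 - q) t) / (2 * pi) \<le> c / 1"
      using calculation c by (intro frac_le) auto
    moreover have "0 \<le> (poisson_ker q t + poisson_ker (1 - q) t) / (2 * pi)" using calculation by auto
    ultimately show ?thesis using c unfolding expcos_def by (intro abs_leI) linarith+
  qed
  have large: "\<bar>expcos q t\<bar> \<le> 1 / (1 - exp (- 1)) * exp (- t)" if t: "1 \<le> t" for t
  proof -
    have et: "exp (- t) < 1" "exp (- t) \<le> exp (- 1)" using t by auto
    have g: "(\<lambda>d. exp (- t) * exp (- t) ^ d) sums (exp (- t) * (1 / (1 - exp (- t))))"
      using et by (intro sums_mult geometric_sums) auto
    have le: "norm (exp (- (2 * pi * real (Suc d) * t)) * cos (2 * pi * real (Suc d) * q)) \<le> exp (- t) * exp (- t) ^ d" for d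
    proof -
      have "norm (exp (- (2 * pi * real (Suc d) * t)) * cos (2 * pi * real (Suc d) * q)) \<le> exp (- (2 * pi * real (Suc d) * t)) * 1"
        unfolding norm_mult by (intro mult_mono) auto
      also have "\<dots> \<le> exp (- (real (Suc d) * t))"
        using t pi_gt3 mult_right_mono[of 1 "2 * pi" "real (Suc d) * t"] by (simp add: mult_ac)
      also have "\<dots> = exp (- t) * exp (- t) ^ d"
        using exp_of_nat_mult[of "Suc d" "- t"] by simp
      finally show ?thesis .
    qed
    have "0 < t" using t by simp
    have "norm (expcos q t) \<le> exp (- t) * (1 / (1 - exp (- t)))"
      by (rule norm_sums_le[OF expcos_sums[OF q \<open>0 < t\<close>] g le])
    also have "\<dots> \<le> exp (- t) * (1 / (1 - exp (- 1)))"
      using et e1 by (intro mult_left_mono divide_left_mono) auto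
    finally show ?thesis by (simp add: mult.commute)
  qed
  show ?thesis
  proof (intro exI[of _ K] conjI allI impI)
    show K: "0 < K" using e1 by (simp add: K_def less_max_iff_disj)
    fix t :: real assume t: "0 < t"
    show "\<bar>expcos q t\<bar> \<le> K * exp (- t)"
    proof (cases "t \<le> 1")
      case True
      have "c + 1 = (c + 1) * exp 1 * exp (- 1)" by (simp add: exp_minus)
      also have "\<dots> \<le> K * exp (- t)"
        using True c K by (intro mult_mono less_imp_le[OF K]) (auto simp: K_def)
      finally show ?thesis using small[OF t True] by linarith
    next
      case False
      have "1 / (1 - exp (- 1)) * exp (- t) \<le> K * exp (- t)"
        by (intro mult_right_mono) (auto simp: K_def)
      then show ?thesis using large[of t] False by linarith
    qed
  qed
qed

section \<open>The double series\<close>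

lemma powr_add_of_nat:
  assumes "0 < X"
  shows "complex_of_real X powr (c + of_nat k) = complex_of_real X powr c * complex_of_real X ^ k"
  using assms by (simp add: powr_add powr_nat')

lemma powr_minus_2:
  assumes "0 < X"
  shows "complex_of_real X powr c = complex_of_real X powr (c - 2) * complex_of_real X ^ 2"
  using powr_add_of_nat[OF assms, of "c - 2" 2] by simp

lemma powr_sub_2:
  fixes w t :: real
  assumes "0 < w"
  shows "w powr (t - 2) = w powr t / w\<^sup>2"
  using assms by (simp add: powr_diff)

text \<open>Which endpoint dominates depends on whether c >= 1, so the sum of both serves for every
  c and gives bounds that are uniform over a vertical strip.\<close>

lemma powr_strip_le:
  fixes c \<sigma> \<alpha> \<beta> :: real
  assumes "0 < c" "\<alpha> \<le> \<sigma>" "\<sigma> \<le> \<beta>"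
  shows "c powr \<sigma> \<le> c powr \<alpha> + c powr \<beta>"
proof (cases "1 \<le> c")
  case True
  then have "c powr \<sigma> \<le> c powr \<beta>" using assms by (intro powr_mono) auto
  then show ?thesis using powr_ge_zero[of c \<alpha>] by linarith
next
  case False
  then have "c powr \<sigma> \<le> c powr \<alpha>" using assms by (intro powr_mono') auto
  then show ?thesis using powr_ge_zero[of c \<beta>] by linarith
qed

lemma summable_powr_shift:
  fixes a r :: real
  assumes "0 < a" "r < - 1"
  shows "summable (\<lambda>n. (real n + a) powr r)"
proof -
  have "summable (\<lambda>n. norm (complex_of_real (real n + a) powr (- of_real (- r))))"
    by (rule summable_hurwitz) (use assms in auto)
  moreover have "norm (complex_of_real (real n + a) powr (- of_real (- r))) = (real n + a) powr r" for n
    using assms by (subst norm_of_real_powr) auto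
  ultimately show ?thesis by simp
qed

lemma G_fun_holomorphic:
  assumes "0 < x" "0 < u" "0 < v"
  shows "(\<lambda>\<nu>. G_fun x \<nu> N u v) holomorphic_on A"
  using assms unfolding G_fun_def divide_inverse by (cases "u * v = x") (auto intro!: holomorphic_intros)

text \<open>For u v >= 2 x the denominator is at least 3/4 (u v)^2, whence the factor 4/3. Every
  term of the bound is a power of u times a power of v, so the double sum factorises.\<close>

lemma norm_G_fun_le:
  assumes x: "0 < x" and u: "0 < u" and v: "0 < v" and uv: "2 * x \<le> u * v"
    and \<nu>: "\<alpha> \<le> Re \<nu>" "Re \<nu> \<le> \<beta>"
  shows "norm (G_fun x \<nu> N u v) \<le>
     4 / 3 * ((v powr (\<alpha> - 2 * real N - 2) + v powr (\<beta> - 2 * real N - 2)) * u powr (- 2 * real N - 2)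
      + (x powr (\<alpha> - 2 * real N) + x powr (\<beta> - 2 * real N)) * (v powr (- 2) * (u powr (- \<beta> - 2) + u powr (- \<alpha> - 2))))" (is "_ \<le> ?B")
proof -
  let ?\<sigma> = "Re \<nu>"
  have uv0: "0 < u * v" using u v by simp
  have ne: "u * v \<noteq> x" using uv x by linarith
  have sq: "(2 * x)\<^sup>2 \<le> (u * v)\<^sup>2" using x uv by (intro power_mono) auto
  have den: "3 / 4 * (u * v)\<^sup>2 \<le> (u * v)\<^sup>2 - x\<^sup>2" using sq by (simp add: power_mult_distrib)
  have den0: "0 < (u * v)\<^sup>2" using u v by simp
  have "norm (G_fun x \<nu> N u v) = u powr (- ?\<sigma>) *
      (norm (complex_of_real (u * v) powr (\<nu> - 2 * of_nat N) - complex_of_real x powr (\<nu> - 2 * of_nat N)) / \<bar>(u * v)\<^sup>2 - x\<^sup>2\<bar>)"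
    using ne u unfolding G_fun_def by (simp only: if_False norm_mult norm_divide norm_of_real norm_of_real_powr uminus_complex.sel)
  also have "\<dots> \<le> u powr (- ?\<sigma>) * (((u * v) powr (?\<sigma> - 2 * real N) + x powr (?\<sigma> - 2 * real N)) / (3 / 4 * (u * v)\<^sup>2))"
  proof (intro mult_left_mono frac_le)
    show "norm (complex_of_real (u * v) powr (\<nu> - 2 * of_nat N) - complex_of_real x powr (\<nu> - 2 * of_nat N))
       \<le> (u * v) powr (?\<sigma> - 2 * real N) + x powr (?\<sigma> - 2 * real N)"
      by (rule order.trans[OF norm_triangle_ineq4])
         (use uv0 x in \<open>simp only: norm_of_real_powr, simp\<close>)
    show "3 / 4 * (u * v)\<^sup>2 \<le> \<bar>(u * v)\<^sup>2 - x\<^sup>2\<bar>"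
      using den abs_ge_self[of "(u * v)\<^sup>2 - x\<^sup>2"] by linarith
  qed (use den den0 in auto)
  also have "\<dots> = 4 / 3 * (v powr (?\<sigma> - 2 * real N - 2) * u powr (- 2 * real N - 2)
      + x powr (?\<sigma> - 2 * real N) * (v powr (- 2) * u powr (- ?\<sigma> - 2)))"
  proof -
    define \<sigma> where "\<sigma> = ?\<sigma>"
    define M where "M = 2 * real N"
    have "u powr (- \<sigma>) * u powr (\<sigma> - M) = u powr (- M)" by (simp flip: powr_add)
    then have 1: "u powr (- ?\<sigma>) * ((u * v) powr (?\<sigma> - 2 * real N) / (u * v)\<^sup>2) = v powr (?\<sigma> - 2 * real N - 2) * u powr (- 2 * real N - 2)"
      unfolding powr_sub_2[OF u] powr_sub_2[OF v] powr_mult power_mult_distrib \<sigma>_def M_def using u v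
      by (simp add: divide_inverse mult_ac)
    have 2: "u powr (- ?\<sigma>) / (u * v)\<^sup>2 = v powr (- 2) * u powr (- ?\<sigma> - 2)"
    proof -
      have v2: "v powr (- 2) = 1 / v\<^sup>2" using powr_sub_2[OF v, of 0] v by simp
      show ?thesis unfolding powr_sub_2[OF u] power_mult_distrib v2 by simp
    qed
    have "a * ((P + X) / (3 / 4 * D)) = 4 / 3 * (a * (P / D) + X * (a / D))" for a P X D :: real
      by (cases "D = 0") (simp_all add: field_simps)
    then show ?thesis unfolding 1[symmetric] 2[symmetric] .
  qed
  also have "\<dots> \<le> ?B"
    using u v x \<nu> by (intro mult_left_mono add_mono mult_right_mono mult_mono powr_strip_le mult_nonneg_nonneg add_nonneg_nonneg) auto
  finally show ?thesis .
qed

text \<open>The critical exponents of the bound are Re \<nu> - 2 N - 2 for v and - Re \<nu> - 2 for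
  u; both lie below -1 exactly when -1 < Re \<nu> < 2 N + 1. The finitely many pairs with u v < 2 x
  are bounded by compactness.\<close>

lemma G_fun_dominated:
  assumes x: "0 < x" and p: "0 < p" and q: "0 < q" and \<nu>0: "- 1 < Re \<nu>0" "Re \<nu>0 < 2 * real N + 1"
  shows "\<exists>r>0. \<exists>g. g summable_on UNIV \<and>
     (\<forall>\<nu>\<in>ball \<nu>0 r. \<forall>m n. norm (G_fun x \<nu> N (real n + p) (real m + q)) \<le> g (m, n))"
proof -
  \<comment> \<open>Half the distance from \<nu>0 to the edges of the strip, which keeps
    \<open>\<alpha>\<close> and \<open>\<beta>\<close> strictly inside it.\<close>
  define r where "r = min (Re \<nu>0 + 1) (2 * real N + 1 - Re \<nu>0) / 2"
  define \<alpha> where "\<alpha> = Re \<nu>0 - r"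
  define \<beta> where "\<beta> = Re \<nu>0 + r"
  have r: "0 < r" "- 1 < \<alpha>" "\<beta> < 2 * real N + 1" "\<alpha> \<le> \<beta>"
    using \<nu>0 by (auto simp: r_def \<alpha>_def \<beta>_def min_def field_simps)
  have strip: "\<alpha> \<le> Re \<nu>" "Re \<nu> \<le> \<beta>" if "\<nu> \<in> ball \<nu>0 r" for \<nu>
    using that abs_Re_le_cmod[of "\<nu>0 - \<nu>"] by (auto simp: \<alpha>_def \<beta>_def dist_norm)
  define A where "A = (\<lambda>(m, n). ((real m + q) powr (\<alpha> - 2 * real N - 2) + (real m + q) powr (\<beta> - 2 * real N - 2)) * (real n + p) powr (- 2 * real N - 2))"
  define C where "C = (\<lambda>(m, n). (real m + q) powr (- 2) * ((real n + p) powr (- \<beta> - 2) + (real n + p) powr (- \<alpha> - 2)))"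
  define h where "h = (\<lambda>i. 4 / 3 * (A i + (x powr (\<alpha> - 2 * real N) + x powr (\<beta> - 2 * real N)) * C i))"
  have h0: "0 \<le> h i" for i
    unfolding h_def A_def C_def by (auto simp: case_prod_unfold intro!: add_nonneg_nonneg mult_nonneg_nonneg)
  have prod: "(\<lambda>(m, n). a m * b n) summable_on UNIV" if "summable a" "summable b" "\<And>n. 0 \<le> a n" "\<And>n. 0 \<le> b n" for a b :: "nat \<Rightarrow> real"
    using has_sum_product_pairs(2)[of a "suminf a" b "suminf b"] that by (auto intro!: has_sum_imp_summable summable_sums)
  have h: "h summable_on UNIV"
    unfolding h_def A_def C_def using p q r
    by (intro summable_on_cmult_right summable_on_add prod summable_add summable_powr_shift) auto
  define F where "F = {(m, n). (real n + p) * (real m + q) < 2 * x}"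
  have "F \<subseteq> {..nat \<lceil>2 * x / p\<rceil>} \<times> {..nat \<lceil>2 * x / q\<rceil>}"
  proof
    fix i assume i: "i \<in> F"
    obtain m n where mn: "i = (m, n)" by (cases i)
    have lt: "(real n + p) * (real m + q) < 2 * x" using i mn by (simp add: F_def)
    have "p * real m \<le> (real n + p) * (real m + q)" using p q by (intro mult_mono) auto
    then have "real m \<le> 2 * x / p" using lt p by (simp add: field_simps)
    moreover have "real n * q \<le> (real n + p) * (real m + q)" using p q by (intro mult_mono) auto
    then have "real n \<le> 2 * x / q" using lt q by (simp add: field_simps)
    ultimately show "i \<in> {..nat \<lceil>2 * x / p\<rceil>} \<times> {..nat \<lceil>2 * x / q\<rceil>}"
      unfolding mn by simp linarith
  qed
  then have F: "finite F" by (rule finite_subset) auto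
  have "\<exists>B. \<forall>\<nu>\<in>cball \<nu>0 r. norm (G_fun x \<nu> N (real (snd i) + p) (real (fst i) + q)) \<le> B" for i
  proof -
    have "continuous_on (cball \<nu>0 r) (\<lambda>\<nu>. G_fun x \<nu> N (real (snd i) + p) (real (fst i) + q))"
      by (rule holomorphic_on_imp_continuous_on[OF G_fun_holomorphic]) (use x p q in auto)
    then have "compact ((\<lambda>\<nu>. G_fun x \<nu> N (real (snd i) + p) (real (fst i) + q)) ` cball \<nu>0 r)"
      by (rule compact_continuous_image) simp
    from compact_imp_bounded[OF this] show ?thesis unfolding bounded_iff by simp
  qed
  then obtain B where B: "\<And>i \<nu>. \<nu> \<in> cball \<nu>0 r \<Longrightarrow> norm (G_fun x \<nu> N (real (snd i) + p) (real (fst i) + q)) \<le> B i"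
    by metis
  show ?thesis
  proof (intro exI[of _ r] conjI exI[of _ "\<lambda>i. h i + (if i \<in> F then \<bar>B i\<bar> else 0)"] ballI allI)
    show "(\<lambda>i. h i + (if i \<in> F then \<bar>B i\<bar> else 0)) summable_on UNIV"
      by (intro summable_on_add h finite_nonzero_values_imp_summable_on) (use F in \<open>auto intro: finite_subset\<close>)
    fix \<nu> m n assume \<nu>: "\<nu> \<in> ball \<nu>0 r"
    show "norm (G_fun x \<nu> N (real n + p) (real m + q)) \<le> h (m, n) + (if (m, n) \<in> F then \<bar>B (m, n)\<bar> else 0)"
    proof (cases "(m, n) \<in> F")
      case True
      then show ?thesis using B[of \<nu> "(m, n)"] h0[of "(m, n)"] \<nu> by auto
    next
      case False
      have "norm (G_fun x \<nu> N (real n + p) (real m + q)) \<le> h (m, n)"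
        unfolding h_def A_def C_def prod.case by (rule norm_G_fun_le) (use False x p q strip[OF \<nu>] in \<open>auto simp: F_def not_less\<close>)
      then show ?thesis using False by simp
    qed
  qed (use r in auto)
qed

text \<open>The index m goes with the second argument v of \<open>G_fun\<close> (offset q, later
  \<theta> or 1 - \<theta>), n with the first argument u (offset p, later \<psi> or 1 -
  \<psi>).\<close>

definition G_sum :: "real \<Rightarrow> real \<Rightarrow> real \<Rightarrow> nat \<Rightarrow> complex \<Rightarrow> complex" where
  "G_sum x p q N \<nu> = (\<Sum>\<^sub>\<infinity>(m, n)\<in>UNIV. G_fun x \<nu> N (real n + p) (real m + q))"

lemma G_fun_abs_summable:
  assumes "0 < x" "0 < p" "0 < q" "- 1 < Re \<nu>" "Re \<nu> < 2 * real N + 1"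
  shows "(\<lambda>(m, n). norm (G_fun x \<nu> N (real n + p) (real m + q))) summable_on UNIV"
proof -
  obtain r g where r: "r > 0" and g: "g summable_on UNIV"
     "\<And>\<mu> m n. \<mu> \<in> ball \<nu> r \<Longrightarrow> norm (G_fun x \<mu> N (real n + p) (real m + q)) \<le> g (m, n)"
    using G_fun_dominated[OF assms] by metis
  show ?thesis
    by (rule summable_on_comparison_test[OF g(1)]) (use g(2)[of \<nu>] r in auto)
qed

lemma G_fun_summable:
  assumes "0 < x" "0 < p" "0 < q" "- 1 < Re \<nu>" "Re \<nu> < 2 * real N + 1"
  shows "(\<lambda>(m, n). G_fun x \<nu> N (real n + p) (real m + q)) summable_on UNIV"
  using abs_summable_summable[of "\<lambda>(m, n). G_fun x \<nu> N (real n + p) (real m + q)"] G_fun_abs_summable[OF assms]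
  by (simp add: case_prod_unfold)

text \<open>An absolutely convergent unordered sum is an integral over counting measure, so the
  result on dominated parameter integrals yields holomorphy directly.\<close>

lemma G_sum_holomorphic:
  assumes x: "0 < x" and p: "0 < p" and q: "0 < q"
  shows "G_sum x p q N holomorphic_on {\<nu>. - 1 < Re \<nu> \<and> Re \<nu> < 2 * real N + 1}"
proof -
  let ?S = "{\<nu>. - 1 < Re \<nu> \<and> Re \<nu> < 2 * real N + 1}"
  let ?F = "\<lambda>\<nu> i. G_fun x \<nu> N (real (snd i) + p) (real (fst i) + q)"
  have op: "open ?S"
    using open_Int[OF open_halfspace_Re_gt open_halfspace_Re_lt] by (simp add: Collect_conj_eq)
  have "(\<lambda>\<nu>. \<integral>i. ?F \<nu> i \<partial>count_space UNIV) holomorphic_on ?S"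
  proof (rule holomorphic_integral_dominated[OF op])
    show "(\<lambda>\<nu>. ?F \<nu> i) holomorphic_on ?S" for i
      by (rule G_fun_holomorphic) (use x p q in auto)
    fix \<nu>0 assume "\<nu>0 \<in> ?S"
    then obtain r g where r: "r > 0" and g: "g summable_on UNIV"
       "\<And>\<mu> m n. \<mu> \<in> ball \<nu>0 r \<Longrightarrow> norm (G_fun x \<mu> N (real n + p) (real m + q)) \<le> g (m, n)"
      using G_fun_dominated[OF x p q, of \<nu>0 N] by auto
    have "integrable (count_space UNIV) g"
      using g(1) abs_summable_equivalent[of g UNIV] summable_on_iff_abs_summable_on_real[of g UNIV]
      by (simp add: Infinite_Set_Sum.abs_summable_on_def)
    then show "\<exists>r>0. \<exists>g. integrable (count_space UNIV) g \<and> (\<forall>z\<in>ball \<nu>0 r \<inter> ?S. \<forall>i\<in>space (count_space UNIV). norm (?F z i) \<le> g i)"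
      using r g(2) by (intro exI[of _ r] conjI exI[of _ g]) auto
  qed auto
  then show ?thesis
  proof (rule holomorphic_transform)
    fix \<nu> assume "\<nu> \<in> ?S"
    then have "(\<lambda>i. norm (?F \<nu> i)) summable_on UNIV"
      using G_fun_abs_summable[OF x p q, of \<nu> N] by (simp add: case_prod_unfold)
    then have "infsetsum (?F \<nu>) UNIV = infsum (?F \<nu>) UNIV"
      using abs_summable_equivalent by (intro infsetsum_infsum) blast
    then show "(\<integral>i. ?F \<nu> i \<partial>count_space UNIV) = G_sum x p q N \<nu>"
      by (simp add: infsetsum_def G_sum_def case_prod_unfold)
  qed
qed

text \<open>With X = x, Y = u v and s = \<nu> - 2 N the numerators combine to Y^s - X^s - X^2
  (Y^(s-2) - X^(s-2)) = Y^(s-2) (Y^2 - X^2). The denominator cancels, and a power of u times a power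
  of v remains. For Y = X the prescribed values give the same, because s/2 - (s-2)/2 = 1.\<close>

lemma G_fun_telescope:
  assumes x: "0 < x" and u: "0 < u" and v: "0 < v"
  shows "of_real (x ^ (2 * N + 1)) * G_fun x \<nu> N u v - of_real (x ^ (2 * N + 3)) * G_fun x \<nu> (Suc N) u v =
     of_real (x ^ (2 * N + 1)) * (of_real v powr (- (of_nat (2 * N + 2) - \<nu>)) * of_real u powr (- of_nat (2 * N + 2)))"
proof -
  define s where "s = \<nu> - 2 * of_nat N"
  have s': "\<nu> - 2 * of_nat (Suc N) = s - 2" by (simp add: s_def)
  have uv: "0 < u * v" using u v by simp
  define X where "X = complex_of_real x"
  define Y where "Y = complex_of_real (u * v)"
  define c where "c = complex_of_real u powr (- \<nu>)"
  have rhs: "of_real v powr (- (of_nat (2 * N + 2) - \<nu>)) * of_real u powr (- of_nat (2 * N + 2)) = c * Y powr (s - 2)"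
  proof -
    have "c * Y powr (s - 2) = (c * of_real u powr (s - 2)) * of_real v powr (s - 2)"
      unfolding Y_def using u v by (simp add: powr_times_real)
    also have "c * of_real u powr (s - 2) = of_real u powr (- \<nu> + (s - 2))"
      by (simp only: c_def powr_add)
    also have "- \<nu> + (s - 2) = - of_nat (2 * N + 2)" by (simp add: s_def)
    also have "complex_of_real v powr (s - 2) = of_real v powr (- (of_nat (2 * N + 2) - \<nu>))" by (simp add: s_def diff_diff_eq add.commute)
    finally show ?thesis by (simp only: mult.commute)
  qed
  have X: "X \<noteq> 0" "Y \<noteq> 0" using x u v by (auto simp: X_def Y_def)
  have xp: "of_real (x ^ (2 * N + 3)) = of_real (x ^ (2 * N + 1)) * X ^ 2"
    by (simp add: X_def power_add power2_eq_square power3_eq_cube mult_ac)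
  have "G_fun x \<nu> N u v - X ^ 2 * G_fun x \<nu> (Suc N) u v = c * Y powr (s - 2)"
  proof (cases "u * v = x")
    case True
    then have YX: "Y = X" by (simp add: X_def Y_def)
    have e: "X powr (s - 2) = X powr (s - 2 - 2) * X ^ 2"
      unfolding X_def by (rule powr_minus_2[OF x])
    have "G_fun x \<nu> N u v = c * s * X powr (s - 2) / 2"
      using True by (simp add: G_fun_def c_def X_def s_def)
    moreover have "G_fun x \<nu> (Suc N) u v = c * (s - 2) * X powr (s - 2 - 2) / 2"
      using True unfolding G_fun_def s' by (simp add: c_def X_def)
    then have "X ^ 2 * G_fun x \<nu> (Suc N) u v = c * (s - 2) * X powr (s - 2) / 2"
      unfolding e by simp
    ultimately have "G_fun x \<nu> N u v - X ^ 2 * G_fun x \<nu> (Suc N) u v = c * s * X powr (s - 2) / 2 - c * (s - 2) * X powr (s - 2) / 2"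
      by (simp only:)
    also have "\<dots> = c * X powr (s - 2)" by (simp add: field_simps)
    finally show ?thesis unfolding YX .
  next
    case False
    have "(u * v) \<noteq> - x" using uv x by linarith
    then have "(u * v)\<^sup>2 \<noteq> x\<^sup>2" using False by (simp add: power2_eq_iff)
    then have nz: "complex_of_real ((u * v)\<^sup>2 - x\<^sup>2) \<noteq> 0" by (metis eq_iff_diff_eq_0 of_real_eq_0_iff)
    have den: "complex_of_real ((u * v)\<^sup>2 - x\<^sup>2) = Y ^ 2 - X ^ 2" by (simp add: X_def Y_def)
    have d: "Y ^ 2 - X ^ 2 \<noteq> 0" using nz unfolding den .
    have p: "X powr s = X powr (s - 2) * X ^ 2" "Y powr s = Y powr (s - 2) * Y ^ 2"
      unfolding X_def Y_def by (rule powr_minus_2[OF x] powr_minus_2[OF uv])+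
    have "G_fun x \<nu> N u v = c * ((Y powr s - X powr s) / (Y ^ 2 - X ^ 2))"
      using False unfolding G_fun_def den by (simp add: c_def X_def Y_def s_def)
    moreover have "G_fun x \<nu> (Suc N) u v = c * ((Y powr (s - 2) - X powr (s - 2)) / (Y ^ 2 - X ^ 2))"
      using False unfolding G_fun_def den s' by (simp add: c_def X_def Y_def)
    ultimately have "G_fun x \<nu> N u v - X ^ 2 * G_fun x \<nu> (Suc N) u v =
       c * ((Y powr s - X powr s - X ^ 2 * (Y powr (s - 2) - X powr (s - 2))) / (Y ^ 2 - X ^ 2))"
      by (simp add: diff_divide_distrib right_diff_distrib mult_ac)
    also have "Y powr s - X powr s - X ^ 2 * (Y powr (s - 2) - X powr (s - 2)) = Y powr (s - 2) * (Y ^ 2 - X ^ 2)"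
      unfolding p by (simp add: algebra_simps)
    finally show ?thesis using d by simp
  qed
  then have "of_real (x ^ (2 * N + 1)) * (G_fun x \<nu> N u v - X ^ 2 * G_fun x \<nu> (Suc N) u v) = of_real (x ^ (2 * N + 1)) * (c * Y powr (s - 2))"
    by (rule arg_cong)
  then show ?thesis unfolding rhs xp by (simp only: right_diff_distrib mult.assoc)
qed

text \<open>The remainder of the termwise identity separates into two Dirichlet series, with
  exponent 2 N + 2 - \<nu> in v and 2 N + 2 in u, both of real part above 1.\<close>

lemma G_sum_telescope:
  assumes x: "0 < x" and p: "0 < p" and q: "0 < q" and \<nu>: "- 1 < Re \<nu>" "Re \<nu> < 2 * real N + 1"
  shows "of_real (x ^ (2 * N + 1)) * G_sum x p q N \<nu> - of_real (x ^ (2 * N + 3)) * G_sum x p q (Suc N) \<nu> =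
     of_real (x ^ (2 * N + 1)) * (hurwitz_zeta (of_nat (2 * N + 2) - \<nu>) q * hurwitz_zeta (of_nat (2 * N + 2)) p)"
proof -
  have re: "1 < Re (of_nat (2 * N + 2) - \<nu>)" "1 < Re (of_nat (2 * N + 2) :: complex)" using \<nu> by auto
  \<comment> \<open>The strip of convergence widens with the index, so both sums converge for this
    \<nu>.\<close>
  have hs: "((\<lambda>(m, n). G_fun x \<nu> M (real n + p) (real m + q)) has_sum G_sum x p q M \<nu>) UNIV" if "N \<le> M" for M
    unfolding G_sum_def by (rule has_sum_infsum[OF G_fun_summable]) (use assms that in auto)
  let ?g = "\<lambda>i. of_real (x ^ (2 * N + 1)) * (case i of (m, n) \<Rightarrow> G_fun x \<nu> N (real n + p) (real m + q))
      - of_real (x ^ (2 * N + 3)) * (case i of (m, n) \<Rightarrow> G_fun x \<nu> (Suc N) (real n + p) (real m + q))"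
  let ?h = "\<lambda>i. of_real (x ^ (2 * N + 1)) * (case i of (m, n) \<Rightarrow> of_real (real m + q) powr (- (of_nat (2 * N + 2) - \<nu>)) * of_real (real n + p) powr (- of_nat (2 * N + 2)))"
  have hd: "((\<lambda>i. f i - g i) has_sum (a - b)) UNIV" if "(f has_sum a) UNIV" "(g has_sum b) UNIV"
    for f g :: "nat \<times> nat \<Rightarrow> complex" and a b
    using has_sum_add[OF that(1) has_sum_cmult_right[OF that(2), of "- 1"]] by simp
  have 1: "(?g has_sum
     (of_real (x ^ (2 * N + 1)) * G_sum x p q N \<nu> - of_real (x ^ (2 * N + 3)) * G_sum x p q (Suc N) \<nu>)) UNIV"
    by (intro hd has_sum_cmult_right hs) auto
  have sm: "(\<lambda>n. complex_of_real (real n + a) powr (- s)) sums hurwitz_zeta s a" if "1 < Re s" "0 < a" for s a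
    unfolding hurwitz_zeta_properties(2)[OF that(2,1)] by (rule summable_sums[OF summable_norm_cancel[OF summable_hurwitz[OF that]]])
  have 2: "(?h has_sum
      of_real (x ^ (2 * N + 1)) * (hurwitz_zeta (of_nat (2 * N + 2) - \<nu>) q * hurwitz_zeta (of_nat (2 * N + 2)) p)) UNIV"
    by (intro has_sum_cmult_right has_sum_product_pairs(2) sm summable_hurwitz re p q)
  have "?g i = ?h i" for i
    using G_fun_telescope[OF x, of "real (snd i) + p" "real (fst i) + q" N \<nu>] p q by (simp only: case_prod_unfold)
  then show ?thesis using has_sum_unique[OF 1] 2 by simp
qed

section \<open>Mellin transforms\<close>

lemma Gamma_reflection_real:
  assumes "0 < p" "p < (1::real)"
  shows "Gamma p * Gamma (1 - p) = pi / sin (pi * p)"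
proof -
  have "complex_of_real (Gamma p * Gamma (1 - p)) = Gamma (of_real p) * Gamma (1 - of_real p)"
    using Gamma_complex_of_real[of "1 - p"] by (simp add: Gamma_complex_of_real)
  also have "\<dots> = of_real pi / sin (of_real pi * of_real p)"
    by (rule Gamma_reflection_complex)
  also have "\<dots> = complex_of_real (pi / sin (pi * p))"
    by (simp flip: sin_of_real)
  finally show ?thesis using of_real_eq_iff by blast
qed

text \<open>Substituting t = exp w / (1 + exp w) leads to the Beta integral B(p, 1 - p) = Gamma(p)
  Gamma(1 - p).\<close>

lemma has_bochner_integral_logistic:
  assumes p: "0 < p" "p < (1::real)"
  shows "has_bochner_integral lborel (\<lambda>w. exp (p * w) / (1 + exp w)) (pi / sin (pi * p))"
proof -
  define g where "g = (\<lambda>w::real. exp w / (1 + exp w))"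
  define f where "f = (\<lambda>t::real. t powr (p - 1) * (1 - t) powr (- p))"
  have pos: "0 < 1 + exp w" for w :: real by (simp add: add_pos_pos)
  have eq: "\<bar>exp w / (1 + exp w)\<^sup>2\<bar> *\<^sub>R f (g w) = exp (p * w) / (1 + exp w)" for w
  proof -
    define L where "L = ln (1 + exp w)"
    have eL: "1 + exp w = exp L" using pos[of w] by (simp add: L_def)
    have "1 - g w = exp (- L)" using pos[of w]
      unfolding g_def exp_minus eL[symmetric] by (simp add: field_simps)
    moreover have "g w = exp (w - L)" unfolding g_def eL by (simp add: exp_diff)
    ultimately have "f (g w) = exp ((w - L) * (p - 1)) * exp (L * p)"
      unfolding f_def by (simp add: powr_def mult.commute)
    then have "\<bar>exp w / (1 + exp w)\<^sup>2\<bar> *\<^sub>R f (g w) = exp (w - 2 * L) * (exp ((w - L) * (p - 1)) * exp (L * p))"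
      unfolding eL by (simp add: exp_diff exp_double)
    also have "\<dots> = exp (p * w - L)" by (simp add: algebra_simps flip: exp_add)
    finally show ?thesis by (simp add: exp_diff eL)
  qed
  have der: "(g has_field_derivative exp w / (1 + exp w)\<^sup>2) (at w within UNIV)" for w
    unfolding g_def using pos[of w] by (auto intro!: derivative_eq_intros simp: field_simps power2_eq_square)
  have inj: "inj_on g UNIV"
  proof (rule inj_onI)
    fix w v assume "g w = g v"
    then show "w = v" using pos[of w] pos[of v] by (simp add: g_def field_simps)
  qed
  have ran: "g ` UNIV = {0<..<1}"
  proof (intro equalityI subsetI)
    fix t :: real assume t: "t \<in> {0<..<1}"
    then have "g (ln (t / (1 - t))) = t" by (simp add: g_def field_simps)
    then show "t \<in> range g" by (metis rangeI)
  qed (use pos in \<open>auto simp: g_def divide_simps\<close>)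
  have "set_integrable lborel {0..1} f"
    using integrable_Beta[of p "1 - p"] p by (simp add: f_def)
  then have "set_integrable lborel {0<..<1} f"
    by (rule set_integrable_subset) auto
  then have i1: "f absolutely_integrable_on {0<..<1}"
    unfolding set_integrable_def by (subst integrable_completion) (auto simp: f_def)
  have "(f has_integral Beta p (1 - p)) {0..1}"
    using has_integral_Beta_real[of p "1 - p"] p by (simp add: f_def)
  then have "(f has_integral Beta p (1 - p)) {0<..<1}"
    by (simp add: has_integral_Icc_iff_Ioo)
  then have i2: "integral {0<..<1} f = pi / sin (pi * p)"
    using Gamma_reflection_real[OF p] by (simp add: integral_unique Beta_def)
  have "(\<lambda>w. \<bar>exp w / (1 + exp w)\<^sup>2\<bar> *\<^sub>R f (g w)) absolutely_integrable_on UNIV \<and>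
     integral UNIV (\<lambda>w. \<bar>exp w / (1 + exp w)\<^sup>2\<bar> *\<^sub>R f (g w)) = pi / sin (pi * p)"
    using has_absolute_integral_change_of_variables_real[OF _ der inj, of f "pi / sin (pi * p)"] i1 i2
    unfolding ran by simp
  then have 1: "(\<lambda>w. exp (p * w) / (1 + exp w)) absolutely_integrable_on UNIV"
    and 2: "integral UNIV (\<lambda>w. exp (p * w) / (1 + exp w)) = pi / sin (pi * p)"
    unfolding eq by auto
  have 3: "integrable lborel (\<lambda>w. exp (p * w) / (1 + exp w))"
    using 1 unfolding set_integrable_def by (subst (asm) integrable_completion) auto
  show ?thesis using 3 2 integral_lborel[OF 3] by (simp add: has_bochner_integral_iff)
qed

text \<open>The Mellin transform of 1 / (t^2 + c^2) with t = exp y; w = 2 y - 2 ln c turns it into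
  the logistic integral with p = s/2.\<close>

lemma has_bochner_integral_exp_quadratic:
  fixes s c :: real
  assumes s: "0 < s" "s < 2" and c: "0 < c"
  shows "has_bochner_integral lborel (\<lambda>y. exp (s * y) / (exp y ^ 2 + c\<^sup>2)) (c powr (s - 2) * (pi / (2 * sin (pi * s / 2))))"
proof -
  have "has_bochner_integral lborel (\<lambda>w. exp (s / 2 * w) / (1 + exp w)) (pi / sin (pi * (s / 2)))"
    by (rule has_bochner_integral_logistic) (use s in auto)
  then have "has_bochner_integral lborel (\<lambda>y. exp (s / 2 * (- 2 * ln c + 2 * y)) / (1 + exp (- 2 * ln c + 2 * y))) (pi / sin (pi * (s / 2)) /\<^sub>R \<bar>2\<bar>)"
    by (subst (asm) lborel_has_bochner_integral_real_affine_iff[of 2 _ _ "- 2 * ln c"]) auto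
  then have A: "has_bochner_integral lborel (\<lambda>y. c powr (s - 2) * (exp (s / 2 * (- 2 * ln c + 2 * y)) / (1 + exp (- 2 * ln c + 2 * y)))) (c powr (s - 2) * (pi / sin (pi * (s / 2)) /\<^sub>R \<bar>2\<bar>))"
    by (rule has_bochner_integral_mult_right[rotated]) 
  have eq: "c powr (s - 2) * (exp (s / 2 * (- 2 * ln c + 2 * y)) / (1 + exp (- 2 * ln c + 2 * y))) = exp (s * y) / (exp y ^ 2 + c\<^sup>2)" for y
  proof -
    have h1: "exp (- 2 * ln c + 2 * y) = exp y ^ 2 / c\<^sup>2"
    proof -
      have "- 2 * ln c + 2 * y = 2 * y - 2 * ln c" by simp
      then show ?thesis using c by (simp only: exp_diff exp_double exp_ln)
    qed
    have h2: "exp (s / 2 * (- 2 * ln c + 2 * y)) = exp (s * y) * c powr (- s)"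
      using c by (simp add: powr_def algebra_simps flip: exp_add)
    have h3: "c powr (s - 2) * c powr (- s) = 1 / c\<^sup>2"
    proof -
      have "c powr (s - 2) * c powr (- s) = c powr (s - 2 + - s)" by (simp only: powr_add)
      also have "\<dots> = c powr (- 2)" by simp
      finally show ?thesis using c powr_minus[of c 2] by (simp add: divide_inverse)
    qed
    have h4: "1 + exp y ^ 2 / c\<^sup>2 = (exp y ^ 2 + c\<^sup>2) / c\<^sup>2" using c by (simp add: field_simps)
    have "c powr (s - 2) * (exp (s * y) * c powr (- s) / (1 + exp y ^ 2 / c\<^sup>2)) =
        (c powr (s - 2) * c powr (- s)) * exp (s * y) / (1 + exp y ^ 2 / c\<^sup>2)"
      by simp
    also have "\<dots> = exp (s * y) / (exp y ^ 2 + c\<^sup>2)"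
      unfolding h3 h4 using c by simp
    finally show ?thesis unfolding h1 h2 .
  qed
  show ?thesis using A unfolding eq by simp
qed

text \<open>Each term is a quadratic integral at s + 1, and sin (pi (s+1) / 2) = cos (pi s / 2). The
  term integrals need s > -1 at the origin t = 0, and summability of (m + q)^(s-1) needs s <
  0.\<close>

lemma has_bochner_integral_poisson_ker:
  fixes s q :: real
  assumes s: "- 1 < s" "s < 0" and q: "0 < q"
  shows "has_bochner_integral lborel (\<lambda>y. exp (s * y) * poisson_ker q (exp y))
     (pi / (2 * cos (pi * s / 2)) * (\<Sum>m. (real m + q) powr (s - 1)))"
proof -
  let ?f = "\<lambda>m y. exp (s * y) * (exp y / ((exp y)\<^sup>2 + (real m + q)\<^sup>2))"
  have sn: "sin (pi * (s + 1) / 2) = cos (pi * s / 2)"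
  proof -
    have "pi * (s + 1) / 2 = pi / 2 + pi * s / 2" by (simp add: field_simps)
    then show ?thesis by (simp only: sin_add) simp
  qed
  have f: "has_bochner_integral lborel (?f m) ((real m + q) powr (s - 1) * (pi / (2 * cos (pi * s / 2))))" for m
  proof -
    have "has_bochner_integral lborel (\<lambda>y. exp ((s + 1) * y) / (exp y ^ 2 + (real m + q)\<^sup>2)) ((real m + q) powr (s + 1 - 2) * (pi / (2 * sin (pi * (s + 1) / 2))))"
      by (rule has_bochner_integral_exp_quadratic) (use s q in auto)
    then show ?thesis unfolding sn by (simp add: exp_add distrib_right)
  qed
  have f0: "0 \<le> ?f m y" for m y using q by (auto intro!: mult_nonneg_nonneg divide_nonneg_nonneg)
  have int: "integrable lborel (?f m)" and I: "(\<integral>y. ?f m y \<partial>lborel) = (real m + q) powr (s - 1) * (pi / (2 * cos (pi * s / 2)))" for m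
    using f[of m] by (auto simp: has_bochner_integral_iff)
  have nI: "(\<integral>y. norm (?f m y) \<partial>lborel) = (real m + q) powr (s - 1) * (pi / (2 * cos (pi * s / 2)))" for m
    using I[of m] f0 by simp
  have sm: "summable (\<lambda>m. (real m + q) powr (s - 1))" by (rule summable_powr_shift) (use s q in auto)
  have ps: "(\<lambda>m. ?f m y) sums (exp (s * y) * poisson_ker q (exp y))" for y
    using q by (intro sums_mult poisson_ker_sums) auto
  have 1: "AE y in lborel. summable (\<lambda>m. norm (?f m y))"
    using ps f0 by (auto simp: sums_iff)
  have 2: "summable (\<lambda>m. \<integral>y. norm (?f m y) \<partial>lborel)"
    unfolding nI by (rule summable_mult2[OF sm])
  have eq: "(\<Sum>m. ?f m y) = exp (s * y) * poisson_ker q (exp y)" for y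
    using ps[of y] by (simp add: sums_iff)
  have "integrable lborel (\<lambda>y. exp (s * y) * poisson_ker q (exp y))"
    using integrable_suminf[OF int 1 2] unfolding eq .
  moreover have "(\<integral>y. exp (s * y) * poisson_ker q (exp y) \<partial>lborel) = (\<Sum>m. (real m + q) powr (s - 1) * (pi / (2 * cos (pi * s / 2))))"
    using integral_suminf[OF int 1 2] unfolding eq I .
  moreover have "\<dots> = pi / (2 * cos (pi * s / 2)) * (\<Sum>m. (real m + q) powr (s - 1))"
    unfolding suminf_mult2[OF sm, symmetric] by (rule mult.commute)
  ultimately show ?thesis by (simp add: has_bochner_integral_iff)
qed

lemma hurwitz_zeta_of_real:
  assumes "1 < s" "0 < q"
  shows "hurwitz_zeta (of_real s) q = of_real (\<Sum>m. (real m + q) powr (- s))"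
proof -
  have "complex_of_real (real m + q) powr (- of_real s) = of_real ((real m + q) powr (- s))" for m
    using assms powr_of_real[of "real m + q" "- s"] by simp
  then show ?thesis
    using hurwitz_zeta_properties(2)[of q "of_real s"] assms summable_powr_shift[of q "- s"]
    by (simp add: suminf_of_real del: of_real_add)
qed

lemma has_bochner_integral_exp_neg:
  fixes s :: real
  assumes "s < 0"
  shows "has_bochner_integral lborel (\<lambda>y. indicator {0..} y * exp (s * y)) (- 1 / s)"
proof -
  have 1: "((\<lambda>y. exp (s * y)) has_integral (- 1 / s)) {0..}"
    using has_integral_exp_minus_to_infinity[of "- s" 0] assms by simp
  then have "(\<lambda>y. exp (s * y)) absolutely_integrable_on {0..}"
    by (subst absolutely_integrable_on_iff_nonneg) (auto dest: has_integral_integrable)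
  then have 2: "set_integrable lborel {0..} (\<lambda>y. exp (s * y))"
    unfolding set_integrable_def by (subst (asm) integrable_completion) auto
  show ?thesis
    using 2 set_borel_integral_eq_integral(2)[OF 2] integral_unique[OF 1]
    by (simp add: has_bochner_integral_iff set_integrable_def set_lebesgue_integral_def)
qed

lemma has_bochner_integral_exp_pos:
  fixes s :: real
  assumes "0 < s"
  shows "has_bochner_integral lborel (\<lambda>y. indicator {..0} y * exp (s * y)) (1 / s)"
proof -
  have "has_bochner_integral lborel (\<lambda>y. indicator {0..} (0 + (-1) * y) * exp (- s * (0 + (-1) * y))) ((- 1 / - s) /\<^sub>R \<bar>-1\<bar>)"
    by (subst lborel_has_bochner_integral_real_affine_iff[symmetric]) (use has_bochner_integral_exp_neg[of "- s"] assms in auto)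
  then show ?thesis by (simp add: indicator_def)
qed

text \<open>Removing the constant term \<open>- 1 / 2\<close> of \<open>expcos q t\<close> at \<open>t = 0\<close> extends the strip of convergence of the
  Mellin transform from \<open>Re s > 0\<close> to \<open>Re s > - 1\<close>.\<close>
definition reg_expcos :: "real \<Rightarrow> real \<Rightarrow> real" where
  "reg_expcos q y = expcos q (exp y) + indicator {..0} y / 2"

definition reg_expcos_Mellin :: "real \<Rightarrow> complex \<Rightarrow> complex" where
  "reg_expcos_Mellin q s = (\<integral>y. exp (s * of_real y) * of_real (reg_expcos q y) \<partial>lborel)"

text \<open>For y <= 0 the added 1/2 cancels the constant of \<open>expcos\<close>, and the Poisson
  sums that remain are at most c exp y, giving the rate 1 + \<alpha>. For y > 0 the factor exp (-
  exp y) absorbs exp (\<sigma> y) and leaves the rate 1.\<close>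

lemma reg_expcos_bound:
  assumes q: "0 < q" "q < 1"
  shows "\<exists>C. \<forall>\<sigma> y. \<alpha> \<le> \<sigma> \<longrightarrow> \<sigma> \<le> real n - 1 \<longrightarrow> exp (\<sigma> * y) * \<bar>reg_expcos q y\<bar> \<le> C * exp (- (min 1 (1 + \<alpha>) * \<bar>y\<bar>))"
proof -
  obtain K where K: "0 < K" "\<And>t. 0 < t \<Longrightarrow> \<bar>expcos q t\<bar> \<le> K * exp (- t)"
    using expcos_bound[OF q] by blast
  define c where "c = (\<Sum>m. 1 / (real m + q)\<^sup>2) + (\<Sum>m. 1 / (real m + (1 - q))\<^sup>2)"
  have c: "0 \<le> c"
    unfolding c_def using q by (intro add_nonneg_nonneg suminf_nonneg summable_inverse_square_shift) auto
  have "exp (\<sigma> * y) * \<bar>reg_expcos q y\<bar> \<le> (c + K * fact n) * exp (- (min 1 (1 + \<alpha>) * \<bar>y\<bar>))"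
    if \<sigma>: "\<alpha> \<le> \<sigma>" "\<sigma> \<le> real n - 1" for \<sigma> y
  proof (cases "y \<le> 0")
    case True
    have e: "reg_expcos q y = (poisson_ker q (exp y) + poisson_ker (1 - q) (exp y)) / (2 * pi)"
      using True by (simp add: reg_expcos_def expcos_def)
    have "poisson_ker q (exp y) + poisson_ker (1 - q) (exp y) \<le> exp y * c" "0 \<le> poisson_ker q (exp y) + poisson_ker (1 - q) (exp y)"
      using poisson_ker_bounds[of q "exp y"] poisson_ker_bounds[of "1 - q" "exp y"] q by (auto simp: c_def distrib_left)
    moreover have "1 \<le> 2 * pi" using pi_gt3 by simp
    ultimately have "(poisson_ker q (exp y) + poisson_ker (1 - q) (exp y)) / (2 * pi) \<le> exp y * c / 1"
      using c by (intro frac_le) auto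
    then have "\<bar>reg_expcos q y\<bar> \<le> exp y * c"
      unfolding e using \<open>0 \<le> poisson_ker q (exp y) + poisson_ker (1 - q) (exp y)\<close> by simp
    then have "exp (\<sigma> * y) * \<bar>reg_expcos q y\<bar> \<le> exp (\<sigma> * y) * (exp y * c)"
      by (intro mult_left_mono) auto
    also have "\<dots> = c * exp ((1 + \<sigma>) * y)" by (simp add: exp_add distrib_right)
    also have "\<dots> \<le> c * exp (- (min 1 (1 + \<alpha>) * \<bar>y\<bar>))"
      using True \<sigma> c mult_right_mono_neg[of "min 1 (1 + \<alpha>)" "1 + \<sigma>" y] by (intro mult_left_mono) auto
    also have "\<dots> \<le> (c + K * fact n) * exp (- (min 1 (1 + \<alpha>) * \<bar>y\<bar>))"
      using K by (intro mult_right_mono) auto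
    finally show ?thesis .
  next
    case False
    have "exp (\<sigma> * y) * \<bar>reg_expcos q y\<bar> \<le> exp (\<sigma> * y) * (K * exp (- exp y))"
      using False K(2)[of "exp y"] by (intro mult_left_mono) (auto simp: reg_expcos_def)
    also have "\<dots> \<le> exp (\<sigma> * y) * (K * (fact n / exp y ^ n))"
      using K by (intro mult_left_mono exp_minus_le_power) auto
    also have "\<dots> = K * fact n * exp ((\<sigma> - real n) * y)"
      by (simp add: exp_diff left_diff_distrib exp_of_nat_mult exp_of_nat2_mult)
    also have "\<dots> \<le> K * fact n * exp (- (min 1 (1 + \<alpha>) * \<bar>y\<bar>))"
      using False \<sigma> K mult_right_mono[of "\<sigma> - real n" "- min 1 (1 + \<alpha>)" y] by (intro mult_left_mono) auto
    also have "\<dots> \<le> (c + K * fact n) * exp (- (min 1 (1 + \<alpha>) * \<bar>y\<bar>))"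
      using c by (intro mult_right_mono) auto
    finally show ?thesis .
  qed
  then show ?thesis by blast
qed

lemma integrable_exp_minus_abs_scaled:
  assumes "0 < c"
  shows "integrable lborel (\<lambda>y::real. exp (- (c * \<bar>y\<bar>)))"
  using lborel_integrable_real_affine[OF integrable_exp_minus_abs, of c 0] assms by (simp add: abs_mult)

lemma borel_measurable_reg_expcos [measurable]: "reg_expcos q \<in> borel_measurable borel"
  unfolding reg_expcos_def[abs_def] by measurable

lemma integrable_reg_expcos:
  assumes q: "0 < q" "q < 1" and s: "- 1 < Re s"
  shows "integrable lborel (\<lambda>y. exp (s * of_real y) * of_real (reg_expcos q y))"
proof -
  obtain n where n: "Re s + 1 \<le> real n" using real_arch_simple by blast
  obtain C where C0: "\<And>\<sigma> y. Re s \<le> \<sigma> \<Longrightarrow> \<sigma> \<le> real n - 1 \<Longrightarrow>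
      exp (\<sigma> * y) * \<bar>reg_expcos q y\<bar> \<le> C * exp (- (min 1 (1 + Re s) * \<bar>y\<bar>))"
    using reg_expcos_bound[OF q, of "Re s" n] by blast
  have C: "exp (Re s * y) * \<bar>reg_expcos q y\<bar> \<le> C * exp (- (min 1 (1 + Re s) * \<bar>y\<bar>))" for y
    by (rule C0) (use n in auto)
  have "integrable lborel (\<lambda>y. C * exp (- (min 1 (1 + Re s) * \<bar>y\<bar>)))"
    using integrable_exp_minus_abs_scaled[of "min 1 (1 + Re s)"] s by auto
  then show ?thesis
    by (rule Bochner_Integration.integrable_bound)
       (auto simp: norm_mult intro!: order.trans[OF C abs_ge_self] borel_measurable_continuous_onI continuous_intros)
qed

lemma holomorphic_Mellin_reg_expcos:
  assumes q: "0 < q" "q < 1"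
  shows "reg_expcos_Mellin q holomorphic_on {s. - 1 < Re s}"
  unfolding reg_expcos_Mellin_def
proof (rule holomorphic_integral_dominated)
  show "open {s. - 1 < Re s}" by (rule open_halfspace_Re_gt)
  show "(\<lambda>y. exp (s * of_real y) * of_real (reg_expcos q y)) \<in> borel_measurable lborel" if "s \<in> {s. - 1 < Re s}" for s
    using integrable_reg_expcos[OF q, of s] that by auto
  show "(\<lambda>s. exp (s * of_real y) * of_real (reg_expcos q y)) holomorphic_on {s. - 1 < Re s}" for y
    by (intro holomorphic_intros)
  fix s assume s: "s \<in> {s. - 1 < Re s}"
  \<comment> \<open>Half the distance from Re s to -1, so that Re s - r is still above -1.\<close>
  define r where "r = (1 + Re s) / 2"
  have r: "0 < r" using s by (simp add: r_def)
  obtain n where n: "Re s + r + 1 \<le> real n" using real_arch_simple by blast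
  obtain C where C: "\<And>\<sigma> y. Re s - r \<le> \<sigma> \<Longrightarrow> \<sigma> \<le> real n - 1 \<Longrightarrow>
      exp (\<sigma> * y) * \<bar>reg_expcos q y\<bar> \<le> C * exp (- (min 1 (1 + (Re s - r)) * \<bar>y\<bar>))"
    using reg_expcos_bound[OF q, of "Re s - r" n] by blast
  show "\<exists>r>0. \<exists>g. integrable lborel g \<and> (\<forall>z\<in>ball s r \<inter> {s. - 1 < Re s}. \<forall>y\<in>space lborel. norm (exp (z * of_real y) * of_real (reg_expcos q y)) \<le> g y)"
  proof (intro exI[of _ r] conjI r exI[of _ "\<lambda>y. C * exp (- (min 1 (1 + (Re s - r)) * \<bar>y\<bar>))"] ballI)
    have "0 < min 1 (1 + (Re s - r))" using s by (simp add: r_def field_simps)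
    then show "integrable lborel (\<lambda>y. C * exp (- (min 1 (1 + (Re s - r)) * \<bar>y\<bar>)))"
      using integrable_exp_minus_abs_scaled by auto
    fix z and y :: real assume "z \<in> ball s r \<inter> {s. - 1 < Re s}"
    then have "Re s - r \<le> Re z" "Re z \<le> real n - 1"
      using abs_Re_le_cmod[of "s - z"] n by (auto simp: dist_norm)
    then show "norm (exp (z * of_real y) * of_real (reg_expcos q y)) \<le> C * exp (- (min 1 (1 + (Re s - r)) * \<bar>y\<bar>))"
      using C[of "Re z" y] by (simp add: norm_mult)
  qed
qed

text \<open>Real intervals are the sets of agreement in the identity theorem, which asks for a limit
  point in the complex plane.\<close>

lemma of_real_islimpt_image:
  assumes "a < t" "t < b"
  shows "complex_of_real t islimpt complex_of_real ` {a<..<b}"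
  unfolding islimpt_approachable
proof (intro allI impI)
  fix e :: real assume e: "0 < e"
  define d where "d = min e (b - t) / 2"
  have d: "0 < d" "d < e" "t + d < b" using e assms by (auto simp: d_def min_def field_simps)
  then have "complex_of_real (t + d) \<in> complex_of_real ` {a<..<b}"
    using assms by (intro imageI) auto
  then show "\<exists>x'\<in>complex_of_real ` {a<..<b}. x' \<noteq> complex_of_real t \<and> dist x' (complex_of_real t) < e"
    by (rule bexI[rotated]) (use d in \<open>auto simp: dist_norm\<close>)
qed

lemma reg_expcos_Mellin_of_real:
  "reg_expcos_Mellin q (of_real s) = complex_of_real (\<integral>y. exp (s * y) * reg_expcos q y \<partial>lborel)"
  unfolding reg_expcos_Mellin_def
  by (subst integral_complex_of_real[symmetric]) (simp add: exp_of_real[symmetric])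

text \<open>Away from y = 0 the regularised function is the Poisson sums over 2 pi minus 1/2 on y >=
  0. For s < 0 that constant is integrable against exp (s y) and contributes 1 / (2 s); the Poisson
  sums contribute zeta series.\<close>

lemma Mellin_reg_expcos_strip:
  assumes q: "0 < q" "q < 1" and s: "- 1 < s" "s < 0"
  shows "4 * cos (of_real pi * of_real s / 2) * (reg_expcos_Mellin q (of_real s) - 1 / (2 * of_real s)) =
     hurwitz_zeta (1 - of_real s) q + hurwitz_zeta (1 - of_real s) (1 - q)"
proof -
  define Z where "Z = (\<Sum>m. (real m + q) powr (s - 1)) + (\<Sum>m. (real m + (1 - q)) powr (s - 1))"
  have cp: "0 < cos (pi * s / 2)" 
    using s mult_strict_left_mono[of "- 1" s pi] mult_strict_left_mono[of s 1 pi] by (intro cos_gt_zero_pi) auto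
  let ?f = "\<lambda>y. (exp (s * y) * poisson_ker q (exp y) + exp (s * y) * poisson_ker (1 - q) (exp y)) / (2 * pi)
       - indicator {0..} y * exp (s * y) / 2"
  have 1: "has_bochner_integral lborel ?f ((pi / (2 * cos (pi * s / 2)) * (\<Sum>m. (real m + q) powr (s - 1)) +
       pi / (2 * cos (pi * s / 2)) * (\<Sum>m. (real m + (1 - q)) powr (s - 1))) / (2 * pi) - (- 1 / s) / 2)"
    using q by (intro has_bochner_integral_diff has_bochner_integral_divide_zero has_bochner_integral_add
        has_bochner_integral_poisson_ker s has_bochner_integral_exp_neg) auto
  have "(\<integral>y. exp (s * y) * reg_expcos q y \<partial>lborel) =
     (\<integral>y. ?f y \<partial>lborel)"
  proof (rule integral_cong_AE)
    \<comment> \<open>Both indicators contain 0, so the two integrands differ at y = 0, which is a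
      null set.\<close>
    show "AE y in lborel. exp (s * y) * reg_expcos q y = ?f y"
      using AE_lborel_singleton[of "0::real"]
      by eventually_elim (auto simp: reg_expcos_def expcos_def indicator_def field_simps)
  qed auto
  also have "\<dots> = Z / (4 * cos (pi * s / 2)) + 1 / (2 * s)"
    unfolding has_bochner_integral_integral_eq[OF 1] Z_def using cp s by (simp add: field_simps)
  finally have 2: "4 * cos (pi * s / 2) * ((\<integral>y. exp (s * y) * reg_expcos q y \<partial>lborel) - 1 / (2 * s)) = Z"
    using cp by simp
  have "4 * cos (of_real pi * of_real s / 2) * (reg_expcos_Mellin q (of_real s) - 1 / (2 * of_real s)) =
     complex_of_real (4 * cos (pi * s / 2) * ((\<integral>y. exp (s * y) * reg_expcos q y \<partial>lborel) - 1 / (2 * s)))"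
    by (simp add: reg_expcos_Mellin_of_real flip: cos_of_real)
  also have "\<dots> = of_real Z" unfolding 2 ..
  also have "\<dots> = hurwitz_zeta (of_real (1 - s)) q + hurwitz_zeta (of_real (1 - s)) (1 - q)"
    using q s by (subst (1 2) hurwitz_zeta_of_real) (auto simp: Z_def)
  finally show ?thesis by simp
qed

text \<open>Hurwitz's formula. The identity theorem carries the equation from the interval -1 < s <
  0 to the half-plane Re s > -1 without s = 0, where 1 / (2 s) is singular; that region is
  connected.\<close>

lemma Mellin_reg_expcos:
  assumes q: "0 < q" "q < 1" and s: "- 1 < Re s" "s \<noteq> 0"
  shows "4 * cos (of_real pi * s / 2) * (reg_expcos_Mellin q s - 1 / (2 * s)) =
     hurwitz_zeta (1 - s) q + hurwitz_zeta (1 - s) (1 - q)"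
proof -
  let ?S = "{s. - 1 < Re s} - {0}"
  let ?d = "\<lambda>s. 4 * cos (of_real pi * s / 2) * (reg_expcos_Mellin q s - 1 / (2 * s))
     - (hurwitz_zeta (1 - s) q + hurwitz_zeta (1 - s) (1 - q))"
  have hz: "(\<lambda>s. hurwitz_zeta (1 - s) a) holomorphic_on ?S" if "0 < a" for a
  proof -
    have "((\<lambda>s. hurwitz_zeta s a) \<circ> (\<lambda>s. 1 - s)) holomorphic_on ?S"
      by (rule holomorphic_on_compose_gen[OF _ hurwitz_zeta_properties(1)[OF that]]) (auto intro!: holomorphic_intros)
    then show ?thesis by (simp add: o_def)
  qed
  have "?d s = 0"
  proof (rule analytic_continuation[where f="?d" and S="?S" and U="complex_of_real ` {-1<..<0}" and \<xi>="of_real (- 1 / 2)"])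
    show "?d holomorphic_on ?S"
      using q by (intro holomorphic_intros hz holomorphic_on_subset[OF holomorphic_Mellin_reg_expcos[OF q]]) auto
    show "open ?S" by (intro open_Diff open_halfspace_Re_gt) auto
    show "connected ?S"
      by (rule connected_open_delete) (auto intro: open_halfspace_Re_gt convex_connected convex_halfspace_Re_gt)
    show "complex_of_real (- 1 / 2) islimpt complex_of_real ` {- 1<..<0}"
      by (rule of_real_islimpt_image) auto
    show "?d z = 0" if zU: "z \<in> complex_of_real ` {- 1<..<0}" for z
    proof -
      obtain t where "z = of_real t" "t \<in> {- 1<..<0}" using zU unfolding image_iff by (elim bexE) (rule that)
      then show ?thesis using Mellin_reg_expcos_strip[OF q, of t] by simp
    qed
  qed (use s in auto)
  then show ?thesis by simp
qed

text \<open>For s > 0 the term 1 / (2 s) is the integral of exp (s y) / 2 over y <= 0, so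
  subtracting it undoes the regularisation.\<close>

lemma Mellin_expcos:
  fixes s :: real
  assumes q: "0 < q" "q < 1" and s: "0 < s" "s < 1"
  shows "integrable lborel (\<lambda>y. exp (s * y) * expcos q (exp y))"
    and "complex_of_real (\<integral>y. exp (s * y) * expcos q (exp y) \<partial>lborel) =
      (hurwitz_zeta (1 - of_real s) q + hurwitz_zeta (1 - of_real s) (1 - q)) / (4 * cos (of_real pi * of_real s / 2))"
proof -
  have cp: "0 < cos (pi * s / 2)" 
    using s mult_strict_left_mono[of "- 1" s pi] mult_strict_left_mono[of s 1 pi] by (intro cos_gt_zero_pi) auto
  have "integrable lborel (\<lambda>y. complex_of_real (exp (s * y) * reg_expcos q y))"
    using integrable_reg_expcos[OF q, of "of_real s"] s by (simp add: exp_of_real[symmetric])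
  then have 1: "integrable lborel (\<lambda>y. exp (s * y) * reg_expcos q y)"
    unfolding complex_of_real_integrable_eq .
  have 2: "has_bochner_integral lborel (\<lambda>y. exp (s * y) * reg_expcos q y - indicator {..0} y * exp (s * y) / 2)
     ((\<integral>y. exp (s * y) * reg_expcos q y \<partial>lborel) - 1 / s / 2)"
    by (intro has_bochner_integral_diff has_bochner_integral_divide_zero has_bochner_integral_exp_pos s has_bochner_integral_integrable 1)
  have eq: "exp (s * y) * reg_expcos q y - indicator {..0} y * exp (s * y) / 2 = exp (s * y) * expcos q (exp y)" for y
    by (simp add: reg_expcos_def algebra_simps)
  note 3 = 2[unfolded eq]
  show "integrable lborel (\<lambda>y. exp (s * y) * expcos q (exp y))" using 3 by (simp add: has_bochner_integral_iff)
  have "complex_of_real (\<integral>y. exp (s * y) * expcos q (exp y) \<partial>lborel) =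
     reg_expcos_Mellin q (of_real s) - 1 / (2 * of_real s)"
    using has_bochner_integral_integral_eq[OF 3] by (simp add: reg_expcos_Mellin_of_real)
  moreover have "4 * cos (of_real pi * complex_of_real s / 2) \<noteq> 0"
  proof -
    have "cos (of_real pi * complex_of_real s / 2) = of_real (cos (pi * s / 2))" by (simp flip: cos_of_real)
    then show ?thesis using cp by simp
  qed
  ultimately show "complex_of_real (\<integral>y. exp (s * y) * expcos q (exp y) \<partial>lborel) =
      (hurwitz_zeta (1 - of_real s) q + hurwitz_zeta (1 - of_real s) (1 - q)) / (4 * cos (of_real pi * of_real s / 2))"
    using Mellin_reg_expcos[OF q, of "of_real s"] s by (simp add: eq_divide_eq mult.commute)
qed

text \<open>With t = E the left-hand side is x t^2 / ((t^2 + v^2) (x^2 + u^2 t^2)). The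
  decomposition rests on t^2 ((u v)^2 - x^2) = v^2 (x^2 + u^2 t^2) - x^2 (t^2 + v^2).\<close>

lemma partial_fractions_pair:
  fixes E x u v :: real
  assumes "0 < E" "0 < x" "0 < u" "0 < v" "(u * v)\<^sup>2 - x\<^sup>2 \<noteq> 0"
  shows "(E / (E\<^sup>2 + v\<^sup>2)) * ((x * (1 / E)) / ((x * (1 / E))\<^sup>2 + u\<^sup>2)) =
    x * (v\<^sup>2 / ((u * v)\<^sup>2 - x\<^sup>2) * (1 / (E\<^sup>2 + v\<^sup>2)) - (x / u)\<^sup>2 / ((u * v)\<^sup>2 - x\<^sup>2) * (1 / (E\<^sup>2 + (x / u)\<^sup>2)))"
proof -
  define D where "D = (u * v)\<^sup>2 - x\<^sup>2"
  define A where "A = E\<^sup>2 + v\<^sup>2"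
  define B where "B = x\<^sup>2 + u\<^sup>2 * E\<^sup>2"
  have pos: "0 < A" "0 < B" using assms by (auto simp: A_def B_def intro!: add_pos_pos)
  have D: "D \<noteq> 0" using assms by (simp add: D_def)
  have 1: "(x * (1 / E)) / ((x * (1 / E))\<^sup>2 + u\<^sup>2) = x * E / B"
  proof -
    have "(x * (1 / E))\<^sup>2 + u\<^sup>2 = B / E\<^sup>2" using assms by (simp add: B_def field_simps)
    then show ?thesis using assms by (simp add: power2_eq_square)
  qed
  have 2: "(x / u)\<^sup>2 * (1 / (E\<^sup>2 + (x / u)\<^sup>2)) = x\<^sup>2 / B"
  proof -
    have "E\<^sup>2 + (x / u)\<^sup>2 = B / u\<^sup>2" using assms by (simp add: B_def field_simps)
    then show ?thesis using assms by (simp add: power_divide)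
  qed
  have 3: "E\<^sup>2 * D = v\<^sup>2 * B - x\<^sup>2 * A"
    by (simp add: A_def B_def D_def power_mult_distrib algebra_simps)
  have "(E / A) * (x * E / B) = x * ((E\<^sup>2 * D) / (D * A * B))"
    using D by (simp add: power2_eq_square)
  also have "\<dots> = x * (v\<^sup>2 / D * (1 / A) - (x\<^sup>2 / B) / D)"
    unfolding 3 using D pos by (simp add: diff_divide_distrib)
  finally show ?thesis unfolding 1 2[symmetric] A_def[symmetric] D_def[symmetric] by simp
qed

text \<open>For u v different from x, partial fractions leave quadratic integrals with c = v and c =
  x/u. For u v = x the two quadratics coincide, and the squared denominator is treated by
  integration by parts. In both cases the value is x pi / (2 sin (pi \<nu> / 2)) times
  \<open>G_fun\<close> for N = 0.\<close>

lemma has_bochner_integral_pair: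
  fixes x u v \<nu> :: real
  assumes x: "0 < x" and u: "0 < u" and v: "0 < v" and \<nu>: "0 < \<nu>" "\<nu> < 1"
  shows "has_bochner_integral lborel (\<lambda>y. exp (\<nu> * y) * ((exp y / ((exp y)\<^sup>2 + v\<^sup>2)) * ((x * exp (- y)) / ((x * exp (- y))\<^sup>2 + u\<^sup>2))))
     (x * (pi / (2 * sin (pi * \<nu> / 2))) * (if u * v = x then u powr (- \<nu>) * \<nu> * x powr (\<nu> - 2) / 2
        else u powr (- \<nu>) * (((u * v) powr \<nu> - x powr \<nu>) / ((u * v)\<^sup>2 - x\<^sup>2))))"
    (is "has_bochner_integral _ ?f _")
proof -
  define P where "P = pi / (2 * sin (pi * \<nu> / 2))"
  have quad: "has_bochner_integral lborel (\<lambda>y. exp (\<nu> * y) / (exp y ^ 2 + c\<^sup>2)) (c powr (\<nu> - 2) * P)" if "0 < c" for c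
    unfolding P_def by (rule has_bochner_integral_exp_quadratic) (use \<nu> that in auto)
  have em: "exp (- y) = 1 / exp y" for y :: real by (simp add: exp_minus divide_inverse)
  show ?thesis
  proof (cases "u * v = x")
    case False
    have "u * v \<noteq> - x" using x u v by (smt (verit) mult_pos_pos)
    then have D: "(u * v)\<^sup>2 - x\<^sup>2 \<noteq> 0" using False by (simp add: power2_eq_iff)
    define D' where "D' = (u * v)\<^sup>2 - x\<^sup>2"
    let ?l = "\<lambda>y. x * (v\<^sup>2 / D' * (exp (\<nu> * y) / (exp y ^ 2 + v\<^sup>2)) - (x / u)\<^sup>2 / D' * (exp (\<nu> * y) / (exp y ^ 2 + (x / u)\<^sup>2)))"
    let ?val = "x * (v\<^sup>2 / D' * (v powr (\<nu> - 2) * P) - (x / u)\<^sup>2 / D' * ((x / u) powr (\<nu> - 2) * P))"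
    have "has_bochner_integral lborel ?l
       ?val"
      using x u v by (intro has_bochner_integral_mult_right has_bochner_integral_diff quad) auto
    also have "?val =
       x * P * (u powr (- \<nu>) * (((u * v) powr \<nu> - x powr \<nu>) / D'))"
    proof -
      have "v\<^sup>2 * v powr (\<nu> - 2) = v powr \<nu>" "(x / u)\<^sup>2 * (x / u) powr (\<nu> - 2) = (x / u) powr \<nu>"
        using x u v by (simp_all add: powr_sub_2)
      moreover have "(x / u) powr \<nu> = u powr (- \<nu>) * x powr \<nu>"
        using x u by (simp add: powr_divide powr_minus_divide)
      moreover have "v powr \<nu> = u powr (- \<nu>) * (u * v) powr \<nu>"
        using u v by (simp add: powr_mult powr_minus)
      ultimately have e: "v\<^sup>2 * v powr (\<nu> - 2) = u powr (- \<nu>) * (u * v) powr \<nu>" "(x / u)\<^sup>2 * (x / u) powr (\<nu> - 2) = u powr (- \<nu>) * x powr \<nu>"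
        by auto
      have "?val =
         x * P * ((v\<^sup>2 * v powr (\<nu> - 2)) / D' - ((x / u)\<^sup>2 * (x / u) powr (\<nu> - 2)) / D')"
        by (simp add: algebra_simps)
      also have "\<dots> = x * P * (u powr (- \<nu>) * (((u * v) powr \<nu> - x powr \<nu>) / D'))"
        unfolding e by (simp add: algebra_simps diff_divide_distrib)
      finally show ?thesis .
    qed
    also have "?l =
       ?f"
      unfolding em partial_fractions_pair[OF exp_gt_zero x u v D] D'_def[symmetric] by (simp add: algebra_simps)
    finally show ?thesis using False by (simp add: P_def D'_def)
  next
    case True
    \<comment> \<open>The derivative of \<open>F\<close> is \<open>\<nu> * F - 2 * H\<close> and
      \<open>F\<close> vanishes at both ends, so the integral of \<open>H\<close> is \<nu>/2 times
      that of \<open>F\<close>.\<close>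
    define F where "F = (\<lambda>y. exp (\<nu> * y) / (exp y ^ 2 + v\<^sup>2))"
    define H where "H = (\<lambda>y. exp (\<nu> * y) * exp y ^ 2 / (exp y ^ 2 + v\<^sup>2)\<^sup>2)"
    have pos: "0 < exp y ^ 2 + v\<^sup>2" for y :: real by (intro add_pos_nonneg) auto
    have F: "has_bochner_integral lborel F (v powr (\<nu> - 2) * P)" unfolding F_def by (rule quad[OF v])
    have H: "integrable lborel H"
    proof (rule Bochner_Integration.integrable_bound)
      show "integrable lborel F" using F by (simp add: has_bochner_integral_iff)
      have "norm (H y) \<le> norm (F y)" for y
      proof -
        have "H y = F y * (exp y ^ 2 / (exp y ^ 2 + v\<^sup>2))" by (simp add: H_def F_def power2_eq_square)
        also have "\<dots> \<le> F y * 1"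
          using pos[of y] v by (intro mult_left_mono) (auto simp: F_def divide_le_eq)
        finally show ?thesis using pos[of y] by (simp add: H_def F_def)
      qed
      then show "AE y in lborel. norm (H y) \<le> norm (F y)" by simp
    qed (simp add: H_def)
    have lim: "(F \<longlongrightarrow> 0) at_top" "(F \<longlongrightarrow> 0) at_bot"
    proof -
      have "norm (F y) \<le> exp ((\<nu> - 2) * y)" for y
      proof -
        have "F y \<le> exp (\<nu> * y) / exp y ^ 2"
          unfolding F_def using v by (intro divide_left_mono mult_pos_pos pos) auto
        then show ?thesis using pos[of y] by (simp add: F_def exp_diff left_diff_distrib exp_double[symmetric])
      qed
      moreover have "((\<lambda>y. exp ((\<nu> - 2) * y)) \<longlongrightarrow> 0) at_top" using \<nu> by real_asymp
      ultimately show "(F \<longlongrightarrow> 0) at_top" by (intro Lim_null_comparison[of F "\<lambda>y. exp ((\<nu> - 2) * y)"] always_eventually) auto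
      have "norm (F y) \<le> exp (\<nu> * y) / v\<^sup>2" for y
      proof -
        have "F y \<le> exp (\<nu> * y) / v\<^sup>2"
          unfolding F_def using v by (intro divide_left_mono mult_pos_pos pos) auto
        then show ?thesis using pos[of y] by (simp add: F_def)
      qed
      moreover have "((\<lambda>y. exp (\<nu> * y) / v\<^sup>2) \<longlongrightarrow> 0) at_bot" using \<nu> v by real_asymp
      ultimately show "(F \<longlongrightarrow> 0) at_bot" by (intro Lim_null_comparison[of F "\<lambda>y. exp (\<nu> * y) / v\<^sup>2"] always_eventually) auto
    qed
    have "(\<integral>y. \<nu> * F y - 2 * H y \<partial>lborel) = 0"
    proof (rule integral_derivative_eq_0[OF _ _ _ lim])
      fix y :: real
      have nz: "exp y ^ 2 + v\<^sup>2 \<noteq> 0" using pos[of y] by simp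
      have "(F has_field_derivative ((exp (\<nu> * y) * \<nu>) * (exp y ^ 2 + v\<^sup>2) - exp (\<nu> * y) * (2 * exp y * exp y)) / ((exp y ^ 2 + v\<^sup>2) * (exp y ^ 2 + v\<^sup>2))) (at y)"
        unfolding F_def by (rule DERIV_divide) (use nz in \<open>auto intro!: derivative_eq_intros\<close>)
      also have "((exp (\<nu> * y) * \<nu>) * (exp y ^ 2 + v\<^sup>2) - exp (\<nu> * y) * (2 * exp y * exp y)) / ((exp y ^ 2 + v\<^sup>2) * (exp y ^ 2 + v\<^sup>2)) = \<nu> * F y - 2 * H y"
        using nz unfolding F_def H_def diff_divide_distrib by (simp add: power2_eq_square mult_ac)
      finally have "(F has_field_derivative \<nu> * F y - 2 * H y) (at y)" .
      then show "(F has_vector_derivative \<nu> * F y - 2 * H y) (at y)"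
        by (simp add: has_real_derivative_iff_has_vector_derivative)
      show "continuous_on UNIV (\<lambda>y. \<nu> * F y - 2 * H y)"
        unfolding F_def H_def using pos by (auto intro!: continuous_intros simp: less_imp_neq[THEN not_sym])
      show "integrable lborel (\<lambda>y. \<nu> * F y - 2 * H y)"
        using F H by (auto simp: has_bochner_integral_iff)
    qed
    then have "(\<integral>y. H y \<partial>lborel) = \<nu> / 2 * (v powr (\<nu> - 2) * P)"
      using F H by (simp add: has_bochner_integral_iff)
    then have "has_bochner_integral lborel (\<lambda>y. x / u\<^sup>2 * H y) (x / u\<^sup>2 * (\<nu> / 2 * (v powr (\<nu> - 2) * P)))"
      using H by (intro has_bochner_integral_mult_right) (auto simp: has_bochner_integral_iff)
    also have "x / u\<^sup>2 * (\<nu> / 2 * (v powr (\<nu> - 2) * P)) = x * P * (u powr (- \<nu>) * \<nu> * x powr (\<nu> - 2) / 2)"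
    proof -
      have "u powr (- \<nu>) * x powr (\<nu> - 2) = u powr (- \<nu>) * u powr (\<nu> - 2) * v powr (\<nu> - 2)"
        using u v by (simp flip: True add: powr_mult)
      also have "u powr (- \<nu>) * u powr (\<nu> - 2) = 1 / u\<^sup>2"
        using u by (simp add: powr_sub_2 powr_minus)
      finally have e: "u powr (- \<nu>) * x powr (\<nu> - 2) = 1 / u\<^sup>2 * v powr (\<nu> - 2)" .
      have "x * P * (u powr (- \<nu>) * \<nu> * x powr (\<nu> - 2) / 2) = x * P * \<nu> / 2 * (u powr (- \<nu>) * x powr (\<nu> - 2))"
        by simp
      then show ?thesis unfolding e by simp
    qed
    \<comment> \<open>For x = u v one has (x/t)^2 + u^2 = u^2 (t^2 + v^2) / t^2, which accounts for
      the factor x / u^2.\<close>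
    also have "(\<lambda>y. x / u\<^sup>2 * H y) = ?f"
    proof
      fix y :: real
      define E where "E = exp y"
      have E: "0 < E" by (simp add: E_def)
      have "(x * (1 / E))\<^sup>2 + u\<^sup>2 = u\<^sup>2 * (E\<^sup>2 + v\<^sup>2) / E\<^sup>2"
        using E True by (simp add: field_simps) (simp add: power_mult_distrib algebra_simps flip: True)
      then have e: "(x * (1 / E)) / ((x * (1 / E))\<^sup>2 + u\<^sup>2) = x * E / (u\<^sup>2 * (E\<^sup>2 + v\<^sup>2))"
        using E by (simp add: power2_eq_square)
      show "x / u\<^sup>2 * H y = ?f y"
        unfolding H_def em E_def[symmetric] e by (simp add: power2_eq_square mult_ac)
    qed
    finally show ?thesis using True by (simp add: P_def)
  qed
qed

lemma G_fun_of_real: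
  assumes "0 < x" "0 < u" "0 < v"
  shows "G_fun x (of_real \<nu>) 0 u v = of_real (if u * v = x then u powr (- \<nu>) * \<nu> * x powr (\<nu> - 2) / 2
        else u powr (- \<nu>) * (((u * v) powr \<nu> - x powr \<nu>) / ((u * v)\<^sup>2 - x\<^sup>2)))"
proof -
  have p: "complex_of_real w powr (of_real t) = of_real (w powr t)" if "0 < w" for w t
    using that by (simp add: powr_of_real)
  have "0 < u * v" using assms by simp
  then have p': "complex_of_real u powr (- of_real \<nu>) = of_real (u powr (- \<nu>))" "complex_of_real x powr (of_real \<nu> - 2) = of_real (x powr (\<nu> - 2))"
    "complex_of_real x powr of_real \<nu> = of_real (x powr \<nu>)" "complex_of_real (u * v) powr of_real \<nu> = of_real ((u * v) powr \<nu>)"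
    using p[of u "- \<nu>"] p[of x "\<nu> - 2"] p[of x \<nu>] p[of "u * v" \<nu>] assms by simp_all
  show ?thesis
  proof (cases "u * v = x")
    case True
    then show ?thesis by (simp add: G_fun_def p')
  next
    case False
    then have "G_fun x (of_real \<nu>) 0 u v = of_real (u powr (- \<nu>)) * ((of_real ((u * v) powr \<nu>) - of_real (x powr \<nu>)) / of_real ((u * v)\<^sup>2 - x\<^sup>2))"
      by (simp add: G_fun_def p' del: of_real_mult of_real_diff of_real_power)
    then show ?thesis using False by simp
  qed
qed

text \<open>All terms are nonnegative, so the integral of each norm is the norm of its value, a
  multiple of \<open>G_fun\<close>. Absolute summability of the double sum therefore licenses
  termwise integration.\<close>

lemma poisson_pair_integral:
  fixes x p q \<nu> :: real
  assumes x: "0 < x" and p: "0 < p" and q: "0 < q" and \<nu>: "0 < \<nu>" "\<nu> < 1"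
  defines "f \<equiv> \<lambda>y. exp (\<nu> * y) * (poisson_ker q (exp y) * poisson_ker p (x * exp (- y)))"
  shows "integrable lborel f"
    and "complex_of_real (\<integral>y. f y \<partial>lborel) = of_real (x * (pi / (2 * sin (pi * \<nu> / 2)))) * G_sum x p q 0 (of_real \<nu>)"
proof -
  define F where "F = (\<lambda>i y. exp (\<nu> * y) * ((exp y / ((exp y)\<^sup>2 + (real (fst i) + q)\<^sup>2)) * ((x * exp (- y)) / ((x * exp (- y))\<^sup>2 + (real (snd i) + p)\<^sup>2))))"
  define c where "c = x * (pi / (2 * sin (pi * \<nu> / 2)))"
  have hb: "integrable lborel (F i)" and I: "complex_of_real (\<integral>y. F i y \<partial>lborel) = of_real c * G_fun x (of_real \<nu>) 0 (real (snd i) + p) (real (fst i) + q)" for i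
    using has_bochner_integral_pair[OF x _ _ \<nu>, of "real (snd i) + p" "real (fst i) + q"] p q
    by (auto simp: has_bochner_integral_iff F_def c_def G_fun_of_real[OF x] add_nonneg_pos)
  have F0: "0 \<le> F i y" for i y using x by (auto simp: F_def intro!: mult_nonneg_nonneg divide_nonneg_nonneg)
  have term0: "0 \<le> t / (t\<^sup>2 + (real m + a)\<^sup>2)" if "0 \<le> t" for t a m using that by auto
  have pt: "((\<lambda>i. F i y) has_sum f y) UNIV" for y
  proof -
    have "((\<lambda>(m, n). (exp y / ((exp y)\<^sup>2 + (real m + q)\<^sup>2)) * ((x * exp (- y)) / ((x * exp (- y))\<^sup>2 + (real n + p)\<^sup>2))) has_sum
       (poisson_ker q (exp y) * poisson_ker p (x * exp (- y)))) UNIV"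
    proof (rule has_sum_product_pairs(2))
      show 1: "(\<lambda>m. exp y / ((exp y)\<^sup>2 + (real m + q)\<^sup>2)) sums poisson_ker q (exp y)"
        by (rule poisson_ker_sums) (use q in auto)
      show 2: "(\<lambda>m. (x * exp (- y)) / ((x * exp (- y))\<^sup>2 + (real m + p)\<^sup>2)) sums poisson_ker p (x * exp (- y))"
        by (rule poisson_ker_sums) (use p x in auto)
      show "summable (\<lambda>m. norm (exp y / ((exp y)\<^sup>2 + (real m + q)\<^sup>2)))"
        using sums_summable[OF 1] by (simp only: real_norm_def abs_of_nonneg[OF term0[OF exp_ge_zero]])
      have "0 \<le> x * exp (- y)" using x by simp
      then show "summable (\<lambda>m. norm ((x * exp (- y)) / ((x * exp (- y))\<^sup>2 + (real m + p)\<^sup>2)))"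
        using sums_summable[OF 2] by (simp only: real_norm_def abs_of_nonneg[OF term0])
    qed
    from has_sum_cmult_right[OF this, of "exp (\<nu> * y)"] show ?thesis
      by (simp add: F_def f_def case_prod_unfold)
  qed
  have nm: "(\<lambda>i. norm (F i y)) summable_on UNIV" for y
    using pt[of y] F0 by (auto intro: has_sum_imp_summable)
  have "norm (complex_of_real (\<integral>y. F i y \<partial>lborel)) = (\<integral>y. norm (F i y) \<partial>lborel)" for i
    using F0 by (simp add: integral_nonneg_AE)
  then have nI: "(\<integral>y. norm (F i y) \<partial>lborel) = norm (complex_of_real c) * norm (G_fun x (of_real \<nu>) 0 (real (snd i) + p) (real (fst i) + q))" for i
    unfolding I by (simp only: norm_mult)
  have "(\<lambda>i. norm (G_fun x (of_real \<nu>) 0 (real (snd i) + p) (real (fst i) + q))) summable_on UNIV"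
    using G_fun_abs_summable[OF x p q, of "of_real \<nu>" 0] \<nu> by (simp add: case_prod_unfold)
  then have sI: "(\<lambda>i. \<integral>y. norm (F i y) \<partial>lborel) summable_on UNIV"
    unfolding nI by (rule summable_on_cmult_right)
  show "integrable lborel f"
    by (rule integral_has_sum_pairs(1)[OF hb nm pt sI])
  have "((\<lambda>i. \<integral>y. F i y \<partial>lborel) has_sum (\<integral>y. f y \<partial>lborel)) UNIV"
    by (rule integral_has_sum_pairs(2)[OF hb nm pt sI])
  then have "((\<lambda>i. complex_of_real (\<integral>y. F i y \<partial>lborel)) has_sum complex_of_real (\<integral>y. f y \<partial>lborel)) UNIV"
    by (rule has_sum_bounded_linear[OF bounded_linear_of_real])
  then have 1: "((\<lambda>i. of_real c * G_fun x (of_real \<nu>) 0 (real (snd i) + p) (real (fst i) + q)) has_sum complex_of_real (\<integral>y. f y \<partial>lborel)) UNIV"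
    unfolding I .
  have "((\<lambda>(m, n). G_fun x (of_real \<nu>) 0 (real n + p) (real m + q)) has_sum G_sum x p q 0 (of_real \<nu>)) UNIV"
    unfolding G_sum_def by (rule has_sum_infsum[OF G_fun_summable[OF x p q]]) (use \<nu> in auto)
  from has_sum_cmult_right[OF this, of "of_real c"]
  have "((\<lambda>i. of_real c * G_fun x (of_real \<nu>) 0 (real (snd i) + p) (real (fst i) + q)) has_sum of_real c * G_sum x p q 0 (of_real \<nu>)) UNIV"
    by (simp add: case_prod_unfold)
  with 1 show "complex_of_real (\<integral>y. f y \<partial>lborel) = of_real (x * (pi / (2 * sin (pi * \<nu> / 2)))) * G_sum x p q 0 (of_real \<nu>)"
    unfolding c_def[symmetric] by (rule has_sum_unique)
qed

text \<open>The substitution y -> ln x - y, that is t -> x/t, replaces \<nu> by - \<nu>, which lies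
  in the strip -1 < s < 0 of the Poisson transform.\<close>

lemma poisson_ker_reflect_integral:
  fixes x p \<nu> :: real
  assumes x: "0 < x" and p: "0 < p" and \<nu>: "0 < \<nu>" "\<nu> < 1"
  defines "f \<equiv> \<lambda>y. exp (\<nu> * y) * poisson_ker p (x * exp (- y))"
  shows "integrable lborel f"
    and "complex_of_real (\<integral>y. f y \<partial>lborel) = of_real (x powr \<nu>) * (of_real (pi / (2 * cos (pi * \<nu> / 2))) * hurwitz_zeta (1 + of_real \<nu>) p)"
proof -
  let ?g = "\<lambda>y. x powr \<nu> * (exp (- \<nu> * (ln x + (- 1) * y)) * poisson_ker p (exp (ln x + (- 1) * y)))"
  have "has_bochner_integral lborel (\<lambda>y. exp (- \<nu> * y) * poisson_ker p (exp y))
     (pi / (2 * cos (pi * - \<nu> / 2)) * (\<Sum>m. (real m + p) powr (- \<nu> - 1)))"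
    by (rule has_bochner_integral_poisson_ker) (use \<nu> p in auto)
  then have "has_bochner_integral lborel (\<lambda>y. exp (- \<nu> * (ln x + (- 1) * y)) * poisson_ker p (exp (ln x + (- 1) * y)))
     (pi / (2 * cos (pi * - \<nu> / 2)) * (\<Sum>m. (real m + p) powr (- \<nu> - 1)) /\<^sub>R \<bar>- 1\<bar>)"
    by (subst (asm) lborel_has_bochner_integral_real_affine_iff[of "- 1" _ _ "ln x"]) auto
  then have "has_bochner_integral lborel ?g
     (x powr \<nu> * (pi / (2 * cos (pi * - \<nu> / 2)) * (\<Sum>m. (real m + p) powr (- \<nu> - 1)) /\<^sub>R \<bar>- 1\<bar>))"
    by (intro has_bochner_integral_mult_right) auto
  also have "?g = f"
  proof
    fix y
    have "exp (ln x + (- 1) * y) = x * exp (- y)" using x by (simp add: exp_diff exp_minus divide_inverse)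
    moreover have "x powr \<nu> * exp (- \<nu> * (ln x + (- 1) * y)) = exp (\<nu> * y)"
      using x by (simp add: powr_def algebra_simps flip: exp_add)
    ultimately show "?g y = f y"
      by (simp only: f_def mult.assoc[symmetric])
  qed
  finally have 1: "has_bochner_integral lborel f (x powr \<nu> * (pi / (2 * cos (pi * \<nu> / 2)) * (\<Sum>m. (real m + p) powr (- (1 + \<nu>)))))"
  proof -
    have e: "- \<nu> - 1 = - (1 + \<nu>)" by simp
    show ?thesis if "has_bochner_integral lborel f (x powr \<nu> * (pi / (2 * cos (pi * - \<nu> / 2)) * (\<Sum>m. (real m + p) powr (- \<nu> - 1)) /\<^sub>R \<bar>- 1\<bar>))"
      using that unfolding e by simp
  qed
  show "integrable lborel f" using 1 by (simp add: has_bochner_integral_iff)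
  show "complex_of_real (\<integral>y. f y \<partial>lborel) = of_real (x powr \<nu>) * (of_real (pi / (2 * cos (pi * \<nu> / 2))) * hurwitz_zeta (1 + of_real \<nu>) p)"
    using has_bochner_integral_integral_eq[OF 1] hurwitz_zeta_of_real[of "1 + \<nu>" p] \<nu> p by simp
qed

section \<open>The identity by analytic continuation\<close>

definition zeta_sym :: "complex \<Rightarrow> real \<Rightarrow> complex" where
  "zeta_sym s q = hurwitz_zeta s q + hurwitz_zeta s (1 - q)"

definition G_sym :: "real \<Rightarrow> real \<Rightarrow> real \<Rightarrow> nat \<Rightarrow> complex \<Rightarrow> complex" where
  "G_sym x \<theta> \<psi> N \<nu> = G_sum x \<psi> \<theta> N \<nu> + G_sum x (1 - \<psi>) \<theta> N \<nu> + G_sum x \<psi> (1 - \<theta>) N \<nu> + G_sum x (1 - \<psi>) (1 - \<theta>) N \<nu>"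

definition bessel_series_value :: "real \<Rightarrow> real \<Rightarrow> real \<Rightarrow> nat \<Rightarrow> complex \<Rightarrow> complex" where
  "bessel_series_value x \<theta> \<psi> N \<nu> =
     - (of_real pi * of_real x powr \<nu> / (2 * cos (of_real pi * \<nu> / 2))) * zeta_sym (1 + \<nu>) \<psi>
     - of_real pi / (2 * cos (of_real pi * \<nu> / 2)) * zeta_sym (1 - \<nu>) \<theta>
     + 1 / (2 * sin (of_real pi * \<nu> / 2)) * (\<Sum>j = 1..N. of_real (x ^ (2 * j - 1)) * zeta_sym (of_nat (2 * j)) \<psi> * zeta_sym (of_nat (2 * j) - \<nu>) \<theta>)
     + 1 / (2 * sin (of_real pi * \<nu> / 2)) * of_real (x ^ (2 * N + 1)) * G_sym x \<theta> \<psi> N \<nu>"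

text \<open>The function L(\<nu>) without its factor 4 pi.\<close>

definition expcos_Mellin :: "real \<Rightarrow> real \<Rightarrow> real \<Rightarrow> complex \<Rightarrow> complex" where
  "expcos_Mellin x \<theta> \<psi> \<nu> = (\<integral>y. exp (\<nu> * of_real y) * of_real (expcos \<theta> (exp y) * expcos \<psi> (x * exp (- y))) \<partial>lborel)"

lemma expcos_Mellin_base:
  fixes \<nu> :: real
  assumes x: "0 < x" and \<theta>: "0 < \<theta>" "\<theta> < 1" and \<psi>: "0 < \<psi>" "\<psi> < 1" and \<nu>: "0 < \<nu>" "\<nu> < 1"
  shows "4 * of_real pi * expcos_Mellin x \<theta> \<psi> (of_real \<nu>) = bessel_series_value x \<theta> \<psi> 0 (of_real \<nu>)"
proof -
  define S where "S = sin (pi * \<nu> / 2)"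
  define C where "C = cos (pi * \<nu> / 2)"
  define I where "I = (\<lambda>q p y. exp (\<nu> * y) * (poisson_ker q (exp y) * poisson_ker p (x * exp (- y))))"
  define J where "J = (\<lambda>p y. exp (\<nu> * y) * poisson_ker p (x * exp (- y)))"
  define M where "M = (\<lambda>y. exp (\<nu> * y) * expcos \<theta> (exp y))"
  have I: "integrable lborel (I q p)" "complex_of_real (\<integral>y. I q p y \<partial>lborel) = of_real (x * (pi / (2 * S))) * G_sum x p q 0 (of_real \<nu>)"
    if "0 < q" "0 < p" for q p
    unfolding I_def S_def using poisson_pair_integral[OF x that(2,1) \<nu>] by auto
  have J: "integrable lborel (J p)" "complex_of_real (\<integral>y. J p y \<partial>lborel) = of_real (x powr \<nu>) * (of_real (pi / (2 * C)) * hurwitz_zeta (1 + of_real \<nu>) p)"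
    if "0 < p" for p
    unfolding J_def C_def using poisson_ker_reflect_integral[OF x that \<nu>] by auto
  have cC: "cos (of_real pi * complex_of_real \<nu> / 2) = of_real C" and sS: "sin (of_real pi * complex_of_real \<nu> / 2) = of_real S"
    by (simp_all add: C_def S_def flip: cos_of_real sin_of_real)
  have M: "integrable lborel M" "complex_of_real (\<integral>y. M y \<partial>lborel) = zeta_sym (1 - of_real \<nu>) \<theta> / (4 * of_real C)"
    unfolding M_def using Mellin_expcos[OF \<theta> \<nu>] by (auto simp: cC zeta_sym_def)
  have C: "0 < C" unfolding C_def
    using \<nu> mult_strict_left_mono[of "- 1" \<nu> pi] mult_strict_left_mono[of \<nu> 1 pi] by (intro cos_gt_zero_pi) auto
  have S: "0 < S" unfolding S_def
    using \<nu> mult_strict_left_mono[of \<nu> 1 pi] by (intro sin_gt_zero) auto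
  have pos: "0 < 1 - \<theta>" "0 < 1 - \<psi>" using \<theta> \<psi> by auto
  \<comment> \<open>The constant -1/2 of the \<psi>-factor multiplies the unexpanded
    \<theta>-factor. Expanding both would leave exp (\<nu> y) / 4 by itself, which is not
    integrable.\<close>
  have pt: "exp (\<nu> * y) * (expcos \<theta> (exp y) * expcos \<psi> (x * exp (- y))) =
     (- (1 / 2)) * M y + 1 / (4 * pi\<^sup>2) * (I \<theta> \<psi> y + I \<theta> (1 - \<psi>) y + I (1 - \<theta>) \<psi> y + I (1 - \<theta>) (1 - \<psi>) y)
      - 1 / (4 * pi) * (J \<psi> y + J (1 - \<psi>) y)" for y
    unfolding M_def I_def J_def expcos_def by (simp add: field_simps power2_eq_square)
  let ?lin = "(- (1 / 2)) * (\<integral>y. M y \<partial>lborel) + 1 / (4 * pi\<^sup>2) * ((\<integral>y. I \<theta> \<psi> y \<partial>lborel) + (\<integral>y. I \<theta> (1 - \<psi>) y \<partial>lborel) + (\<integral>y. I (1 - \<theta>) \<psi> y \<partial>lborel) + (\<integral>y. I (1 - \<theta>) (1 - \<psi>) y \<partial>lborel))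
      - 1 / (4 * pi) * ((\<integral>y. J \<psi> y \<partial>lborel) + (\<integral>y. J (1 - \<psi>) y \<partial>lborel))"
  have "expcos_Mellin x \<theta> \<psi> (of_real \<nu>) = complex_of_real (\<integral>y. exp (\<nu> * y) * (expcos \<theta> (exp y) * expcos \<psi> (x * exp (- y))) \<partial>lborel)"
    unfolding expcos_Mellin_def by (subst integral_complex_of_real[symmetric]) (simp add: exp_of_real[symmetric])
  also have "(\<integral>y. exp (\<nu> * y) * (expcos \<theta> (exp y) * expcos \<psi> (x * exp (- y))) \<partial>lborel) =
     ?lin"
    unfolding pt using M(1) I(1) J(1) \<theta> \<psi> pos by simp
  finally have eqE: "expcos_Mellin x \<theta> \<psi> (of_real \<nu>) = complex_of_real ?lin" .
  have "4 * of_real pi * expcos_Mellin x \<theta> \<psi> (of_real \<nu>) =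
     - 2 * of_real pi * complex_of_real (\<integral>y. M y \<partial>lborel)
     + 1 / of_real pi * (complex_of_real (\<integral>y. I \<theta> \<psi> y \<partial>lborel) + complex_of_real (\<integral>y. I \<theta> (1 - \<psi>) y \<partial>lborel) + complex_of_real (\<integral>y. I (1 - \<theta>) \<psi> y \<partial>lborel) + complex_of_real (\<integral>y. I (1 - \<theta>) (1 - \<psi>) y \<partial>lborel))
     - (complex_of_real (\<integral>y. J \<psi> y \<partial>lborel) + complex_of_real (\<integral>y. J (1 - \<psi>) y \<partial>lborel))"
    unfolding eqE by (simp add: field_simps power2_eq_square)
  also have "\<dots> = - 2 * of_real pi * (zeta_sym (1 - of_real \<nu>) \<theta> / (4 * of_real C))
     + of_real (x / (2 * S)) * G_sym x \<theta> \<psi> 0 (of_real \<nu>) - of_real (x powr \<nu>) * of_real (pi / (2 * C)) * zeta_sym (1 + of_real \<nu>) \<psi>"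
    unfolding M(2) I(2)[OF \<theta>(1) \<psi>(1)] I(2)[OF \<theta>(1) pos(2)] I(2)[OF pos(1) \<psi>(1)] I(2)[OF pos] J(2)[OF \<psi>(1)] J(2)[OF pos(2)]
    by (simp add: G_sym_def zeta_sym_def algebra_simps)
  also have "of_real (x powr \<nu>) = complex_of_real x powr of_real \<nu>"
    using x by (simp add: powr_of_real)
  finally have eqL: "4 * of_real pi * expcos_Mellin x \<theta> \<psi> (of_real \<nu>) =
      - 2 * of_real pi * (zeta_sym (1 - of_real \<nu>) \<theta> / (4 * of_real C))
     + of_real (x / (2 * S)) * G_sym x \<theta> \<psi> 0 (of_real \<nu>) - complex_of_real x powr of_real \<nu> * of_real (pi / (2 * C)) * zeta_sym (1 + of_real \<nu>) \<psi>" .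
  show ?thesis
    unfolding eqL bessel_series_value_def cC sS using C S by (simp add: field_simps)
qed

text \<open>The remainders of the four telescoped sums combine into one product of symmetrised zeta
  values, which is the summand j = N + 1 of the finite sum.\<close>

lemma bessel_series_value_Suc:
  assumes x: "0 < x" and \<theta>: "0 < \<theta>" "\<theta> < 1" and \<psi>: "0 < \<psi>" "\<psi> < 1" and \<nu>: "- 1 < Re \<nu>" "Re \<nu> < 2 * real N + 1"
  shows "bessel_series_value x \<theta> \<psi> (Suc N) \<nu> = bessel_series_value x \<theta> \<psi> N \<nu>"
proof -
  define X1 where "X1 = complex_of_real (x ^ (2 * N + 1))"
  define X3 where "X3 = complex_of_real (x ^ (2 * N + 3))"
  have t: "X1 * G_sum x p q N \<nu> - X3 * G_sum x p q (Suc N) \<nu> =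
     X1 * (hurwitz_zeta (of_nat (2 * N + 2) - \<nu>) q * hurwitz_zeta (of_nat (2 * N + 2)) p)" if "0 < p" "0 < q" for p q
    unfolding X1_def X3_def by (rule G_sum_telescope[OF x that \<nu>])
  have pos: "0 < 1 - \<theta>" "0 < 1 - \<psi>" using \<theta> \<psi> by auto
  have "X1 * G_sym x \<theta> \<psi> N \<nu> - X3 * G_sym x \<theta> \<psi> (Suc N) \<nu> =
      (X1 * G_sum x \<psi> \<theta> N \<nu> - X3 * G_sum x \<psi> \<theta> (Suc N) \<nu>) + (X1 * G_sum x (1 - \<psi>) \<theta> N \<nu> - X3 * G_sum x (1 - \<psi>) \<theta> (Suc N) \<nu>)
    + (X1 * G_sum x \<psi> (1 - \<theta>) N \<nu> - X3 * G_sum x \<psi> (1 - \<theta>) (Suc N) \<nu>) + (X1 * G_sum x (1 - \<psi>) (1 - \<theta>) N \<nu> - X3 * G_sum x (1 - \<psi>) (1 - \<theta>) (Suc N) \<nu>)"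
    unfolding G_sym_def by (simp add: algebra_simps)
  also have "\<dots> = X1 * zeta_sym (of_nat (2 * N + 2)) \<psi> * zeta_sym (of_nat (2 * N + 2) - \<nu>) \<theta>"
    unfolding t[OF \<psi>(1) \<theta>(1)] t[OF pos(2) \<theta>(1)] t[OF \<psi>(1) pos(1)] t[OF pos(2,1)] zeta_sym_def
    by (simp add: algebra_simps del: of_nat_add of_nat_mult)
  finally have key: "X1 * G_sym x \<theta> \<psi> N \<nu> = X1 * zeta_sym (of_nat (2 * N + 2)) \<psi> * zeta_sym (of_nat (2 * N + 2) - \<nu>) \<theta> + X3 * G_sym x \<theta> \<psi> (Suc N) \<nu>"
    by (simp add: algebra_simps)
  have idx: "2 * Suc N - 1 = 2 * N + 1" "2 * Suc N + 1 = 2 * N + 3" "2 * Suc N = 2 * N + 2" by auto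
  have sum: "(\<Sum>j = 1..Suc N. complex_of_real (x ^ (2 * j - 1)) * zeta_sym (of_nat (2 * j)) \<psi> * zeta_sym (of_nat (2 * j) - \<nu>) \<theta>) =
    (\<Sum>j = 1..N. complex_of_real (x ^ (2 * j - 1)) * zeta_sym (of_nat (2 * j)) \<psi> * zeta_sym (of_nat (2 * j) - \<nu>) \<theta>)
     + X1 * zeta_sym (of_nat (2 * N + 2)) \<psi> * zeta_sym (of_nat (2 * N + 2) - \<nu>) \<theta>"
    unfolding X1_def by (subst sum.atLeast_Suc_atMost_Suc_shift[symmetric] sum.nat_ivl_Suc') (simp_all only: idx, simp_all add: add.commute)
  show ?thesis
    unfolding bessel_series_value_def sum idx(2) X1_def[symmetric] X3_def[symmetric] mult.assoc[of _ X1] mult.assoc[of _ X3] key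
    by (simp only: distrib_left add.assoc)
qed

text \<open>The strip |Re \<nu>| < 1 belongs to N = 0 and lies in the strip of every other N, so the
  single steps can be chained.\<close>

lemma bessel_series_value_0:
  assumes "0 < x" "0 < \<theta>" "\<theta> < 1" "0 < \<psi>" "\<psi> < 1" "- 1 < Re \<nu>" "Re \<nu> < 1"
  shows "bessel_series_value x \<theta> \<psi> N \<nu> = bessel_series_value x \<theta> \<psi> 0 \<nu>"
proof (induction N)
  case (Suc N)
  then show ?case using bessel_series_value_Suc[of x \<theta> \<psi> \<nu> N] assms by simp
qed simp

text \<open>The decay exp (- t) and exp (- x/t) of the two cosine factors reproduces the Bessel
  kernel, which makes the transform entire.\<close>

lemma norm_expcos_Mellin_integrand:
  assumes "0 < x" "0 < \<theta>" "\<theta> < 1" "0 < \<psi>" "\<psi> < 1"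
  shows "\<exists>K>0. \<forall>\<nu> y. norm (exp (\<nu> * of_real y) * of_real (expcos \<theta> (exp y) * expcos \<psi> (x * exp (- y)))) \<le> K * norm (kern \<nu> (of_real x) y)"
proof -
  obtain K1 where K1: "K1 > 0" "\<And>t. 0 < t \<Longrightarrow> \<bar>expcos \<theta> t\<bar> \<le> K1 * exp (- t)" using expcos_bound assms by blast
  obtain K2 where K2: "K2 > 0" "\<And>t. 0 < t \<Longrightarrow> \<bar>expcos \<psi> t\<bar> \<le> K2 * exp (- t)" using expcos_bound assms by blast
  show ?thesis
  proof (intro exI[of _ "K1 * K2"] conjI allI)
    show "0 < K1 * K2" using K1 K2 by simp
    fix \<nu> :: complex and y :: real
    let ?F = "exp (\<nu> * of_real y) * of_real (expcos \<theta> (exp y) * expcos \<psi> (x * exp (- y)))"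
    have "norm (?F) = exp (Re \<nu> * y) * (\<bar>expcos \<theta> (exp y)\<bar> * \<bar>expcos \<psi> (x * exp (- y))\<bar>)"
      by (simp add: norm_mult abs_mult)
    also have "\<dots> \<le> exp (Re \<nu> * y) * ((K1 * exp (- exp y)) * (K2 * exp (- (x * exp (- y)))))"
      using K1 K2 assms by (intro mult_left_mono mult_mono) auto
    also have "\<dots> = K1 * K2 * norm (kern \<nu> (of_real x) y)"
    proof -
      have "norm (kern \<nu> (of_real x) y) = exp (Re \<nu> * y) * exp (- exp y) * exp (- (x * exp (- y)))"
        unfolding norm_kern by (simp flip: exp_add)
      then show ?thesis by simp
    qed
    finally show "norm (?F) \<le> K1 * K2 * norm (kern \<nu> (of_real x) y)" .
  qed
qed

lemma expcos_Mellin_holomorphic: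
  assumes "0 < x" "0 < \<theta>" "\<theta> < 1" "0 < \<psi>" "\<psi> < 1"
  shows "expcos_Mellin x \<theta> \<psi> holomorphic_on A"
proof -
  let ?F = "\<lambda>\<nu> y. exp (\<nu> * of_real y) * of_real (expcos \<theta> (exp y) * expcos \<psi> (x * exp (- y)))"
  obtain K where K: "K > 0" "\<And>\<nu> y. norm (?F \<nu> y) \<le> K * norm (kern \<nu> (of_real x) y)"
    using norm_expcos_Mellin_integrand[OF assms] by blast
  have "expcos_Mellin x \<theta> \<psi> holomorphic_on UNIV"
    unfolding expcos_Mellin_def
  proof (rule holomorphic_integral_dominated)
    show "?F \<nu> \<in> borel_measurable lborel" for \<nu> :: complex
    proof -
      have "(\<lambda>y::real. exp (\<nu> * of_real y)) \<in> borel_measurable lborel"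
        by (auto intro!: borel_measurable_continuous_onI continuous_intros)
      then show ?thesis by measurable
    qed
    show "(\<lambda>\<nu>. ?F \<nu> y) holomorphic_on UNIV" for y
      by (intro holomorphic_intros)
    fix \<nu> :: complex
    \<comment> \<open>One unit more than at \<nu> alone: on the disc of radius 1 around \<nu>, |Re
      z| grows by at most 1.\<close>
    obtain n where n: "\<bar>Re \<nu>\<bar> + 2 \<le> real n" using real_arch_simple by blast
    define C where "C = K * (fact n + fact n / x ^ n)"
    show "\<exists>r>0. \<exists>g. integrable lborel g \<and> (\<forall>z\<in>ball \<nu> r \<inter> UNIV. \<forall>y\<in>space lborel. norm (?F z y) \<le> g y)"
    proof (intro exI[of _ 1] conjI exI[of _ "\<lambda>y. C * exp (- \<bar>y\<bar>)"] ballI)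
      show "integrable lborel (\<lambda>y. C * exp (- \<bar>y\<bar>))" using integrable_exp_minus_abs by auto
      fix z and y :: real assume "z \<in> ball \<nu> 1 \<inter> UNIV"
      then have "\<bar>Re z\<bar> + 1 \<le> real n"
        using abs_Re_le_cmod[of "\<nu> - z"] n by (auto simp: dist_norm)
      then have "norm (kern z (of_real x) y) \<le> (fact n + fact n / x ^ n) * exp (- \<bar>y\<bar>)"
        by (rule norm_kern_le) (use assms in auto)
      then have "K * norm (kern z (of_real x) y) \<le> C * exp (- \<bar>y\<bar>)"
        using K(1) by (simp add: C_def mult.assoc)
      then show "norm (?F z y) \<le> C * exp (- \<bar>y\<bar>)"
        using K(2)[of z y] by linarith
    qed simp
  qed simp
  then show ?thesis by (rule holomorphic_on_subset) simp
qed

lemma holomorphic_zeta_sym [holomorphic_intros]: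
  assumes "0 < q" "q < 1" "f holomorphic_on A" "\<And>s. s \<in> A \<Longrightarrow> f s \<noteq> 1"
  shows "(\<lambda>s. zeta_sym (f s) q) holomorphic_on A"
proof -
  have "(\<lambda>s. zeta_sym s q) holomorphic_on - {1}"
    unfolding zeta_sym_def by (intro holomorphic_intros hurwitz_zeta_properties(1)) (use assms in auto)
  then have "(\<lambda>s. zeta_sym s q) \<circ> f holomorphic_on A"
    by (rule holomorphic_on_compose_gen[OF assms(3)]) (use assms(4) in auto)
  then show ?thesis by (simp add: o_def)
qed

lemma cos_sin_half_nonzero:
  assumes "\<nu> \<notin> \<int>"
  shows "cos (of_real pi * \<nu> / 2) \<noteq> 0" "sin (of_real pi * \<nu> / 2) \<noteq> (0::complex)"
proof -
  have "sin (of_real pi * \<nu>) \<noteq> 0"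
    using assms by (auto simp: sin_eq_0 mult.commute)
  moreover have "sin (of_real pi * \<nu>) = 2 * sin (of_real pi * \<nu> / 2) * cos (of_real pi * \<nu> / 2)"
    using sin_double[of "of_real pi * \<nu> / 2"] by simp
  ultimately show "cos (of_real pi * \<nu> / 2) \<noteq> 0" "sin (of_real pi * \<nu> / 2) \<noteq> 0" by auto
qed

text \<open>Inside the strip all possible singularities are integers: zeros of the cosine and sine
  of pi \<nu> / 2, and points where 1 + \<nu>, 1 - \<nu> or 2 j - \<nu> equals 1.\<close>

lemma bessel_series_value_holomorphic:
  assumes "0 < x" "0 < \<theta>" "\<theta> < 1" "0 < \<psi>" "\<psi> < 1"
    and A: "A \<subseteq> {\<nu>. - 1 < Re \<nu> \<and> Re \<nu> < 2 * real N + 1} - \<int>"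
  shows "bessel_series_value x \<theta> \<psi> N holomorphic_on A"
proof -
  have ni: "\<nu> \<notin> \<int>" if "\<nu> \<in> A" for \<nu> using that A by auto
  have nz: "cos (of_real pi * \<nu> / 2) \<noteq> 0" "sin (of_real pi * \<nu> / 2) \<noteq> 0" if "\<nu> \<in> A" for \<nu>
    using cos_sin_half_nonzero[OF ni[OF that]] by auto
  have n1: "1 + \<nu> \<noteq> 1" "1 - \<nu> \<noteq> 1" if "\<nu> \<in> A" for \<nu> using ni[OF that] by auto
  have n2: "of_nat (2 * j) - \<nu> \<noteq> 1" if "\<nu> \<in> A" for \<nu> and j :: nat
  proof
    assume "of_nat (2 * j) - \<nu> = 1"
    then have "\<nu> = of_nat (2 * j) - 1" by (simp add: algebra_simps)
    also have "\<dots> \<in> \<int>" by simp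
    finally show False using ni[OF that] by simp
  qed
  have G: "G_sym x \<theta> \<psi> N holomorphic_on A"
    unfolding G_sym_def[abs_def] using assms
    by (intro holomorphic_intros holomorphic_on_subset[OF G_sum_holomorphic]) auto
  show ?thesis
    unfolding bessel_series_value_def[abs_def] using assms nz n1 n2 G
    by (intro holomorphic_intros) auto
qed

lemma expcos_Mellin_eq:
  assumes x: "0 < x" and \<theta>: "0 < \<theta>" "\<theta> < 1" and \<psi>: "0 < \<psi>" "\<psi> < 1"
    and \<nu>: "- 1 < Re \<nu>" "Re \<nu> < 2 * real N + 1" "\<nu> \<notin> \<int>"
  shows "4 * of_real pi * expcos_Mellin x \<theta> \<psi> \<nu> = bessel_series_value x \<theta> \<psi> N \<nu>"
proof -
  let ?H = "{\<nu>. - 1 < Re \<nu> \<and> Re \<nu> < 2 * real N + 1}"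
  \<comment> \<open>These are the only integers in the open strip, and removing a finite set keeps
    it connected.\<close>
  let ?S = "?H - of_nat ` {..2 * N}"
  have op: "open ?H"
    using open_Int[OF open_halfspace_Re_gt open_halfspace_Re_lt] by (simp add: Collect_conj_eq)
  have conv: "convex ?H"
    using convex_Int[OF convex_halfspace_Re_gt convex_halfspace_Re_lt] by (simp add: Collect_conj_eq)
  have sub: "?S \<subseteq> ?H - \<int>"
  proof (intro subsetI DiffI)
    fix z assume z: "z \<in> ?S"
    show "z \<notin> \<int>"
    proof
      assume "z \<in> \<int>"
      then obtain k where k: "z = of_int k" by (elim Ints_cases)
      with z have "- 1 < k" "k < 2 * int N + 1" by auto
      then have "z = of_nat (nat k)" "nat k \<le> 2 * N" using k by auto
      then show False using z by blast
    qed
  qed auto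
  have nS: "\<nu> \<in> ?S" using \<nu> by auto
  let ?d = "\<lambda>\<nu>. 4 * of_real pi * expcos_Mellin x \<theta> \<psi> \<nu> - bessel_series_value x \<theta> \<psi> N \<nu>"
  have "?d \<nu> = 0"
  proof (rule analytic_continuation[where f="?d" and S="?S" and U="complex_of_real ` {0<..<1}" and \<xi>="of_real (1 / 2)"])
    show "?d holomorphic_on ?S"
      by (intro holomorphic_intros expcos_Mellin_holomorphic bessel_series_value_holomorphic sub x \<theta> \<psi>)
    show "open ?S" by (intro open_Diff op finite_imp_closed) auto
    show "connected ?S"
      by (rule connected_open_delete_finite) (use conv op in \<open>auto intro: convex_connected\<close>)
    show "complex_of_real ` {0<..<1} \<subseteq> ?S"
    proof
      fix z assume "z \<in> complex_of_real ` {0<..<1}"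
      then obtain t where t: "z = of_real t" "t \<in> {0<..<1}" by (rule imageE)
      have "z \<noteq> of_nat k" for k
      proof
        assume "z = of_nat k"
        then have "Re z = Re (of_nat k)" by simp
        then have "t = real k" using t by simp
        then show False using t(2) by auto
      qed
      then show "z \<in> ?S" using t by auto
    qed
    show "of_real (1 / 2) \<in> ?S"
    proof -
      have "complex_of_real (1 / 2) \<noteq> of_nat k" for k
      proof
        assume "complex_of_real (1 / 2) = of_nat k"
        then have "Re (complex_of_real (1 / 2)) = Re (of_nat k)" by (rule arg_cong)
        then have "1 / 2 = real k" by (simp only: Re_complex_of_real complex_Re_of_nat)
        then have "real (2 * k) = 1" by simp
        then have "2 * k = 1" by linarith
        then show False by presburger
      qed
      then show ?thesis by auto
    qed
    show "complex_of_real (1 / 2) islimpt complex_of_real ` {0<..<1}"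
      by (rule of_real_islimpt_image) auto
    \<comment> \<open>On (0, 1) the value for N equals the value for N = 0, where the termwise
      computation was carried out.\<close>
    show "?d z = 0" if zU: "z \<in> complex_of_real ` {0<..<1}" for z
    proof -
      obtain t where t: "z = of_real t" "t \<in> {0<..<1}" using zU by (rule imageE)
      then show ?thesis
        using expcos_Mellin_base[OF x \<theta> \<psi>, of t] bessel_series_value_0[OF x \<theta> \<psi>, of "of_real t" N] by simp
    qed
  qed (rule nS)
  then show ?thesis by simp
qed

section \<open>The Bessel series\<close>

text \<open>Translating y by ln a, that is scaling t by a, leaves the single parameter a b and the
  factor a^(-\<nu>).\<close>

lemma integral_exp_kern_scaled:
  assumes a: "0 < a" and b: "0 < b"
  shows "integrable lborel (\<lambda>y. exp (\<nu> * of_real y) * of_real (exp (- (a * exp y)) * exp (- (b * exp (- y)))))"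
    and "(\<integral>y. exp (\<nu> * of_real y) * of_real (exp (- (a * exp y)) * exp (- (b * exp (- y)))) \<partial>lborel) =
      of_real a powr (- \<nu>) * kern_int \<nu> (of_real (a * b))"
proof -
  have eq: "exp (\<nu> * of_real y) * of_real (exp (- (a * exp y)) * exp (- (b * exp (- y)))) =
     of_real a powr (- \<nu>) * kern \<nu> (of_real (a * b)) (ln a + 1 * y)" for y
  proof -
    have e: "exp (ln a + 1 * y) = a * exp y" "exp (- (ln a + 1 * y)) = exp (- y) / a"
      using a by (simp_all add: exp_add exp_diff exp_minus divide_inverse)
    have p: "of_real a powr (- \<nu>) = exp (- \<nu> * of_real (ln a))" using a by (simp add: powr_def Ln_of_real)
    have "of_real a powr (- \<nu>) * kern \<nu> (of_real (a * b)) (ln a + 1 * y) =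
       exp (- \<nu> * of_real (ln a) + (\<nu> * of_real (ln a + 1 * y) - of_real (a * exp y) - of_real (a * b) * of_real (exp (- y) / a)))"
      unfolding kern_def e p exp_add[symmetric] ..
    also have "- \<nu> * of_real (ln a) + (\<nu> * of_real (ln a + 1 * y) - of_real (a * exp y) - of_real (a * b) * of_real (exp (- y) / a)) =
       \<nu> * of_real y + of_real (- (a * exp y) + - (b * exp (- y)))"
      using a by (simp add: algebra_simps)
    finally show ?thesis by (simp only: exp_add exp_of_real of_real_mult)
  qed
  have w: "0 < Re (complex_of_real (a * b))" using a b by simp
  show "integrable lborel (\<lambda>y. exp (\<nu> * of_real y) * of_real (exp (- (a * exp y)) * exp (- (b * exp (- y)))))"
    unfolding eq by (intro integrable_mult_right lborel_integrable_real_affine[OF integrable_kern[OF w]]) auto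
  have "(\<integral>y. kern \<nu> (of_real (a * b)) (ln a + 1 * y) \<partial>lborel) = kern_int \<nu> (of_real (a * b))"
    unfolding kern_int_def by (subst (2) lborel_integral_real_affine[of 1 _ "ln a"]) auto
  then show "(\<integral>y. exp (\<nu> * of_real y) * of_real (exp (- (a * exp y)) * exp (- (b * exp (- y)))) \<partial>lborel) =
      of_real a powr (- \<nu>) * kern_int \<nu> (of_real (a * b))"
    unfolding eq by simp
qed

text \<open>Here a = 2 pi D and b = 2 pi m x. Then 2 sqrt (a b) is the Bessel argument, and in
  a^(-\<nu>) (a b)^(\<nu>/2) the powers of 2 pi cancel.\<close>

lemma exp_scaled_kern_int:
  assumes x: "0 < x" and \<nu>: "\<nu> \<notin> \<int>" and D: "0 < D" and m: "0 < m"
  shows "of_real (2 * pi * D) powr (- \<nu>) * kern_int \<nu> (of_real (2 * pi * D * (2 * pi * m * x))) =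
     2 * of_real D powr (- \<nu>) * of_real (D * m) powr (\<nu> / 2) * of_real x powr (\<nu> / 2) * bessel_K \<nu> (4 * pi * sqrt (D * m * x))"
proof -
  have w0: "0 < 2 * pi * D * (2 * pi * m * x)" using assms by simp
  have w: "2 * pi * D * (2 * pi * m * x) = (2 * pi)\<^sup>2 * (D * m * x)" by (simp add: power2_eq_square)
  have sq: "2 * sqrt (2 * pi * D * (2 * pi * m * x)) = 4 * pi * sqrt (D * m * x)"
    unfolding w real_sqrt_mult real_sqrt_abs by simp
  have lnw: "ln (2 * pi * D * (2 * pi * m * x)) = 2 * ln (2 * pi) + ln (D * m) + ln x"
  proof -
    have l: "ln (P\<^sup>2) = 2 * ln P" for P :: real using ln_realpow[of P 2] by simp
    have "ln ((2 * pi)\<^sup>2 * (D * m * x)) = ln ((2 * pi)\<^sup>2) + ln (D * m * x)" by (rule ln_mult_pos) (use assms in auto)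
    moreover have "ln (D * m * x) = ln (D * m) + ln x" by (rule ln_mult_pos) (use assms in auto)
    moreover have "ln ((2 * pi)\<^sup>2) = 2 * ln (2 * pi)" by (rule l)
    ultimately show ?thesis unfolding w by linarith
  qed
  have lnD: "ln (2 * pi * D) = ln (2 * pi) + ln D" using D by (simp add: ln_mult)
  have pw: "complex_of_real t powr s = exp (s * of_real (ln t))" if "0 < t" for t s
    using that by (simp add: powr_def Ln_of_real)
  have "of_real (2 * pi * D) powr (- \<nu>) * of_real (2 * pi * D * (2 * pi * m * x)) powr (\<nu> / 2) =
     exp (- \<nu> * of_real (ln (2 * pi * D)) + \<nu> / 2 * of_real (ln (2 * pi * D * (2 * pi * m * x))))"
    unfolding exp_add using w0 D by (subst (1 2) pw) auto
  also have "- \<nu> * of_real (ln (2 * pi * D)) + \<nu> / 2 * of_real (ln (2 * pi * D * (2 * pi * m * x))) =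
     - \<nu> * of_real (ln D) + \<nu> / 2 * of_real (ln (D * m)) + \<nu> / 2 * of_real (ln x)"
    unfolding lnw lnD by (simp add: field_simps)
  also have "exp \<dots> = of_real D powr (- \<nu>) * of_real (D * m) powr (\<nu> / 2) * of_real x powr (\<nu> / 2)"
    unfolding exp_add using D m x by (subst (1 2 3) pw) auto
  finally have p: "of_real (2 * pi * D) powr (- \<nu>) * of_real (2 * pi * D * (2 * pi * m * x)) powr (\<nu> / 2) =
     of_real D powr (- \<nu>) * of_real (D * m) powr (\<nu> / 2) * of_real x powr (\<nu> / 2)" .
  have "of_real (2 * pi * D) powr (- \<nu>) * kern_int \<nu> (of_real (2 * pi * D * (2 * pi * m * x))) =
     2 * (of_real (2 * pi * D) powr (- \<nu>) * of_real (2 * pi * D * (2 * pi * m * x)) powr (\<nu> / 2)) * bessel_K \<nu> (4 * pi * sqrt (D * m * x))"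
    unfolding kern_int_eq_bessel_K[OF w0 \<nu>] sq by (simp only: mult_ac)
  then show ?thesis unfolding p by (simp only: mult_ac)
qed

text \<open>Writing d for \<open>Suc d\<close>, the exponent 2 pi d t is at least t + d t: the first
  part keeps exp (- t) for the integral, the second gives the summable factor d^(-2).\<close>

lemma exp_Suc_le:
  fixes t :: real
  assumes "0 < t"
  shows "exp (- (2 * pi * real (Suc d) * t)) \<le> 2 * exp (- t) / ((real (Suc d))\<^sup>2 * t\<^sup>2)"
proof -
  have "2 * (real (Suc d) * t) \<le> 2 * pi * real (Suc d) * t"
    using assms pi_gt3 mult_right_mono[of 2 "2 * pi" "real (Suc d) * t"] by (simp add: mult_ac)
  moreover have "t \<le> real (Suc d) * t" using assms by simp
  ultimately have "exp (- (2 * pi * real (Suc d) * t)) \<le> exp (- t) * exp (- (real (Suc d) * t))"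
    by (subst exp_add[symmetric], subst exp_le_cancel_iff) linarith
  also have "\<dots> \<le> exp (- t) * (fact 2 / (real (Suc d) * t) ^ 2)"
    using assms by (intro mult_left_mono exp_minus_le_power) auto
  finally show ?thesis by (simp add: power_mult_distrib mult.commute)
qed

text \<open>The product of the two exponential series is integrated term by term, each term being a
  scaled Bessel kernel. The constant 8 pi is 4 pi times the factor 2 in
  \<open>kern_int_eq_bessel_K\<close>.\<close>

lemma bessel_double_series:
  assumes x: "0 < x" and \<theta>: "0 < \<theta>" "\<theta> < 1" and \<psi>: "0 < \<psi>" "\<psi> < 1" and \<nu>: "\<nu> \<notin> \<int>"
  shows "((\<lambda>(d, m). 8 * of_real pi * of_real x powr (\<nu> / 2) * of_real (real (Suc d) * real (Suc m)) powr (\<nu> / 2)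
       * bessel_K \<nu> (4 * pi * sqrt (real (Suc d) * real (Suc m) * x))
       * (of_real (real (Suc d)) powr (- \<nu>) * of_real (cos (2 * pi * real (Suc d) * \<theta>) * cos (2 * pi * real (Suc m) * \<psi>))))
     has_sum (4 * of_real pi * expcos_Mellin x \<theta> \<psi> \<nu>)) UNIV"
proof -
  define a where "a = (\<lambda>d y. exp (- (2 * pi * real (Suc d) * exp y)) * cos (2 * pi * real (Suc d) * \<theta>))"
  define b where "b = (\<lambda>m y. exp (- (2 * pi * real (Suc m) * (x * exp (- y)))) * cos (2 * pi * real (Suc m) * \<psi>))"
  define F where "F = (\<lambda>i y. exp (\<nu> * of_real y) * of_real (a (fst i) y * b (snd i) y))"
  have xe: "0 < x * exp (- y)" for y using x by simp
  have ab: "summable (\<lambda>d. norm (exp (- (2 * pi * real (Suc d) * t)) * cos (2 * pi * real (Suc d) * q)))" if "0 < t" for t q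
  proof (rule summable_comparison_test'[where N=0])
    have "summable (\<lambda>d. inverse (real (Suc d) ^ 2))"
      using inverse_power_summable[of 2, where 'a=real] by (subst summable_Suc_iff) auto
    then show "summable (\<lambda>d. 2 * exp (- t) / t\<^sup>2 * inverse (real (Suc d) ^ 2))" by (rule summable_mult)
    fix d :: nat
    have "norm (exp (- (2 * pi * real (Suc d) * t)) * cos (2 * pi * real (Suc d) * q)) \<le> exp (- (2 * pi * real (Suc d) * t)) * 1"
      unfolding norm_mult by (intro mult_mono) auto
    also have "\<dots> \<le> 2 * exp (- t) / t\<^sup>2 * inverse (real (Suc d) ^ 2)"
      using exp_Suc_le[OF that, of d] by (simp add: divide_inverse mult_ac)
    finally show "norm (norm (exp (- (2 * pi * real (Suc d) * t)) * cos (2 * pi * real (Suc d) * q))) \<le> 2 * exp (- t) / t\<^sup>2 * inverse (real (Suc d) ^ 2)"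
      by simp
  qed
  have an: "summable (\<lambda>d. norm (a d y))" "(\<lambda>d. a d y) sums expcos \<theta> (exp y)" for y
    unfolding a_def using ab[OF exp_gt_zero] expcos_sums[OF \<theta> exp_gt_zero] by auto
  have bn: "summable (\<lambda>m. norm (b m y))" "(\<lambda>m. b m y) sums expcos \<psi> (x * exp (- y))" for y
    unfolding b_def using ab[OF xe] expcos_sums[OF \<psi> xe] by auto
  have prod: "(\<lambda>i. norm (a (fst i) y * b (snd i) y)) summable_on UNIV"
    "((\<lambda>i. a (fst i) y * b (snd i) y) has_sum (expcos \<theta> (exp y) * expcos \<psi> (x * exp (- y)))) UNIV" for y
    using has_sum_product_pairs[OF an bn, of y y] by (simp_all add: case_prod_unfold)
  have nm: "(\<lambda>i. norm (F i y)) summable_on UNIV" for y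
    unfolding F_def norm_mult norm_of_real using prod(1)[of y] by (intro summable_on_cmult_right) simp
  have pt: "((\<lambda>i. F i y) has_sum exp (\<nu> * of_real y) * of_real (expcos \<theta> (exp y) * expcos \<psi> (x * exp (- y)))) UNIV" for y
    unfolding F_def by (intro has_sum_cmult_right has_sum_bounded_linear[OF bounded_linear_of_real] prod)
  define c where "c = (\<lambda>i. complex_of_real (cos (2 * pi * real (Suc (fst i)) * \<theta>) * cos (2 * pi * real (Suc (snd i)) * \<psi>)))"
  have Feq: "F i y = c i * (exp (\<nu> * of_real y) * of_real (exp (- (2 * pi * real (Suc (fst i)) * exp y)) * exp (- (2 * pi * real (Suc (snd i)) * x * exp (- y)))))" for i y
    unfolding F_def a_def b_def c_def by (simp add: mult_ac)
  have int: "integrable lborel (F i)" for i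
    unfolding Feq[abs_def] by (intro integrable_mult_right integral_exp_kern_scaled(1)) (use x in auto)
  have I: "(\<integral>y. F i y \<partial>lborel) = c i * (2 * of_real (real (Suc (fst i))) powr (- \<nu>) * of_real (real (Suc (fst i)) * real (Suc (snd i))) powr (\<nu> / 2) * of_real x powr (\<nu> / 2)
      * bessel_K \<nu> (4 * pi * sqrt (real (Suc (fst i)) * real (Suc (snd i)) * x)))" for i
  proof -
    have "(\<integral>y. F i y \<partial>lborel) = c i * (of_real (2 * pi * real (Suc (fst i))) powr (- \<nu>) * kern_int \<nu> (of_real (2 * pi * real (Suc (fst i)) * (2 * pi * real (Suc (snd i)) * x))))"
      unfolding Feq by (subst integral_mult_right_zero, subst integral_exp_kern_scaled(2)) (use x in auto)
    also have "of_real (2 * pi * real (Suc (fst i))) powr (- \<nu>) * kern_int \<nu> (of_real (2 * pi * real (Suc (fst i)) * (2 * pi * real (Suc (snd i)) * x))) =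
      2 * of_real (real (Suc (fst i))) powr (- \<nu>) * of_real (real (Suc (fst i)) * real (Suc (snd i))) powr (\<nu> / 2) * of_real x powr (\<nu> / 2)
      * bessel_K \<nu> (4 * pi * sqrt (real (Suc (fst i)) * real (Suc (snd i)) * x))"
      by (rule exp_scaled_kern_int[OF x \<nu>]) auto
    finally show ?thesis .
  qed
  define J where "J = (\<integral>y. norm (kern \<nu> (of_real x) y) \<partial>lborel)"
  have kint: "integrable lborel (\<lambda>y. norm (kern \<nu> (of_real x) y))"
    using integrable_kern[of "of_real x" \<nu>] x by simp
  \<comment> \<open>The factors (exp y)^2 and (x exp (- y))^2 in the two denominators multiply to
    x^2, so the bound separates into a summable factor \<open>h i\<close> and one integrable kernel
    in y.\<close>
  define h where "h = (\<lambda>i. 4 / x\<^sup>2 * (inverse (real (Suc (fst i)) ^ 2) * inverse (real (Suc (snd i)) ^ 2)))"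
  have bound: "norm (F i y) \<le> h i * norm (kern \<nu> (of_real x) y)" for i y
  proof -
    have A: "\<bar>a (fst i) y\<bar> \<le> 2 * exp (- exp y) / ((real (Suc (fst i)))\<^sup>2 * (exp y)\<^sup>2)"
    proof -
      have "\<bar>a (fst i) y\<bar> \<le> exp (- (2 * pi * real (Suc (fst i)) * exp y)) * 1"
        unfolding a_def abs_mult by (intro mult_mono) auto
      then show ?thesis using exp_Suc_le[of "exp y" "fst i"] by simp
    qed
    have B: "\<bar>b (snd i) y\<bar> \<le> 2 * exp (- (x * exp (- y))) / ((real (Suc (snd i)))\<^sup>2 * (x * exp (- y))\<^sup>2)"
    proof -
      have "\<bar>b (snd i) y\<bar> \<le> exp (- (2 * pi * real (Suc (snd i)) * (x * exp (- y)))) * 1"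
        unfolding b_def abs_mult by (intro mult_mono) auto
      then show ?thesis using exp_Suc_le[OF xe, of "snd i" y] by simp
    qed
    have "norm (F i y) = exp (Re \<nu> * y) * (\<bar>a (fst i) y\<bar> * \<bar>b (snd i) y\<bar>)"
      by (simp add: F_def norm_mult abs_mult)
    also have "\<dots> \<le> exp (Re \<nu> * y) * ((2 * exp (- exp y) / ((real (Suc (fst i)))\<^sup>2 * (exp y)\<^sup>2)) * (2 * exp (- (x * exp (- y))) / ((real (Suc (snd i)))\<^sup>2 * (x * exp (- y))\<^sup>2)))"
      by (rule mult_left_mono[OF mult_mono[OF A B]]) auto
    also have "\<dots> = h i * (exp (Re \<nu> * y) * exp (- exp y) * exp (- (x * exp (- y))))"
    proof -
      have "(exp y)\<^sup>2 * (x * exp (- y))\<^sup>2 = x\<^sup>2"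
      proof -
        have "exp y * exp (- y) = 1" by (simp flip: exp_add)
        moreover have "(exp y)\<^sup>2 * (x * exp (- y))\<^sup>2 = x\<^sup>2 * (exp y * exp (- y))\<^sup>2"
          by (simp only: power_mult_distrib mult_ac)
        ultimately show ?thesis by simp
      qed
      then have "(2 * exp (- exp y) / ((real (Suc (fst i)))\<^sup>2 * (exp y)\<^sup>2)) * (2 * exp (- (x * exp (- y))) / ((real (Suc (snd i)))\<^sup>2 * (x * exp (- y))\<^sup>2)) =
         4 * (exp (- exp y) * exp (- (x * exp (- y)))) / ((real (Suc (fst i)))\<^sup>2 * (real (Suc (snd i)))\<^sup>2 * x\<^sup>2)"
        by (simp add: mult_ac del: of_nat_Suc)
      then show ?thesis unfolding h_def by (simp add: divide_inverse mult_ac del: of_nat_Suc)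
    qed
    also have "exp (Re \<nu> * y) * exp (- exp y) * exp (- (x * exp (- y))) = norm (kern \<nu> (of_real x) y)"
      unfolding norm_kern by (simp flip: exp_add)
    finally show ?thesis .
  qed
  have sI: "(\<lambda>i. \<integral>y. norm (F i y) \<partial>lborel) summable_on UNIV"
  proof (rule summable_on_comparison_test)
    have s2: "summable (\<lambda>d. inverse (real (Suc d) ^ 2))"
      using inverse_power_summable[of 2, where 'a=real] by (subst summable_Suc_iff) auto
    have "((\<lambda>(d, m). inverse (real (Suc d) ^ 2) * inverse (real (Suc m) ^ 2)) has_sum ((\<Sum>d. inverse (real (Suc d) ^ 2)) * (\<Sum>d. inverse (real (Suc d) ^ 2)))) UNIV"
      by (rule has_sum_product_pairs(2)) (use s2 summable_sums[OF s2] in auto)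
    then have "(\<lambda>i. inverse (real (Suc (fst i)) ^ 2) * inverse (real (Suc (snd i)) ^ 2)) summable_on UNIV"
      by (simp add: case_prod_unfold has_sum_imp_summable)
    then show "(\<lambda>i. h i * J) summable_on UNIV"
      unfolding h_def by (intro summable_on_cmult_left summable_on_cmult_right)
    show "(\<integral>y. norm (F i y) \<partial>lborel) \<le> h i * J" for i
    proof -
      have "(\<integral>y. norm (F i y) \<partial>lborel) \<le> (\<integral>y. h i * norm (kern \<nu> (of_real x) y) \<partial>lborel)"
        using int kint bound by (intro integral_mono) auto
      then show ?thesis by (simp add: J_def)
    qed
  qed simp
  have "((\<lambda>i. \<integral>y. F i y \<partial>lborel) has_sum expcos_Mellin x \<theta> \<psi> \<nu>) UNIV"
    unfolding expcos_Mellin_def by (rule integral_has_sum_pairs(2)[OF int nm pt sI])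
  from has_sum_cmult_right[OF this, of "4 * of_real pi"]
  show ?thesis unfolding I by (rule has_sum_cong[THEN iffD1, rotated]) (simp add: c_def case_prod_unfold mult_ac)
qed

text \<open>Pairs (d, m) correspond to pairs (n, d) with d dividing n = d m. Each n has finitely
  many divisors, so the inner sums are finite, and the remaining unordered sum over n converges in
  the usual order too.\<close>

lemma has_sum_divisor_regroup:
  fixes f :: "nat \<Rightarrow> nat \<Rightarrow> complex"
  assumes "((\<lambda>(d, m). f (Suc d) (Suc m)) has_sum S) UNIV"
  shows "(\<lambda>k. \<Sum>d\<in>{d. d dvd Suc k}. f d (Suc k div d)) sums S"
proof -
  let ?A = "SIGMA k:UNIV. {d. d dvd Suc k}"
  have "((\<lambda>(k, d). f d (Suc k div d)) has_sum S) ?A \<longleftrightarrow> ((\<lambda>(d, m). f (Suc d) (Suc m)) has_sum S) UNIV"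
  \<comment> \<open>Indices start at 0: k stands for n - 1, and the pairs on the right hold d - 1
    and m - 1, which accounts for the shifts in the witnesses.\<close>
  proof (rule has_sum_reindex_bij_witness[where j="\<lambda>(k, d). (d - 1, Suc k div d - 1)" and i="\<lambda>(d, m). (Suc d * Suc m - 1, Suc d)"])
    fix p assume "p \<in> ?A"
    then obtain k d where p: "p = (k, d)" "d dvd Suc k" by auto
    then obtain m where m: "Suc k = d * m" by (elim dvdE)
    then have pos: "0 < d" "0 < m" by (auto intro: gr0I)
    have "Suc k div d = m" using m pos by simp
    then show "(case case p of (k, d) \<Rightarrow> (d - 1, Suc k div d - 1) of (d, m) \<Rightarrow> (Suc d * Suc m - 1, Suc d)) = p"
      using p pos by (simp add: m[symmetric] del: mult_Suc mult_Suc_right)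
    show "(case case p of (k, d) \<Rightarrow> (d - 1, Suc k div d - 1) of (d, m) \<Rightarrow> f (Suc d) (Suc m)) = (case p of (k, d) \<Rightarrow> f d (Suc k div d))"
      using p m pos by simp
  next
    fix q :: "nat \<times> nat"
    obtain d m where q: "q = (d, m)" by (cases q)
    have e: "Suc (Suc d * Suc m - 1) = Suc d * Suc m" by simp
    have dv: "Suc d * Suc m div Suc d = Suc m" by (rule nonzero_mult_div_cancel_left) simp
    show "(case case q of (d, m) \<Rightarrow> (Suc d * Suc m - 1, Suc d) of (k, d) \<Rightarrow> (d - 1, Suc k div d - 1)) = q"
      unfolding q prod.case e dv by simp
    show "(case q of (d, m) \<Rightarrow> (Suc d * Suc m - 1, Suc d)) \<in> ?A"
      unfolding q prod.case by (intro SigmaI UNIV_I CollectI) (simp only: e dvd_triv_left)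
  qed auto
  then have 1: "((\<lambda>(k, d). f d (Suc k div d)) has_sum S) ?A" using assms by simp
  have "((\<lambda>k. \<Sum>d\<in>{d. d dvd Suc k}. f d (Suc k div d)) has_sum S) UNIV"
  proof (rule has_sum_Sigma'[OF 1])
    fix k :: nat
    have "((\<lambda>d. f d (Suc k div d)) has_sum (\<Sum>d\<in>{d. d dvd Suc k}. f d (Suc k div d))) {d. d dvd Suc k}"
      by (rule has_sum_finite) auto
    then show "((\<lambda>d. case (k, d) of (k, d) \<Rightarrow> f d (Suc k div d)) has_sum (\<Sum>d\<in>{d. d dvd Suc k}. f d (Suc k div d))) {d. d dvd Suc k}"
      by simp
  qed
  then show ?thesis by (rule has_sum_imp_sums)
qed

lemma bessel_divisor_series:
  assumes "0 < x" "0 < \<theta>" "\<theta> < 1" "0 < \<psi>" "\<psi> < 1" "\<nu> \<notin> \<int>"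
  shows "(\<lambda>k. let n = Suc k in
            8 * of_real pi * (complex_of_real x) powr (\<nu> / 2) * (of_nat n) powr (\<nu> / 2)
            * bessel_K \<nu> (4 * pi * sqrt (real n * x))
            * (\<Sum>d\<in>{d. d dvd n}. (of_nat d) powr (- \<nu>)
                 * complex_of_real (cos (2 * pi * real d * \<theta>) * cos (2 * pi * real n * \<psi> / real d))))
         sums (4 * of_real pi * expcos_Mellin x \<theta> \<psi> \<nu>)" (is "?t sums _")
proof -
  define f where "f = (\<lambda>d m. 8 * of_real pi * of_real x powr (\<nu> / 2) * of_real (real d * real m) powr (\<nu> / 2)
       * bessel_K \<nu> (4 * pi * sqrt (real d * real m * x))
       * (of_real (real d) powr (- \<nu>) * of_real (cos (2 * pi * real d * \<theta>) * cos (2 * pi * real m * \<psi>))))"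
  have "(\<lambda>k. \<Sum>d\<in>{d. d dvd Suc k}. f d (Suc k div d)) sums (4 * of_real pi * expcos_Mellin x \<theta> \<psi> \<nu>)"
    by (rule has_sum_divisor_regroup) (use bessel_double_series[OF assms] in \<open>simp add: f_def\<close>)
  also have "(\<lambda>k. \<Sum>d\<in>{d. d dvd Suc k}. f d (Suc k div d)) =
     ?t"
  proof
    fix k
    have "f d (Suc k div d) = 8 * of_real pi * (complex_of_real x) powr (\<nu> / 2) * (of_nat (Suc k)) powr (\<nu> / 2)
            * bessel_K \<nu> (4 * pi * sqrt (real (Suc k) * x)) * ((of_nat d) powr (- \<nu>)
                 * complex_of_real (cos (2 * pi * real d * \<theta>) * cos (2 * pi * real (Suc k) * \<psi> / real d)))"
      if dv: "d dvd Suc k" for d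
    proof -
      obtain m where m: "Suc k = d * m" using dv by (elim dvdE)
      then have "0 < d" by (auto intro: gr0I)
      then have "Suc k div d = m" "real (Suc k) = real d * real m" using m by (simp_all flip: of_nat_mult)
      moreover have "2 * pi * (real d * real m) * \<psi> / real d = 2 * pi * real m * \<psi>" using \<open>0 < d\<close> by simp
      moreover have "of_nat (Suc k) = complex_of_real (real d * real m)"
        using calculation(2) by (metis of_real_of_nat_eq)
      ultimately show ?thesis unfolding f_def by (simp only: of_real_of_nat_eq)
    qed
    then show "(\<Sum>d\<in>{d. d dvd Suc k}. f d (Suc k div d)) = ?t k"
      unfolding Let_def sum_distrib_left by (intro sum.cong refl) simp
  qed
  finally show ?thesis .
qed

theorem theorem3p7:
  fixes x \<theta> \<psi> :: real and \<nu> :: complex and N :: nat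
  assumes hx: "0 < x"
    and h\<theta>: "0 < \<theta>" "\<theta> < 1"
    and h\<psi>: "0 < \<psi>" "\<psi> < 1"
    and h\<nu>: "\<nu> \<notin> \<int>" "0 \<le> Re \<nu>"
    and hN: "int N \<ge> \<lfloor>(Re \<nu> + 1) / 2\<rfloor>"
    and hexcl: "\<And>n r :: nat. 1 \<le> n \<Longrightarrow> 1 \<le> r \<Longrightarrow> x \<noteq> (real n - \<theta>) * (real r - \<psi>)"
  shows "(\<lambda>k. let n = Suc k in
            8 * of_real pi * (complex_of_real x) powr (\<nu> / 2) * (of_nat n) powr (\<nu> / 2)
            * bessel_K \<nu> (4 * pi * sqrt (real n * x))
            * (\<Sum>d\<in>{d. d dvd n}. (of_nat d) powr (- \<nu>)
                 * complex_of_real (cos (2 * pi * real d * \<theta>) * cos (2 * pi * real n * \<psi> / real d))))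
         sums
         (- (of_real pi * (complex_of_real x) powr \<nu> / (2 * cos (of_real pi * \<nu> / 2)))
              * (hurwitz_zeta (1 + \<nu>) \<psi> + hurwitz_zeta (1 + \<nu>) (1 - \<psi>))
          - of_real pi / (2 * cos (of_real pi * \<nu> / 2))
              * (hurwitz_zeta (1 - \<nu>) \<theta> + hurwitz_zeta (1 - \<nu>) (1 - \<theta>))
          + 1 / (2 * sin (of_real pi * \<nu> / 2))
              * (\<Sum>j = 1..N. complex_of_real (x ^ (2 * j - 1))
                   * (hurwitz_zeta (of_nat (2 * j)) \<psi> + hurwitz_zeta (of_nat (2 * j)) (1 - \<psi>))
                   * (hurwitz_zeta (of_nat (2 * j) - \<nu>) \<theta> + hurwitz_zeta (of_nat (2 * j) - \<nu>) (1 - \<theta>)))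
          + 1 / (2 * sin (of_real pi * \<nu> / 2)) * complex_of_real (x ^ (2 * N + 1))
              * (\<Sum>\<^sub>\<infinity>(m, n)\<in>(UNIV :: (nat \<times> nat) set).
                   G_fun x \<nu> N (real n + \<psi>) (real m + \<theta>)
                 + G_fun x \<nu> N (real n + 1 - \<psi>) (real m + \<theta>)
                 + G_fun x \<nu> N (real n + \<psi>) (real m + 1 - \<theta>)
                 + G_fun x \<nu> N (real n + 1 - \<psi>) (real m + 1 - \<theta>)))"
proof -
  \<comment> \<open>The floor condition says (Re \<nu> + 1) / 2 < N + 1, that is Re \<nu> < 2 N + 1,
    the right edge of the strip; the left edge is covered by Re \<nu> >= 0.\<close>
  have "\<lfloor>(Re \<nu> + 1) / 2\<rfloor> < int N + 1" using hN by simp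
  then have "(Re \<nu> + 1) / 2 < real_of_int (int N + 1)" by (simp only: floor_less_iff)
  then have re: "- 1 < Re \<nu>" "Re \<nu> < 2 * real N + 1" using h\<nu>(2) by auto
  have G: "G_sym x \<theta> \<psi> N \<nu> = (\<Sum>\<^sub>\<infinity>(m, n)\<in>(UNIV :: (nat \<times> nat) set).
                   G_fun x \<nu> N (real n + \<psi>) (real m + \<theta>)
                 + G_fun x \<nu> N (real n + 1 - \<psi>) (real m + \<theta>)
                 + G_fun x \<nu> N (real n + \<psi>) (real m + 1 - \<theta>)
                 + G_fun x \<nu> N (real n + 1 - \<psi>) (real m + 1 - \<theta>))"
  proof -
    \<comment> \<open>Each of the four families is summable by itself, so they may be added termwise
      into one unordered sum.\<close>
    have s: "((\<lambda>(m, n). G_fun x \<nu> N (real n + p) (real m + q)) has_sum G_sum x p q N \<nu>) UNIV" if "0 < p" "0 < q" for p q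
      unfolding G_sum_def by (rule has_sum_infsum[OF G_fun_summable[OF hx that re]])
    have "((\<lambda>i. (case i of (m, n) \<Rightarrow> G_fun x \<nu> N (real n + \<psi>) (real m + \<theta>)) + (case i of (m, n) \<Rightarrow> G_fun x \<nu> N (real n + (1 - \<psi>)) (real m + \<theta>))
       + (case i of (m, n) \<Rightarrow> G_fun x \<nu> N (real n + \<psi>) (real m + (1 - \<theta>))) + (case i of (m, n) \<Rightarrow> G_fun x \<nu> N (real n + (1 - \<psi>)) (real m + (1 - \<theta>))))
       has_sum G_sym x \<theta> \<psi> N \<nu>) UNIV"
      unfolding G_sym_def using h\<theta> h\<psi> by (intro has_sum_add s) auto
    then show ?thesis
      by (intro infsumI[symmetric]) (simp add: case_prod_unfold add_diff_eq)
  qed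
  show ?thesis
    using bessel_divisor_series[OF hx h\<theta> h\<psi> h\<nu>(1)]
    unfolding expcos_Mellin_eq[OF hx h\<theta> h\<psi> re h\<nu>(1)] bessel_series_value_def zeta_sym_def G .
qed

end
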